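(* Let $N>2$ be an integer, let $1\le q<2$, and let $\Omega\subset\mathbb{R}^N$ be a bounded open set containing the origin. Let $u\in H_0^1(\Omega)$ be a non-negative function, $u\not\equiv 0$. Then there exists a spherically symmetric decreasing function $\overline{u}\in H_0^1(\Omega^\#)$ such that $|\nabla\overline{u}|^{*}=|\nabla u|^{*}$ and $$\frac{\displaystyle\int_{\Omega}|\nabla u|^{2}\,dx-\frac{(N-2)^{2}}{4}\int_{\Omega}\frac{u^{2}}{|x|^{2}}\,dx}{\big\||\nabla u|\big\|_{L^q(\Omega)}^{2}}\;\geq\;\frac{\displaystyle\int_{\Omega^\#}|\nabla\overline{u}|^{2}\,dx-\frac{(N-2)^{2}}{4}\int_{\Omega^\#}\frac{\overline{u}^{2}}{|x|^{2}}\,dx}{\big\||\nabla\overline{u}|\big\|_{L^q(\Omega^\#)}^{2}}.$$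
   Context: $\Omega^\#$ is the open ball of $\mathbb{R}^N$ centered at the origin with the same Lebesgue measure $|\Omega|$ as $\Omega$. For a measurable function $f$ defined on a set of measure $|\Omega|$, $f^*$ denotes its one-dimensional decreasing rearrangement, i.e. the decreasing right-continuous function on $[0,|\Omega|]$ with the same distribution function as $|f|$. "Spherically symmetric decreasing" means depending only on $|x|$ and decreasing (non-increasing) in $|x|$. *)

theory Defs
  imports "HOL-Analysis.Analysis"
begin

text \<open>
  Functions on an open set \<open>\<Omega>\<close> are represented by total functions on the ambient space whose
  values outside \<open>\<Omega>\<close> are irrelevant. Elements of Lebesgue and Sobolev spaces are functions rather
  than classes of functions agreeing almost everywhere; membership and norms depend only on
  the class.
\<close>

section \<open>Lebesgue spaces\<close>

definition Lp :: "real \<Rightarrow> 'a::euclidean_space set \<Rightarrow> ('a \<Rightarrow> 'b::euclidean_space) set" where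
  "Lp p \<Omega> = {f \<in> borel_measurable (lebesgue_on \<Omega>).
               integrable (lebesgue_on \<Omega>) (\<lambda>x. norm (f x) powr p)}"

definition Lp_norm :: "real \<Rightarrow> 'a::euclidean_space set \<Rightarrow> ('a \<Rightarrow> 'b::euclidean_space) \<Rightarrow> real" where
  "Lp_norm p \<Omega> f = (\<integral>x. norm (f x) powr p \<partial>lebesgue_on \<Omega>) powr (1 / p)"

definition locally_integrable :: "'a::euclidean_space set \<Rightarrow> ('a \<Rightarrow> 'b::euclidean_space) \<Rightarrow> bool" where
  "locally_integrable \<Omega> f \<longleftrightarrow> f \<in> borel_measurable (lebesgue_on \<Omega>) \<and>
     (\<forall>K. compact K \<and> K \<subseteq> \<Omega> \<longrightarrow> integrable (lebesgue_on K) f)"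


section \<open>The Sobolev spaces \<open>H\<^sup>1\<close> and \<open>H\<^sub>0\<^sup>1\<close>\<close>

primrec continuously_differentiable :: "nat \<Rightarrow> ('a::euclidean_space \<Rightarrow> real) \<Rightarrow> bool" where
  "continuously_differentiable 0 f \<longleftrightarrow> continuous_on UNIV f"
| "continuously_differentiable (Suc k) f \<longleftrightarrow> (\<forall>x. f differentiable (at x)) \<and>
     (\<forall>v. continuously_differentiable k (\<lambda>x. frechet_derivative f (at x) v))"

definition test_functions :: "'a::euclidean_space set \<Rightarrow> ('a \<Rightarrow> real) set" where
  "test_functions \<Omega> = {\<phi>. (\<forall>k. continuously_differentiable k \<phi>) \<and>
     compact (closure {x. \<phi> x \<noteq> 0}) \<and> closure {x. \<phi> x \<noteq> 0} \<subseteq> \<Omega>}"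

definition gradient :: "('a::euclidean_space \<Rightarrow> real) \<Rightarrow> 'a \<Rightarrow> 'a" where
  "gradient \<phi> x = (\<Sum>b\<in>Basis. frechet_derivative \<phi> (at x) b *\<^sub>R b)"

text \<open>The weak gradient is determined only up to null sets, hence a relation.\<close>

definition has_weak_gradient ::
    "'a::euclidean_space set \<Rightarrow> ('a \<Rightarrow> real) \<Rightarrow> ('a \<Rightarrow> 'a) \<Rightarrow> bool" where
  "has_weak_gradient \<Omega> u g \<longleftrightarrow> locally_integrable \<Omega> u \<and> locally_integrable \<Omega> g \<and>
     (\<forall>\<phi>\<in>test_functions \<Omega>.
        (\<integral>x. u x *\<^sub>R gradient \<phi> x \<partial>lebesgue_on \<Omega>) = - (\<integral>x. \<phi> x *\<^sub>R g x \<partial>lebesgue_on \<Omega>))"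

definition H1 :: "'a::euclidean_space set \<Rightarrow> ('a \<Rightarrow> real) set" where
  "H1 \<Omega> = {u \<in> Lp 2 \<Omega>. \<exists>g\<in>Lp 2 \<Omega>. has_weak_gradient \<Omega> u g}"

text \<open>The closure of the test functions in \<open>H\<^sup>1\<close>.\<close>

definition H10 :: "'a::euclidean_space set \<Rightarrow> ('a \<Rightarrow> real) set" where
  "H10 \<Omega> = {u \<in> H1 \<Omega>. \<exists>g\<in>Lp 2 \<Omega>. has_weak_gradient \<Omega> u g \<and>
     (\<exists>\<phi>. (\<forall>k. \<phi> k \<in> test_functions \<Omega>) \<and>
        (\<lambda>k::nat. Lp_norm 2 \<Omega> (\<lambda>x. \<phi> k x - u x)) \<longlonglongrightarrow> 0 \<and>
        (\<lambda>k. Lp_norm 2 \<Omega> (\<lambda>x. gradient (\<phi> k) x - g x)) \<longlonglongrightarrow> 0)}"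


section \<open>Symmetrization\<close>

definition symmetrized_ball :: "'a::euclidean_space set \<Rightarrow> 'a set" where
  "symmetrized_ball \<Omega> = ball 0 (THE r. 0 \<le> r \<and> measure lebesgue (ball 0 r :: 'a set) = measure lebesgue \<Omega>)"

text \<open>
  The origin is excluded: an element of \<open>H\<^sub>0\<^sup>1\<close> may be unbounded there, and requiring
  \<open>v x \<le> v 0\<close> for a real-valued \<open>v\<close> would force \<open>v\<close> to be bounded above. Points with the same norm
  are compared in both directions, so the condition includes radial symmetry.
\<close>

definition spherically_symmetric_decreasing_on ::
    "'a::euclidean_space set \<Rightarrow> ('a \<Rightarrow> real) \<Rightarrow> bool" where
  "spherically_symmetric_decreasing_on B v \<longleftrightarrow>
     (\<forall>x\<in>B - {0}. \<forall>y\<in>B - {0}. norm x \<le> norm y \<longrightarrow> v y \<le> v x)"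

text \<open>
  The value at \<open>0\<close> is the essential supremum of \<open>\<bar>f\<bar>\<close>, which may be infinite, hence the range
  \<^typ>\<open>ennreal\<close>. Monotonicity and equidistribution do not determine the value at the right
  endpoint \<open>\<bar>\<Omega>\<bar>\<close>; it is fixed to be \<open>0\<close>, as are the values outside \<open>[0, \<bar>\<Omega>\<bar>]\<close>.
\<close>

definition is_decreasing_rearrangement ::
    "'a::euclidean_space set \<Rightarrow> ('a \<Rightarrow> real) \<Rightarrow> (real \<Rightarrow> ennreal) \<Rightarrow> bool" where
  "is_decreasing_rearrangement \<Omega> f h \<longleftrightarrow>
     antimono_on {0..measure lebesgue \<Omega>} h \<and>
     (\<forall>s\<in>{0..<measure lebesgue \<Omega>}. continuous (at_right s) h) \<and>
     (\<forall>t\<ge>0. emeasure lebesgue {s \<in> {0..measure lebesgue \<Omega>}. ennreal t < h s}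
            = emeasure lebesgue {x \<in> \<Omega>. t < \<bar>f x\<bar>}) \<and>
     (\<forall>s. s \<notin> {0..<measure lebesgue \<Omega>} \<longrightarrow> h s = 0)"

definition decreasing_rearrangement ::
    "'a::euclidean_space set \<Rightarrow> ('a \<Rightarrow> real) \<Rightarrow> real \<Rightarrow> ennreal" where
  "decreasing_rearrangement \<Omega> f = (THE h. is_decreasing_rearrangement \<Omega> f h)"


section \<open>Well-definedness\<close>

lemma symmetrized_ball_ex1:
  fixes \<Omega> :: "'a::euclidean_space set"
  shows "\<exists>!r. 0 \<le> r \<and> measure lebesgue (ball 0 r :: 'a set) = measure lebesgue \<Omega>"
proof -
  define n where "n = DIM('a)"
  define V where "V = unit_ball_vol (real n)"
  define m where "m = measure lebesgue \<Omega>"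
  have n: "n > 0" by (simp add: n_def)
  have V: "V > 0" by (simp add: V_def)
  have m: "m \<ge> 0" by (simp add: m_def)
  have ball: "measure lebesgue (ball 0 r :: 'a set) = V * r ^ n" if "r \<ge> 0" for r
    using content_ball[OF that, of "0::'a"] by (simp add: V_def n_def)
  show ?thesis
    unfolding m_def[symmetric]
  proof (rule ex1I[of _ "root n (m / V)"])
    show "0 \<le> root n (m / V) \<and> measure lebesgue (ball 0 (root n (m / V)) :: 'a set) = m"
      using ball[of "root n (m / V)"] n V m by simp
  next
    fix r assume "0 \<le> r \<and> measure lebesgue (ball 0 r :: 'a set) = m"
    then have "r ^ n = m / V" and "r \<ge> 0" using V ball[of r] by (auto simp: field_simps)
    then show "r = root n (m / V)"
      using n by (metis real_root_power_cancel)
  qed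
qed

lemma measure_symmetrized_ball:
  fixes \<Omega> :: "'a::euclidean_space set"
  shows "measure lebesgue (symmetrized_ball \<Omega>) = measure lebesgue \<Omega>"
  unfolding symmetrized_ball_def using theI'[OF symmetrized_ball_ex1[of \<Omega>]] by simp

lemma decreasing_rearrangement_unique:
  assumes h1: "is_decreasing_rearrangement \<Omega> f h1" and h2: "is_decreasing_rearrangement \<Omega> f h2"
  shows "h1 s \<ge> h2 s"
proof (rule ccontr)
  define M where "M = measure lebesgue \<Omega>"
  assume "\<not> h1 s \<ge> h2 s"
  then have less: "h1 s < h2 s" by simp
  then have "h2 s \<noteq> 0" by auto
  then have "s \<in> {0..<M}"
    using h2 unfolding is_decreasing_rearrangement_def M_def by blast
  then have s: "0 \<le> s" "s < M" by auto
  obtain t' where t': "h1 s < t'" "t' < h2 s" using less dense by blast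
  then obtain t where t: "t \<ge> 0" "t' = ennreal t" by (cases t') auto
  have "antimono_on {0..M} h1" "antimono_on {0..M} h2"
    using h1 h2 unfolding is_decreasing_rearrangement_def M_def by blast+
  then have anti: "h y \<le> h x" if "h \<in> {h1, h2}" "0 \<le> x" "x \<le> y" "y \<le> M" for h x y
    using that by (elim insertE emptyE) (auto elim!: monotone_onD)
  have "(h2 \<longlongrightarrow> h2 s) (at_right s)"
    using h2 s unfolding is_decreasing_rearrangement_def M_def continuous_within by auto
  then have "\<forall>\<^sub>F y in at_right s. t' < h2 y" using t'(2) by (rule order_tendstoD)
  then obtain b where b: "b > s" "\<And>y. s < y \<Longrightarrow> y < b \<Longrightarrow> t' < h2 y"
    unfolding eventually_at_right_field by auto
  define c where "c = (s + min b M) / 2"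
  have c: "s < c" "c < b" "c < M" using b s by (auto simp: c_def min_def)
  have "t' < h2 y" if "0 \<le> y" "y \<le> c" for y
    using anti[of h2 y c] b(2)[of c] that c by auto
  then have sub2: "{0..c} \<subseteq> {s \<in> {0..M}. ennreal t < h2 s}" using c t by auto
  have sub1: "{s \<in> {0..M}. ennreal t < h1 s} \<subseteq> {0..s}"
  proof
    fix y assume "y \<in> {s \<in> {0..M}. ennreal t < h1 s}"
    then have y: "0 \<le> y" "y \<le> M" "t' < h1 y" using t by auto
    have "\<not> s \<le> y"
    proof
      assume "s \<le> y"
      then have "h1 y \<le> h1 s" using anti[of h1 s y] s y by simp
      with y(3) t'(1) show False by (meson leD less_trans)
    qed
    with y show "y \<in> {0..s}" by simp
  qed
  have eq: "emeasure lebesgue {s \<in> {0..M}. ennreal t < h2 s}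
          = emeasure lebesgue {s \<in> {0..M}. ennreal t < h1 s}"
    using h1 h2 t unfolding is_decreasing_rearrangement_def M_def by auto
  have "convex {s \<in> {0..M}. ennreal t < h2 s}"
    unfolding is_interval_convex_1[symmetric] is_interval_1
    using anti[of h2] by (auto intro: less_le_trans)
  then have meas: "{s \<in> {0..M}. ennreal t < h2 s} \<in> sets lebesgue"
    by (intro fmeasurableD measurable_convex) (auto intro: bounded_subset[of "{0..M}"])
  have "ennreal c = emeasure lebesgue {0..c}" using s c by simp
  also have "\<dots> \<le> emeasure lebesgue {s \<in> {0..M}. ennreal t < h2 s}"
    using sub2 meas by (rule emeasure_mono)
  also have "\<dots> \<le> emeasure lebesgue {0..s}"
    unfolding eq using sub1 by (rule emeasure_mono) auto
  also have "\<dots> = ennreal s" using s by simp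
  finally show False using s c by (simp add: ennreal_le_iff)
qed

lemma decreasing_rearrangement_exists:
  fixes f :: "'a::euclidean_space \<Rightarrow> real"
  assumes \<Omega>: "\<Omega> \<in> lmeasurable" and f: "f \<in> borel_measurable (lebesgue_on \<Omega>)"
  shows "\<exists>h. is_decreasing_rearrangement \<Omega> f h"
proof -
  define M where "M = measure lebesgue \<Omega>"
  define S where "S t = {x \<in> \<Omega>. t < ennreal \<bar>f x\<bar>}" for t
  define D where "D t = emeasure lebesgue (S t)" for t
  define h where "h s = (if s \<in> {0..<M} then Inf {t. D t \<le> ennreal s} else 0)" for s :: real
  have S: "S t \<in> sets lebesgue" for t
  proof -
    have "{x \<in> space (lebesgue_on \<Omega>). t < ennreal \<bar>f x\<bar>} \<in> sets (lebesgue_on \<Omega>)"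
      using f by measurable
    then show ?thesis
      using \<Omega> by (simp add: S_def sets_restrict_space_iff fmeasurableD)
  qed
  have D_le: "D t \<le> ennreal M" for t
    unfolding D_def M_def emeasure_eq_measure2[OF \<Omega>, symmetric]
    using \<Omega> by (intro emeasure_mono) (auto simp: S_def fmeasurableD)
  have D_anti: "D t' \<le> D t" if "t \<le> t'" for t t'
    unfolding D_def using that S by (intro emeasure_mono) (auto simp: S_def)
  have h_less: "t < h s \<longleftrightarrow> ennreal s < D t" if s: "s \<in> {0..<M}" for s t
  proof -
    define A where "A = {t. D t \<le> ennreal s}"
    have hs: "h s = Inf A" using s by (simp add: h_def A_def)
    have "S top = {}" by (auto simp: S_def)
    then have "top \<in> A" by (simp add: A_def D_def)
    then have "A \<noteq> {}" by auto
    from ennreal_Inf_countable_INF[OF this] obtain a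
      where a: "decseq a" "range a \<subseteq> A" "Inf A = (INF i. a i)" by blast
    have "S (Inf A) = (\<Union>i. S (a i))"
      by (auto simp: S_def a(3) INF_less_iff)
    moreover have "incseq (\<lambda>i. S (a i))"
      using a(1) by (auto simp: S_def incseq_def decseq_def intro: le_less_trans)
    ultimately have "D (Inf A) = (SUP i. D (a i))"
      using SUP_emeasure_incseq[of "\<lambda>i. S (a i)" lebesgue] S by (simp add: D_def image_subset_iff)
    also have "\<dots> \<le> ennreal s" using a(2) by (auto simp: A_def intro!: SUP_least)
    finally have *: "D (Inf A) \<le> ennreal s" .
    have "h s \<le> t \<longleftrightarrow> D t \<le> ennreal s"
      using * D_anti[of "Inf A" t] by (auto simp: hs intro: order_trans Inf_lower simp: A_def)
    then show ?thesis by (meson not_le)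
  qed
  have anti: "h y \<le> h x" if "0 \<le> x" "x \<le> y" for x y
  proof (cases "y < M")
    case True
    then show ?thesis
      using that h_less[of x "h x"] h_less[of y "h x"]
      by (metis atLeastLessThan_iff ennreal_leI le_less_trans not_le order_less_irrefl order_trans)
  qed (simp add: h_def)
  have 1: "continuous (at_right s) h" if s: "s \<in> {0..<M}" for s
    unfolding continuous_within
  proof (rule order_tendstoI)
    fix a assume "a < h s"
    then have a: "ennreal s < D a" using h_less s by simp
    then obtain b where b: "D a = ennreal b" "s < b" "b \<le> M"
      using D_le[of a] s by (cases "D a") (auto simp: ennreal_less_iff top_unique)
    have "\<forall>\<^sub>F y in at_right s. y < b \<and> y > s"
      using b by (auto simp: eventually_at_right_field)
    then show "\<forall>\<^sub>F y in at_right s. a < h y"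
    proof eventually_elim
      case (elim y)
      then show ?case using s b h_less[of y a] by (simp add: ennreal_less_iff)
    qed
  next
    fix a assume "h s < a"
    have "\<forall>\<^sub>F y in at_right s. y > s" by (auto simp: eventually_at_right_less)
    then show "\<forall>\<^sub>F y in at_right s. h y < a"
    proof eventually_elim
      case (elim y)
      then have "h y \<le> h s" using s anti[of s y] by simp
      then show ?case using \<open>h s < a\<close> by (rule le_less_trans)
    qed
  qed
  have 2: "emeasure lebesgue {s \<in> {0..M}. ennreal t < h s}
      = emeasure lebesgue {x \<in> \<Omega>. t < \<bar>f x\<bar>}" if t: "t \<ge> 0" for t
  proof -
    obtain b where b: "D (ennreal t) = ennreal b" "0 \<le> b" "b \<le> M"
      using D_le[of "ennreal t"] by (cases "D (ennreal t)") (auto simp: M_def top_unique)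
    have "s \<in> {0..M} \<and> ennreal t < h s \<longleftrightarrow> s \<in> {0..<b}" for s
    proof (cases "s \<in> {0..<M}")
      case True
      then have "ennreal t < h s \<longleftrightarrow> s < b"
        using h_less[OF True, of "ennreal t"] by (simp add: b(1) ennreal_less_iff)
      with True show ?thesis by simp
    next
      case False
      then have "h s = 0" unfolding h_def by (rule if_not_P)
      with False b show ?thesis by auto
    qed
    then have "{s \<in> {0..M}. ennreal t < h s} = {0..<b}"
      unfolding set_eq_iff mem_Collect_eq by (rule allI)
    then have "emeasure lebesgue {s \<in> {0..M}. ennreal t < h s} = D (ennreal t)"
      using b by simp
    then show ?thesis using t by (simp add: D_def S_def ennreal_less_iff)
  qed
  have 3: "h s = 0" if "s \<notin> {0..<M}" for s
    unfolding h_def using that by (rule if_not_P)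
  have 4: "antimono_on {0..M} h"
    by (rule monotone_onI) (simp add: anti)
  have "is_decreasing_rearrangement \<Omega> f h"
    unfolding is_decreasing_rearrangement_def M_def[symmetric]
    by (intro conjI ballI allI impI 1 2 3 4)
  then show ?thesis by blast
qed

lemma decreasing_rearrangement_is:
  fixes f :: "'a::euclidean_space \<Rightarrow> real"
  assumes "\<Omega> \<in> lmeasurable" and "f \<in> borel_measurable (lebesgue_on \<Omega>)"
  shows "is_decreasing_rearrangement \<Omega> f (decreasing_rearrangement \<Omega> f)"
proof -
  obtain h where h: "is_decreasing_rearrangement \<Omega> f h"
    using decreasing_rearrangement_exists[OF assms] by blast
  have "h' = h" if "is_decreasing_rearrangement \<Omega> f h'" for h'
    using decreasing_rearrangement_unique[OF that h] decreasing_rearrangement_unique[OF h that]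
    by (intro ext antisym)
  with h show ?thesis unfolding decreasing_rearrangement_def by (rule theI)
qed

end

theory Submission
  imports Defs
begin

text \<open>
  Functions whose gradients have equimeasurable norms share every \<open>L\<^sup>p\<close> norm of the gradient, so
  only the weighted integral of \<open>u\<^sup>2\<close> has to be compared. Let \<open>f\<close> be the symmetric decreasing
  rearrangement of \<open>\<bar>\<nabla>u\<bar>\<close>, and let \<open>v(x)\<close> be the integral of \<open>f\<close> along the ray from \<open>x\<close> to
  infinity. Then \<open>\<bar>\<nabla>v\<bar> = f\<close>, and \<open>v\<close> is radial and decreasing.

  Integrating \<open>\<nabla>u\<close> along the same ray gives \<open>\<bar>u(x)\<bar> / \<bar>x\<bar> \<le> \<integral>\<^sub>1\<^sup>\<infinity> \<bar>\<nabla>u\<bar>(s x) ds\<close>, and for \<open>v\<close> this is an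
  equality. After squaring, \<open>\<integral> u\<^sup>2 / \<bar>x\<bar>\<^sup>2\<close> is at most the integral over \<open>s, t \<ge> 1\<close> of
  \<open>\<integral> \<bar>\<nabla>u\<bar>(s x) \<bar>\<nabla>u\<bar>(t x) dx\<close>. The superlevel sets of \<open>f(s x)\<close> and \<open>f(t x)\<close> are concentric balls with
  the same volumes as those of \<open>\<bar>\<nabla>u\<bar>(s x)\<close> and \<open>\<bar>\<nabla>u\<bar>(t x)\<close>. Concentric balls are nested, hence meet in
  the largest possible volume, so replacing \<open>\<bar>\<nabla>u\<bar>\<close> by \<open>f\<close> can only increase the inner integral,
  for each pair \<open>s, t\<close> separately. This is \<open>ray_integral_rearrangement\<close>, the heart of the proof.

  The rest justifies the two uses of the ray integral. It is a bounded operator on \<open>L\<^sup>2\<close> in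
  dimension at least three (\<open>Hardy_inequality_ray_integral\<close>). For \<open>u\<close>, this carries the pointwise
  bound over from approximating test functions (\<open>H10_ray_bound\<close>); that the given weak gradient is
  the limit of their gradients is \<open>weak_gradient_unique\<close>. For \<open>v\<close>, membership in \<open>H\<^sub>0\<^sup>1\<close> asks for
  test functions whose gradients approximate the field of direction \<open>-x\<close> and length \<open>f(x)\<close>
  (\<open>gradient_limit_radial_field\<close>); by the same bound the functions converge once their gradients do.
\<close>


section \<open>Smooth functions and cut-offs\<close>

lemma continuously_differentiable_continuous:
  assumes "continuously_differentiable k f"
  shows "continuous_on UNIV f"
proof (cases k)
  case (Suc j)
  then have "f differentiable_on UNIV"
    using assms by (intro differentiable_at_imp_differentiable_on) auto
  then show ?thesis by (rule differentiable_imp_continuous_on)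
qed (use assms in simp)

lemma continuously_differentiable_Suc_D:
  "continuously_differentiable (Suc k) f \<Longrightarrow> continuously_differentiable k f"
proof (induction k arbitrary: f)
  case 0
  then have "continuous_on UNIV f" by (rule continuously_differentiable_continuous)
  then show ?case by simp
next
  case (Suc k)
  then show ?case by (metis continuously_differentiable.simps(2))
qed

text \<open>
  A formula for the derivative suffices, so the Frechet derivative never has to be computed separately.
\<close>

lemma continuously_differentiable_SucI:
  assumes "\<And>x. (f has_derivative f' x) (at x)" and "\<And>v. continuously_differentiable k (\<lambda>x. f' x v)"
  shows "continuously_differentiable (Suc k) f"
proof -
  have "frechet_derivative f (at x) = f' x" for x
    using assms(1)[of x] by (metis frechet_derivative_at)
  then show ?thesis using assms by (auto simp: differentiable_def)
qed

lemma continuously_differentiable_Suc_derivative: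
  assumes "continuously_differentiable (Suc k) f"
  shows "(f has_derivative frechet_derivative f (at x)) (at x)"
  using assms frechet_derivative_works by auto

lemma continuously_differentiable_const: "continuously_differentiable k (\<lambda>_. c)"
proof (induction k arbitrary: c)
  case (Suc k)
  show ?case by (rule continuously_differentiable_SucI[where f' = "\<lambda>_ _. 0"]) (auto intro: Suc.IH)
qed simp

lemma continuously_differentiable_inner: "continuously_differentiable k (\<lambda>x. x \<bullet> b)"
proof (cases k)
  case (Suc k)
  show ?thesis unfolding Suc
    by (rule continuously_differentiable_SucI[where f' = "\<lambda>_ v. v \<bullet> b"])
       (auto intro!: continuously_differentiable_const derivative_eq_intros)
qed (auto intro!: continuous_intros)

lemma continuously_differentiable_add:
  "continuously_differentiable k f \<Longrightarrow> continuously_differentiable k g \<Longrightarrow>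
    continuously_differentiable k (\<lambda>x. f x + g x)"
proof (induction k arbitrary: f g)
  case 0 then show ?case by (auto intro!: continuous_intros)
next
  case (Suc k)
  show ?case
    by (rule continuously_differentiable_SucI
          [OF has_derivative_add[OF Suc.prems[THEN continuously_differentiable_Suc_derivative]]])
       (use Suc in auto)
qed

lemma continuously_differentiable_mult:
  "continuously_differentiable k f \<Longrightarrow> continuously_differentiable k g \<Longrightarrow>
    continuously_differentiable k (\<lambda>x. f x * g x)"
proof (induction k arbitrary: f g)
  case 0 then show ?case by (auto intro!: continuous_intros)
next
  case (Suc k)
  show ?case
  proof (rule continuously_differentiable_SucI
          [OF has_derivative_mult[OF Suc.prems[THEN continuously_differentiable_Suc_derivative]]])
    show "continuously_differentiable k
        (\<lambda>x. f x * frechet_derivative g (at x) v + frechet_derivative f (at x) v * g x)" for v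
      using Suc.prems[THEN continuously_differentiable_Suc_D] Suc.prems
      by (intro continuously_differentiable_add Suc.IH) auto
  qed
qed

lemma continuously_differentiable_cmult:
  "continuously_differentiable k f \<Longrightarrow> continuously_differentiable k (\<lambda>x. c * f x)"
  by (intro continuously_differentiable_mult continuously_differentiable_const)

lemma continuously_differentiable_sum:
  "(\<And>i. i \<in> I \<Longrightarrow> continuously_differentiable k (f i)) \<Longrightarrow>
    continuously_differentiable k (\<lambda>x. \<Sum>i\<in>I. f i x)"
  by (induction I rule: infinite_finite_induct)
     (auto intro!: continuously_differentiable_const continuously_differentiable_add)

lemma continuously_differentiable_prod:
  "(\<And>i. i \<in> I \<Longrightarrow> continuously_differentiable k (f i)) \<Longrightarrow>
    continuously_differentiable k (\<lambda>x. \<Prod>i\<in>I. f i x)"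
  by (induction I rule: infinite_finite_induct)
     (auto intro!: continuously_differentiable_const continuously_differentiable_mult)

text \<open>
  These functions, \<open>p(1/t) exp(-1/t)\<close> continued by zero, form a family closed under
  differentiation, so a single computation of a derivative yields smoothness of all orders.
\<close>

definition flat_exp :: "real poly \<Rightarrow> real \<Rightarrow> real" where
  "flat_exp p t = (if t > 0 then poly p (1 / t) * exp (- 1 / t) else 0)"

lemma tendsto_poly_exp_at_top: "((\<lambda>y. poly p y * exp (- y)) \<longlongrightarrow> (0::real)) at_top"
proof -
  have *: "((\<lambda>y. coeff p i * (y ^ i / exp y)) \<longlongrightarrow> 0) at_top" for i
    using tendsto_mult_right_zero[OF tendsto_power_div_exp_0] .
  have "((\<lambda>y. \<Sum>i\<le>degree p. coeff p i * (y ^ i / exp y)) \<longlongrightarrow> 0) at_top"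
    by (rule tendsto_null_sum) (use * in auto)
  then show ?thesis
    by (simp add: poly_altdef sum_distrib_right exp_minus divide_inverse mult.assoc)
qed

text \<open>
  The substitution \<open>y = 1/t\<close> turns the limit from the right into the decay of polynomials times \<open>exp(-y)\<close>.
\<close>

lemma tendsto_flat_exp_0: "(flat_exp p \<longlongrightarrow> 0) (at 0)"
proof -
  have "(flat_exp p \<longlongrightarrow> 0) (at_left 0)"
    by (rule tendsto_eventually) (auto simp: flat_exp_def eventually_at_left_field intro!: exI[of _ "-1"])
  moreover have "((\<lambda>t. poly p (inverse t) * exp (- inverse t)) \<longlongrightarrow> 0) (at_right 0)"
    using filterlim_compose[OF tendsto_poly_exp_at_top filterlim_inverse_at_top_right] .
  then have "(flat_exp p \<longlongrightarrow> 0) (at_right 0)"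
    by (rule Lim_transform_eventually)
       (auto simp: flat_exp_def eventually_at_right_field field_simps intro!: exI[of _ 1])
  ultimately show ?thesis by (simp add: filterlim_at_split)
qed

lemma flat_exp_has_derivative:
  "(flat_exp p has_real_derivative flat_exp (monom 1 2 * (p - pderiv p)) t) (at t)"
proof -
  consider "t > 0" | "t < 0" | "t = 0" by linarith
  then show ?thesis
  proof cases
    case 1
    have "((\<lambda>t. poly p (1 / t) * exp (- 1 / t)) has_real_derivative
        flat_exp (monom 1 2 * (p - pderiv p)) t) (at t)"
      using 1 by (auto intro!: derivative_eq_intros DERIV_chain2[OF poly_DERIV]
          simp: flat_exp_def poly_monom power2_eq_square field_simps)
    then show ?thesis
      by (rule DERIV_cong_ev[THEN iffD1, rotated -1])
         (use 1 in \<open>auto simp: flat_exp_def intro!: eventually_nhds_in_open[of "{0<..}", THEN eventually_mono]\<close>)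
  next
    case 2
    have "((\<lambda>t. 0) has_real_derivative flat_exp (monom 1 2 * (p - pderiv p)) t) (at t)"
      using 2 by (auto simp: flat_exp_def)
    then show ?thesis
      by (rule DERIV_cong_ev[THEN iffD1, rotated -1])
         (use 2 in \<open>auto simp: flat_exp_def intro!: eventually_nhds_in_open[of "{..<0}", THEN eventually_mono]\<close>)
  next
    case 3
    \<comment> \<open>Dividing by \<open>h\<close> replaces \<open>p\<close> by \<open>X p\<close>, so the difference quotient belongs to the family again.\<close>
    have "((\<lambda>h. (flat_exp p (0 + h) - flat_exp p 0) / h) \<longlongrightarrow> 0) (at 0)"
      using tendsto_flat_exp_0[of "[:0,1:] * p"]
      by (rule Lim_transform_eventually) (auto simp: flat_exp_def eventually_at_filter)
    then show ?thesis by (simp add: 3 DERIV_def flat_exp_def)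
  qed
qed

lemma continuously_differentiable_flat_exp:
  "continuously_differentiable k f \<Longrightarrow> continuously_differentiable k (\<lambda>x. flat_exp p (f x))"
proof (induction k arbitrary: p f)
  case 0
  have "continuous_on UNIV (flat_exp p)"
    using flat_exp_has_derivative by (intro DERIV_continuous_on) (auto intro: DERIV_subset)
  then show ?case using 0 continuous_on_compose2[of UNIV "flat_exp p" UNIV f] by auto
next
  case (Suc k)
  define q where "q = monom 1 2 * (p - pderiv p)"
  show ?case
  proof (rule continuously_differentiable_SucI)
    show "((\<lambda>x. flat_exp p (f x)) has_derivative
        (\<lambda>v. frechet_derivative f (at x) v * flat_exp q (f x))) (at x)" for x
      using has_derivative_compose[OF continuously_differentiable_Suc_derivative[OF Suc.prems]
        flat_exp_has_derivative[of p, unfolded has_field_derivative_def]]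
      by (simp add: q_def mult.commute)
    show "continuously_differentiable k (\<lambda>x. frechet_derivative f (at x) v * flat_exp q (f x))" for v
      using Suc.prems continuously_differentiable_Suc_D[OF Suc.prems]
      by (intro continuously_differentiable_mult Suc.IH) auto
  qed
qed

text \<open>
  As \<open>n\<close> grows, the rescaled \<open>exp(-1/((n+1) t))\<close> increases to the indicator of the positive
  half-line; it vanishes for \<open>t \<le> 0\<close>, which keeps the supports of products under control.
\<close>

definition smooth_step :: "nat \<Rightarrow> real \<Rightarrow> real" where
  "smooth_step n t = flat_exp 1 (real (Suc n) * t)"

lemma smooth_step_bounds: "0 \<le> smooth_step n t" "smooth_step n t \<le> 1"
  by (auto simp: smooth_step_def flat_exp_def)

lemma smooth_step_eq_0 [simp]: "t \<le> 0 \<Longrightarrow> smooth_step n t = 0"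
  by (auto simp: smooth_step_def flat_exp_def zero_less_mult_iff)

lemma smooth_step_tendsto: "(\<lambda>n. smooth_step n t) \<longlonglongrightarrow> indicator {0<..} t"
proof (cases "t > 0")
  case True
  have "(\<lambda>n. exp (- (1 / real (Suc n)) * (1 / t))) \<longlonglongrightarrow> exp (- 0 * (1 / t))"
    by (intro tendsto_intros LIMSEQ_Suc lim_1_over_n)
  then show ?thesis using True by (simp add: smooth_step_def flat_exp_def)
next
  case False
  then show ?thesis by simp
qed

lemma continuously_differentiable_smooth_step:
  "continuously_differentiable k f \<Longrightarrow> continuously_differentiable k (\<lambda>x. smooth_step n (f x))"
  unfolding smooth_step_def
  by (intro continuously_differentiable_flat_exp continuously_differentiable_cmult)


section \<open>Integrals along rays\<close>

lemma nn_integral_lborel_scaleR: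
  fixes f :: "'a::euclidean_space \<Rightarrow> ennreal"
  assumes [measurable]: "f \<in> borel_measurable borel" and s: "s > 0"
  shows "(\<integral>\<^sup>+x. f (s *\<^sub>R x) \<partial>lborel) = ennreal (1 / s ^ DIM('a)) * (\<integral>\<^sup>+x. f x \<partial>lborel)"
proof -
  have "(\<integral>\<^sup>+x. f x \<partial>lborel) = ennreal (s ^ DIM('a)) * (\<integral>\<^sup>+x. f (s *\<^sub>R x) \<partial>lborel)"
    using s by (subst lborel_affine[of s 0])
      (simp_all add: nn_integral_density nn_integral_distr nn_integral_cmult)
  then show ?thesis
    using s by (simp add: mult.assoc[symmetric] ennreal_mult'[symmetric])
qed

lemma emeasure_lborel_scaleR:
  fixes E :: "'a::euclidean_space set"
  assumes [measurable]: "E \<in> sets borel" and s: "s > 0"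
  shows "emeasure lborel {x. s *\<^sub>R x \<in> E} = ennreal (1 / s ^ DIM('a)) * emeasure lborel E"
proof -
  have "emeasure lborel {x. s *\<^sub>R x \<in> E} = (\<integral>\<^sup>+x. indicator E (s *\<^sub>R x) \<partial>lborel)"
  proof -
    have [measurable]: "{x. s *\<^sub>R x \<in> E} \<in> sets borel" by measurable
    have "indicator E (s *\<^sub>R x) = (indicator {x. s *\<^sub>R x \<in> E} x :: ennreal)" for x
      by (auto split: split_indicator)
    then show ?thesis by simp
  qed
  also have "\<dots> = ennreal (1 / s ^ DIM('a)) * (\<integral>\<^sup>+x. indicator E x \<partial>lborel)"
    using s by (intro nn_integral_lborel_scaleR) auto
  finally show ?thesis by simp
qed

text \<open>
  The integral starts at \<open>x\<close>, not at the origin: \<open>norm x * ray_integral G x\<close> is the integral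
  of \<open>G\<close> with respect to arc length along the ray from \<open>x\<close> to infinity.
\<close>

definition ray_integral :: "('a::euclidean_space \<Rightarrow> ennreal) \<Rightarrow> 'a \<Rightarrow> ennreal" where
  "ray_integral G x = (\<integral>\<^sup>+s\<in>{1..}. G (s *\<^sub>R x) \<partial>lborel)"

lemma borel_measurable_ray_integral [measurable]:
  assumes [measurable]: "G \<in> borel_measurable borel"
  shows "ray_integral G \<in> borel_measurable borel"
  unfolding ray_integral_def[abs_def] by measurable

lemma ray_integral_mono: "(\<And>x. G x \<le> H x) \<Longrightarrow> ray_integral G x \<le> ray_integral H x"
  unfolding ray_integral_def by (intro nn_integral_mono mult_right_mono) auto

lemma ray_integral_add:
  assumes [measurable]: "G \<in> borel_measurable borel" "H \<in> borel_measurable borel"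
  shows "ray_integral (\<lambda>x. G x + H x) x = ray_integral G x + ray_integral H x"
  unfolding ray_integral_def
  by (simp add: distrib_right nn_integral_add)

lemma nn_integral_powr_tail:
  "(\<integral>\<^sup>+s\<in>{1..}. ennreal (s powr (- (3/2))) \<partial>lborel) = 2"
proof -
  have "(\<integral>\<^sup>+s. ennreal (s powr (- (3/2))) * indicator {1..} s \<partial>lborel) = ennreal (0 - (- 2 * 1 powr (- (1/2))))"
  proof (rule nn_integral_FTC_atLeast[where F = "\<lambda>s. - 2 * s powr (- (1/2))" and T = 0])
    show "((\<lambda>s. - 2 * s powr (- (1/2))) has_real_derivative s powr (- (3/2))) (at s)" if "1 \<le> s" for s :: real
      using that by (auto intro!: derivative_eq_intros)
    have "((\<lambda>s::real. s powr (- (1/2))) \<longlongrightarrow> 0) at_top"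
      by (rule tendsto_neg_powr) (auto simp: filterlim_ident)
    from tendsto_mult_right_zero[OF this, of "-2"]
    show "((\<lambda>s::real. - 2 * s powr (- (1/2))) \<longlongrightarrow> 0) at_top" by simp
  qed auto
  then show ?thesis by simp
qed

text \<open>
  The weights \<open>s\<^bsup>-3/4\<^esup>\<close> and \<open>s\<^bsup>3/4\<^esup>\<close> in the Cauchy-Schwarz inequality work in every dimension from three on:
  the first has a convergent square integral, and the dilation by \<open>s\<close> contributes the factor
  \<open>s\<^bsup>3/2 - N\<^esup> \<le> s\<^bsup>-3/2\<^esup>\<close> to the second.
\<close>

lemma Hardy_inequality_ray_integral:
  fixes G :: "'a::euclidean_space \<Rightarrow> ennreal"
  assumes [measurable]: "G \<in> borel_measurable borel" and dim: "DIM('a) > 2"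
  shows "(\<integral>\<^sup>+x. (ray_integral G x)\<^sup>2 \<partial>lborel) \<le> 4 * (\<integral>\<^sup>+x. (G x)\<^sup>2 \<partial>lborel)"
proof -
  define a where "a s = ennreal (s powr (- (3/4))) * indicator {1..} s" for s :: real
  define b where "b x s = ennreal (s powr (3/4)) * G (s *\<^sub>R x) * indicator {1..} s" for x :: 'a and s :: real
  have [measurable]: "a \<in> borel_measurable borel" "(\<lambda>(x, s). b x s) \<in> borel_measurable (borel \<Otimes>\<^sub>M borel)"
    "b x \<in> borel_measurable borel" for x
    by (auto simp: a_def[abs_def] b_def[abs_def])
  have ab: "ray_integral G x = (\<integral>\<^sup>+s. a s * b x s \<partial>lborel)" for x
    unfolding ray_integral_def
  proof (intro nn_integral_cong)
    fix s :: real
    have "ennreal (s powr (- (3/4))) * ennreal (s powr (3/4)) = 1" if "1 \<le> s"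
      using that by (simp add: ennreal_mult'[symmetric] powr_add[symmetric])
    then have "ennreal (s powr (- (3/4))) * (ennreal (s powr (3/4)) * G (s *\<^sub>R x)) = G (s *\<^sub>R x)" if "1 \<le> s"
      using that by (simp only: mult.assoc[symmetric] mult_1)
    then show "G (s *\<^sub>R x) * indicator {1..} s = a s * b x s"
      by (auto simp: a_def b_def split: split_indicator)
  qed
  have "(\<integral>\<^sup>+s. (a s)\<^sup>2 \<partial>lborel) = (\<integral>\<^sup>+s\<in>{1..}. ennreal (s powr (- (3/2))) \<partial>lborel)"
    by (intro nn_integral_cong)
       (auto simp: a_def power2_eq_square ennreal_mult'[symmetric] powr_add[symmetric] split: split_indicator)
  then have a2: "(\<integral>\<^sup>+s. (a s)\<^sup>2 \<partial>lborel) = 2" by (simp add: nn_integral_powr_tail)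
  have "(\<integral>\<^sup>+x. (ray_integral G x)\<^sup>2 \<partial>lborel) \<le> (\<integral>\<^sup>+x. 2 * (\<integral>\<^sup>+s. (b x s)\<^sup>2 \<partial>lborel) \<partial>lborel)"
    unfolding ab a2[symmetric] by (intro nn_integral_mono Cauchy_Schwarz_nn_integral) auto
  also have "\<dots> = 2 * (\<integral>\<^sup>+s. (\<integral>\<^sup>+x. (b x s)\<^sup>2 \<partial>lborel) \<partial>lborel)"
    by (subst nn_integral_cmult, measurable) (subst lborel_pair.Fubini', auto)
  finally have upper: "(\<integral>\<^sup>+x. (ray_integral G x)\<^sup>2 \<partial>lborel)
      \<le> 2 * (\<integral>\<^sup>+s. (\<integral>\<^sup>+x. (b x s)\<^sup>2 \<partial>lborel) \<partial>lborel)" .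
  have "(\<integral>\<^sup>+s. (\<integral>\<^sup>+x. (b x s)\<^sup>2 \<partial>lborel) \<partial>lborel)
      \<le> (\<integral>\<^sup>+s. (\<integral>\<^sup>+x. (G x)\<^sup>2 \<partial>lborel) * (ennreal (s powr (- (3/2))) * indicator {1..} s) \<partial>lborel)"
  proof (intro nn_integral_mono)
    fix s :: real
    show "(\<integral>\<^sup>+x. (b x s)\<^sup>2 \<partial>lborel)
        \<le> (\<integral>\<^sup>+x. (G x)\<^sup>2 \<partial>lborel) * (ennreal (s powr (- (3/2))) * indicator {1..} s)"
    proof (cases "1 \<le> s")
      case True
      have "(\<integral>\<^sup>+x. (b x s)\<^sup>2 \<partial>lborel) = (\<integral>\<^sup>+x. ennreal (s powr (3/2)) * (G (s *\<^sub>R x))\<^sup>2 \<partial>lborel)"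
        using True by (intro nn_integral_cong)
          (simp add: b_def power_mult_distrib power2_eq_square ennreal_mult'[symmetric] powr_add[symmetric] mult_ac)
      also have "\<dots> = ennreal (s powr (3/2)) * (ennreal (1 / s ^ DIM('a)) * (\<integral>\<^sup>+x. (G x)\<^sup>2 \<partial>lborel))"
        using True nn_integral_lborel_scaleR[of "\<lambda>x. (G x)\<^sup>2" s] by (simp add: nn_integral_cmult)
      also have "\<dots> = ennreal (s powr (3/2) / s ^ DIM('a)) * (\<integral>\<^sup>+x. (G x)\<^sup>2 \<partial>lborel)"
        using True by (simp add: mult.assoc[symmetric] ennreal_mult'[symmetric])
      also have "s powr (3/2) / s ^ DIM('a) = s powr (3/2 - DIM('a))"
        using True by (simp add: powr_diff powr_realpow)
      also have "ennreal (s powr (3/2 - DIM('a))) \<le> ennreal (s powr (- (3/2)))"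
        using True dim by (intro ennreal_leI powr_mono) auto
      finally show ?thesis using True by (simp add: mult.commute mult_right_mono)
    qed (simp add: b_def)
  qed
  also have "\<dots> = (\<integral>\<^sup>+x. (G x)\<^sup>2 \<partial>lborel) * 2"
    by (subst nn_integral_cmult) (auto simp: nn_integral_powr_tail)
  finally have "2 * (\<integral>\<^sup>+s. (\<integral>\<^sup>+x. (b x s)\<^sup>2 \<partial>lborel) \<partial>lborel) \<le> 2 * ((\<integral>\<^sup>+x. (G x)\<^sup>2 \<partial>lborel) * 2)"
    by (rule mult_left_mono) simp
  with upper show ?thesis by (simp add: mult_ac mult.assoc[symmetric] del: mult.assoc)
qed

section \<open>Rearrangement inequalities\<close>

text \<open>
  Negative levels are left out: a function that vanishes outside a bounded set exceeds them on a set of infinite measure.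
\<close>

definition equimeasurable :: "('a::euclidean_space \<Rightarrow> real) \<Rightarrow> ('b::euclidean_space \<Rightarrow> real) \<Rightarrow> bool" where
  "equimeasurable f g \<longleftrightarrow>
    (\<forall>t\<ge>0. emeasure lborel {x. t < f x} = emeasure lborel {x. t < g x})"

lemma ennreal_eq_nn_integral_layers: "ennreal a = (\<integral>\<^sup>+t. indicator {0..<a} t \<partial>lborel)"
  by (cases "0 \<le> a") (auto simp: ennreal_neg)

text \<open>
  Both factors are written as integrals over their levels; Tonelli then reduces an integral of a
  product to volumes of intersections of superlevel sets.
\<close>

lemma nn_integral_mult_layers:
  fixes f g :: "'a::euclidean_space \<Rightarrow> real"
  assumes [measurable]: "f \<in> borel_measurable borel" "g \<in> borel_measurable borel"
  shows "(\<integral>\<^sup>+x. ennreal (f x) * ennreal (g x) \<partial>lborel) =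
    (\<integral>\<^sup>+s\<in>{0..}. (\<integral>\<^sup>+t\<in>{0..}. emeasure lborel ({x. s < f x} \<inter> {x. t < g x}) \<partial>lborel) \<partial>lborel)"
proof -
  have "(\<integral>\<^sup>+x. ennreal (f x) * ennreal (g x) \<partial>lborel)
      = (\<integral>\<^sup>+x. (\<integral>\<^sup>+s. (\<integral>\<^sup>+t. indicator {0..<f x} s * indicator {0..<g x} t \<partial>lborel) \<partial>lborel) \<partial>lborel)"
    unfolding ennreal_eq_nn_integral_layers
    by (simp add: nn_integral_cmult nn_integral_multc)
  also have "\<dots> = (\<integral>\<^sup>+s. (\<integral>\<^sup>+x. (\<integral>\<^sup>+t. indicator {0..<f x} s * indicator {0..<g x} t \<partial>lborel) \<partial>lborel) \<partial>lborel)"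
    unfolding indicator_def atLeastLessThan_iff by (rule lborel_pair.Fubini') measurable
  also have "\<dots> = (\<integral>\<^sup>+s. (\<integral>\<^sup>+t. (\<integral>\<^sup>+x. indicator {0..<f x} s * indicator {0..<g x} t \<partial>lborel) \<partial>lborel) \<partial>lborel)"
    unfolding indicator_def atLeastLessThan_iff by (intro nn_integral_cong lborel_pair.Fubini') measurable
  also have "\<dots> = (\<integral>\<^sup>+s. (\<integral>\<^sup>+t. emeasure lborel ({x. s < f x} \<inter> {x. t < g x}) * indicator {0..} t \<partial>lborel) * indicator {0..} s \<partial>lborel)"
  proof (intro nn_integral_cong)
    fix s :: real
    have "(\<integral>\<^sup>+x. indicator {0..<f x} s * indicator {0..<g x} t \<partial>lborel)
        = emeasure lborel ({x. s < f x} \<inter> {x. t < g x}) * indicator {0..} t * indicator {0..} s" for t :: real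
    proof -
      have "(\<integral>\<^sup>+x. indicator {0..<f x} s * indicator {0..<g x} t \<partial>lborel)
          = (\<integral>\<^sup>+x. indicator ({x. s < f x} \<inter> {x. t < g x}) x * (indicator {0..} t * indicator {0..} s) \<partial>lborel)"
        by (intro nn_integral_cong) (auto split: split_indicator)
      then show ?thesis by (simp add: nn_integral_multc mult.assoc)
    qed
    then show "(\<integral>\<^sup>+t. (\<integral>\<^sup>+x. indicator {0..<f x} s * indicator {0..<g x} t \<partial>lborel) \<partial>lborel)
        = (\<integral>\<^sup>+t. emeasure lborel ({x. s < f x} \<inter> {x. t < g x}) * indicator {0..} t \<partial>lborel) * indicator {0..} s"
      by (auto split: split_indicator)
  qed
  finally show ?thesis .
qed

lemma nn_integral_layers:
  fixes f :: "'a::euclidean_space \<Rightarrow> real"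
  assumes [measurable]: "f \<in> borel_measurable borel"
  shows "(\<integral>\<^sup>+x. ennreal (f x) \<partial>lborel) = (\<integral>\<^sup>+s\<in>{0..}. emeasure lborel {x. s < f x} \<partial>lborel)"
proof -
  have "(\<integral>\<^sup>+x. ennreal (f x) \<partial>lborel) = (\<integral>\<^sup>+x. (\<integral>\<^sup>+s. indicator {0..<f x} s \<partial>lborel) \<partial>lborel)"
    unfolding ennreal_eq_nn_integral_layers ..
  also have "\<dots> = (\<integral>\<^sup>+s. (\<integral>\<^sup>+x. indicator {0..<f x} s \<partial>lborel) \<partial>lborel)"
    unfolding indicator_def atLeastLessThan_iff by (rule lborel_pair.Fubini') measurable
  also have "\<dots> = (\<integral>\<^sup>+s. (\<integral>\<^sup>+x. indicator {x. s < f x} x * indicator {0..} s \<partial>lborel) \<partial>lborel)"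
    by (intro nn_integral_cong) (auto split: split_indicator)
  finally show ?thesis by (simp add: nn_integral_multc)
qed

lemma equimeasurable_nn_integral_powr:
  fixes f :: "'a::euclidean_space \<Rightarrow> real" and g :: "'b::euclidean_space \<Rightarrow> real"
  assumes [measurable]: "f \<in> borel_measurable borel" "g \<in> borel_measurable borel"
    and nonneg: "\<And>x. 0 \<le> f x" "\<And>x. 0 \<le> g x" and "equimeasurable f g" and p: "p > 0"
  shows "(\<integral>\<^sup>+x. ennreal (f x powr p) \<partial>lborel) = (\<integral>\<^sup>+x. ennreal (g x powr p) \<partial>lborel)"
proof -
  have iff: "s < a powr p \<longleftrightarrow> s powr (1/p) < a" if "0 \<le> s" "0 \<le> a" for s a :: real
  proof -
    have "s = (s powr (1/p)) powr p" using that p by (simp add: powr_powr)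
    then show ?thesis
      using that p powr_less_mono2[of p "s powr (1/p)" a] powr_mono2[of p a "s powr (1/p)"]
      by (metis linorder_not_less powr_ge_zero order_less_imp_le)
  qed
  have "emeasure lborel {x. s < f x powr p} = emeasure lborel {x. s < g x powr p}" if "0 \<le> s" for s
    using assms(5) that nonneg by (simp add: iff equimeasurable_def)
  then show ?thesis
    by (simp add: nn_integral_layers, intro nn_integral_cong) (auto split: split_indicator)
qed

text \<open>
  Up to the origin, which the notion of radial decrease leaves out, superlevel sets of radially decreasing
  functions are concentric balls, empty or the whole space, so of two such sets one contains the other.
\<close>

lemma emeasure_Int_superlevel:
  fixes f g :: "'a::euclidean_space \<Rightarrow> real"
  assumes [measurable]: "f \<in> borel_measurable borel" "g \<in> borel_measurable borel"
    and f: "spherically_symmetric_decreasing_on UNIV f" and g: "spherically_symmetric_decreasing_on UNIV g"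
  shows "emeasure lborel ({x. s < f x} \<inter> {x. t < g x})
    = min (emeasure lborel {x. s < f x}) (emeasure lborel {x. t < g x})"
proof (rule antisym)
  let ?A = "{x. s < f x}" and ?B = "{x. t < g x}"
  show "emeasure lborel (?A \<inter> ?B) \<le> min (emeasure lborel ?A) (emeasure lborel ?B)"
    by (auto intro!: emeasure_mono)
  have "?A - {0} \<subseteq> ?B \<or> ?B - {0} \<subseteq> ?A"
  proof (rule ccontr)
    assume "\<not> ?thesis"
    then obtain x y where xy: "x \<noteq> 0" "s < f x" "\<not> t < g x" "y \<noteq> 0" "t < g y" "\<not> s < f y" by auto
    show False
    proof (cases "norm x \<le> norm y")
      case True
      then have "g y \<le> g x" using g xy by (auto simp: spherically_symmetric_decreasing_on_def)
      then show False using xy by linarith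
    next
      case False
      then have "f x \<le> f y" using f xy by (auto simp: spherically_symmetric_decreasing_on_def)
      then show False using xy by linarith
    qed
  qed
  moreover have *: "emeasure lborel X \<le> emeasure lborel (X \<inter> Y)"
    if "X - {0} \<subseteq> Y" and [measurable]: "X \<in> sets borel" "Y \<in> sets borel" for X Y :: "'a set"
  proof -
    have "emeasure lborel X \<le> emeasure lborel ((X \<inter> Y) \<union> {0})"
      using that by (intro emeasure_mono) auto
    also have "\<dots> \<le> emeasure lborel (X \<inter> Y) + emeasure lborel {0 :: 'a}"
      by (rule emeasure_subadditive) (simp_all add: sets.Int)
    finally show ?thesis by simp
  qed
  moreover from *[of ?A ?B] *[of ?B ?A]
  have "?A - {0} \<subseteq> ?B \<Longrightarrow> emeasure lborel ?A \<le> emeasure lborel (?A \<inter> ?B)"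
    "?B - {0} \<subseteq> ?A \<Longrightarrow> emeasure lborel ?B \<le> emeasure lborel (?A \<inter> ?B)"
    by (auto simp: Int_commute)
  ultimately show "min (emeasure lborel ?A) (emeasure lborel ?B) \<le> emeasure lborel (?A \<inter> ?B)"
    by (auto simp only: min_le_iff_disj)
qed

text \<open>
  An intersection is never larger than either set, and for the nested superlevel sets on the right this
  bound is attained.
\<close>

lemma Hardy_Littlewood_inequality:
  fixes f1 f2 :: "'a::euclidean_space \<Rightarrow> real" and g1 g2 :: "'b::euclidean_space \<Rightarrow> real"
  assumes [measurable]: "f1 \<in> borel_measurable borel" "f2 \<in> borel_measurable borel"
    "g1 \<in> borel_measurable borel" "g2 \<in> borel_measurable borel"
    and "equimeasurable f1 g1" "equimeasurable f2 g2"
    and "spherically_symmetric_decreasing_on UNIV g1" "spherically_symmetric_decreasing_on UNIV g2"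
  shows "(\<integral>\<^sup>+x. ennreal (f1 x) * ennreal (f2 x) \<partial>lborel) \<le> (\<integral>\<^sup>+x. ennreal (g1 x) * ennreal (g2 x) \<partial>lborel)"
proof -
  have "emeasure lborel ({x. s < f1 x} \<inter> {x. t < f2 x}) \<le> emeasure lborel ({x. s < g1 x} \<inter> {x. t < g2 x})"
    if "0 \<le> s" "0 \<le> t" for s t
  proof -
    have "emeasure lborel ({x. s < f1 x} \<inter> {x. t < f2 x})
        \<le> min (emeasure lborel {x. s < f1 x}) (emeasure lborel {x. t < f2 x})"
      by (auto intro!: emeasure_mono)
    then show ?thesis
      using assms that by (simp add: emeasure_Int_superlevel equimeasurable_def)
  qed
  then show ?thesis
    unfolding nn_integral_mult_layers[OF assms(1,2)] nn_integral_mult_layers[OF assms(3,4)]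
    by (intro nn_integral_mono) (auto split: split_indicator intro!: nn_integral_mono)
qed

lemma equimeasurable_scaleR:
  fixes f g :: "'a::euclidean_space \<Rightarrow> real"
  assumes [measurable]: "f \<in> borel_measurable borel" "g \<in> borel_measurable borel"
    and "equimeasurable f g" "s > 0"
  shows "equimeasurable (\<lambda>x. f (s *\<^sub>R x)) (\<lambda>x. g (s *\<^sub>R x))"
  using assms emeasure_lborel_scaleR[of "{x. t < f x}" s for t] emeasure_lborel_scaleR[of "{x. t < g x}" s for t]
  by (simp add: equimeasurable_def)

lemma spherically_symmetric_decreasing_scaleR:
  fixes f :: "'a::euclidean_space \<Rightarrow> real"
  assumes "spherically_symmetric_decreasing_on UNIV f" "s > 0"
  shows "spherically_symmetric_decreasing_on UNIV (\<lambda>x. f (s *\<^sub>R x))"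
  using assms by (simp add: spherically_symmetric_decreasing_on_def)

text \<open>
  Expanding the square exposes a product of two dilates of the same function, to which rearrangement
  inequalities apply.
\<close>

lemma nn_integral_ray_integral_square:
  fixes G :: "'a::euclidean_space \<Rightarrow> ennreal"
  assumes [measurable]: "G \<in> borel_measurable borel"
  shows "(\<integral>\<^sup>+x. (ray_integral G x)\<^sup>2 \<partial>lborel)
    = (\<integral>\<^sup>+s\<in>{1..}. (\<integral>\<^sup>+t\<in>{1..}. (\<integral>\<^sup>+x. G (s *\<^sub>R x) * G (t *\<^sub>R x) \<partial>lborel) \<partial>lborel) \<partial>lborel)"
proof -
  define H where "H s x = G (s *\<^sub>R x) * indicator {1..} s" for s :: real and x
  have [measurable]: "(\<lambda>(s, x). H s x) \<in> borel_measurable (borel \<Otimes>\<^sub>M borel)"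
    by (simp add: H_def[abs_def])
  have [measurable]: "(\<lambda>x. H (f x) (g x)) \<in> borel_measurable M"
    if [measurable]: "f \<in> borel_measurable M" "g \<in> borel_measurable M" for M f g
    by (simp add: H_def[abs_def])
  have "(\<integral>\<^sup>+x. (ray_integral G x)\<^sup>2 \<partial>lborel)
      = (\<integral>\<^sup>+x. (\<integral>\<^sup>+s. (\<integral>\<^sup>+t. H s x * H t x \<partial>lborel) \<partial>lborel) \<partial>lborel)"
    by (simp add: ray_integral_def H_def[symmetric] power2_eq_square nn_integral_cmult nn_integral_multc)
  also have "\<dots> = (\<integral>\<^sup>+s. (\<integral>\<^sup>+x. (\<integral>\<^sup>+t. H s x * H t x \<partial>lborel) \<partial>lborel) \<partial>lborel)"
    by (rule lborel_pair.Fubini') measurable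
  also have "\<dots> = (\<integral>\<^sup>+s. (\<integral>\<^sup>+t. (\<integral>\<^sup>+x. H s x * H t x \<partial>lborel) \<partial>lborel) \<partial>lborel)"
    by (intro nn_integral_cong lborel_pair.Fubini') measurable
  also have "\<dots> = (\<integral>\<^sup>+s\<in>{1..}. (\<integral>\<^sup>+t\<in>{1..}. (\<integral>\<^sup>+x. G (s *\<^sub>R x) * G (t *\<^sub>R x) \<partial>lborel) \<partial>lborel) \<partial>lborel)"
    by (intro nn_integral_cong)
       (auto simp: H_def split: split_indicator intro!: nn_integral_cong)
  finally show ?thesis .
qed

text \<open>
  For fixed \<open>s\<close> and \<open>t\<close>, dilation by \<open>s\<close> and \<open>t\<close> preserves both equimeasurability and radial decrease, so
  the Hardy-Littlewood inequality applies before integrating over \<open>s\<close> and \<open>t\<close>.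
\<close>

lemma ray_integral_rearrangement:
  fixes f g :: "'a::euclidean_space \<Rightarrow> real"
  assumes [measurable]: "f \<in> borel_measurable borel" "g \<in> borel_measurable borel"
    and "equimeasurable f g" "spherically_symmetric_decreasing_on UNIV g"
  shows "(\<integral>\<^sup>+x. (ray_integral (\<lambda>x. ennreal (f x)) x)\<^sup>2 \<partial>lborel)
    \<le> (\<integral>\<^sup>+x. (ray_integral (\<lambda>x. ennreal (g x)) x)\<^sup>2 \<partial>lborel)"
proof -
  have "(\<integral>\<^sup>+x. ennreal (f (s *\<^sub>R x)) * ennreal (f (t *\<^sub>R x)) \<partial>lborel)
      \<le> (\<integral>\<^sup>+x. ennreal (g (s *\<^sub>R x)) * ennreal (g (t *\<^sub>R x)) \<partial>lborel)" if "1 \<le> s" "1 \<le> t" for s t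
    using that assms
    by (intro Hardy_Littlewood_inequality equimeasurable_scaleR spherically_symmetric_decreasing_scaleR) auto
  then show ?thesis
    by (simp add: nn_integral_ray_integral_square)
       (intro nn_integral_mono; auto split: split_indicator intro!: nn_integral_mono)
qed


section \<open>Gradients of test functions\<close>

lemma test_function_continuously_differentiable:
  "w \<in> test_functions S \<Longrightarrow> continuously_differentiable k w"
  by (simp add: test_functions_def)

lemma test_function_continuous: "w \<in> test_functions S \<Longrightarrow> continuous_on UNIV w"
  using test_function_continuously_differentiable[of w S 0] by simp

text \<open>
  The gradient represents the derivative because the latter is linear and hence determined on the basis.
\<close>

lemma test_function_has_derivative:
  assumes "w \<in> test_functions S"
  shows "(w has_derivative (\<lambda>v. gradient w x \<bullet> v)) (at x)"
proof -
  have D: "(w has_derivative frechet_derivative w (at x)) (at x)"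
    using test_function_continuously_differentiable[OF assms, of "Suc 0"]
    by (rule continuously_differentiable_Suc_derivative)
  then interpret linear "frechet_derivative w (at x)" by (rule has_derivative_linear)
  have "frechet_derivative w (at x) v = gradient w x \<bullet> v" for v
  proof -
    have "frechet_derivative w (at x) v = frechet_derivative w (at x) (\<Sum>b\<in>Basis. (v \<bullet> b) *\<^sub>R b)"
      by (simp add: euclidean_representation)
    also have "\<dots> = gradient w x \<bullet> v"
      by (simp add: sum scale gradient_def inner_sum_right inner_commute mult.commute)
    finally show ?thesis .
  qed
  then have "frechet_derivative w (at x) = (\<lambda>v. gradient w x \<bullet> v)" by auto
  with D show ?thesis by simp
qed

lemma gradient_eqI:
  assumes "(w has_derivative (\<lambda>v. z \<bullet> v)) (at x)"
  shows "gradient w x = z"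
proof -
  have "frechet_derivative w (at x) = (\<lambda>v. z \<bullet> v)"
    using assms by (metis frechet_derivative_at)
  then show ?thesis by (simp add: gradient_def euclidean_representation)
qed

lemma continuous_on_gradient:
  assumes "w \<in> test_functions S"
  shows "continuous_on UNIV (gradient w)"
  unfolding gradient_def
  using test_function_continuously_differentiable[OF assms, of 1]
  by (auto intro!: continuous_intros)

lemma borel_measurable_test_function:
  "w \<in> test_functions S \<Longrightarrow> w \<in> borel_measurable borel"
  by (rule borel_measurable_continuous_onI[OF test_function_continuous])

lemma borel_measurable_gradient:
  "w \<in> test_functions S \<Longrightarrow> gradient w \<in> borel_measurable borel"
  by (rule borel_measurable_continuous_onI[OF continuous_on_gradient])

lemma gradient_eq_0_outside:
  assumes "x \<notin> closure {x. w x \<noteq> 0}"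
  shows "gradient w x = 0"
proof (rule gradient_eqI)
  have "((\<lambda>_. 0) has_derivative (\<lambda>v. 0 \<bullet> v)) (at x)" by simp
  then show "(w has_derivative (\<lambda>v. 0 \<bullet> v)) (at x)"
    by (rule has_derivative_transform_within_open[of _ _ _ _ "- closure {x. w x \<noteq> 0}"])
       (use assms closure_subset[of "{x. w x \<noteq> 0}"] in auto)
qed

lemma test_function_zero_outside:
  assumes "w \<in> test_functions S" "x \<notin> S"
  shows "w x = 0" "gradient w x = 0"
proof -
  have *: "x \<notin> closure {x. w x \<noteq> 0}" using assms by (auto simp: test_functions_def)
  then show "w x = 0" using closure_subset[of "{x. w x \<noteq> 0}"] by auto
  from * show "gradient w x = 0" by (rule gradient_eq_0_outside)
qed

lemma test_function_bounded_support:
  assumes "w \<in> test_functions S"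
  obtains r where "r > 0" "w \<in> test_functions (ball 0 r)"
proof -
  have "bounded (closure {x. w x \<noteq> 0})"
    using assms by (auto simp: test_functions_def compact_imp_bounded)
  then obtain r where "r > 0" "closure {x. w x \<noteq> 0} \<subseteq> ball 0 r"
    using bounded_subset_ballD[of _ 0] by (metis (no_types))
  with assms show ?thesis by (intro that[of r]) (auto simp: test_functions_def)
qed

lemma test_functions_mult:
  assumes "w \<in> test_functions S" "\<And>k. continuously_differentiable k f"
  shows "(\<lambda>x. f x * w x) \<in> test_functions S"
proof -
  have sub: "closure {x. f x * w x \<noteq> 0} \<subseteq> closure {x. w x \<noteq> 0}" by (intro closure_mono) auto
  moreover have "compact (closure {x. w x \<noteq> 0})"
    using assms by (auto simp: test_functions_def)
  then have "compact (closure {x. f x * w x \<noteq> 0})"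
    using sub compact_Int_closed[of "closure {x. w x \<noteq> 0}" "closure {x. f x * w x \<noteq> 0}"]
    by (simp add: Int_absorb1)
  ultimately show ?thesis
    using assms by (auto simp: test_functions_def intro!: continuously_differentiable_mult)
qed

lemma test_functions_add:
  assumes "w \<in> test_functions S" "z \<in> test_functions S"
  shows "(\<lambda>x. w x + z x) \<in> test_functions S"
proof -
  have "closure {x. w x + z x \<noteq> 0} \<subseteq> closure ({x. w x \<noteq> 0} \<union> {x. z x \<noteq> 0})"
    by (intro closure_mono) auto
  then have sub: "closure {x. w x + z x \<noteq> 0} \<subseteq> closure {x. w x \<noteq> 0} \<union> closure {x. z x \<noteq> 0}"
    by simp
  moreover have "compact (closure {x. w x \<noteq> 0} \<union> closure {x. z x \<noteq> 0})"
    using assms by (intro compact_Un) (auto simp: test_functions_def)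
  then have "compact (closure {x. w x + z x \<noteq> 0})"
    using sub compact_Int_closed[of "closure {x. w x \<noteq> 0} \<union> closure {x. z x \<noteq> 0}" "closure {x. w x + z x \<noteq> 0}"]
    by (simp add: Int_absorb1)
  ultimately show ?thesis
    using assms by (auto simp: test_functions_def intro!: continuously_differentiable_add)
qed

lemma gradient_add:
  assumes "w \<in> test_functions S" "z \<in> test_functions T"
  shows "gradient (\<lambda>x. w x + z x) x = gradient w x + gradient z x"
  by (rule gradient_eqI)
     (auto intro!: derivative_eq_intros assms[THEN test_function_has_derivative] simp: inner_add_left)

lemma gradient_mult:
  assumes "w \<in> test_functions S" "z \<in> test_functions T"
  shows "gradient (\<lambda>x. w x * z x) x = w x *\<^sub>R gradient z x + z x *\<^sub>R gradient w x"
  by (rule gradient_eqI)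
     (auto intro!: derivative_eq_intros assms[THEN test_function_has_derivative] simp: inner_add_left)

lemma gradient_cmult:
  assumes "w \<in> test_functions S"
  shows "gradient (\<lambda>x. c * w x) x = c *\<^sub>R gradient w x"
  by (rule gradient_eqI)
     (auto intro!: derivative_eq_intros assms[THEN test_function_has_derivative])

lemma zero_test_function: "(\<lambda>_. 0) \<in> test_functions S"
  by (auto simp: test_functions_def intro: continuously_differentiable_const)

lemma integrable_ball_support:
  fixes f :: "'a::euclidean_space \<Rightarrow> 'b::euclidean_space"
  assumes "continuous_on UNIV f" "\<And>x. x \<notin> ball 0 r \<Longrightarrow> f x = 0"
  shows "integrable lborel f"
proof -
  have "integrable lborel (\<lambda>x. indicator (cball 0 r) x *\<^sub>R f x)"
    by (rule borel_integrable_compact) (use assms in \<open>auto intro: continuous_on_subset\<close>)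
  moreover have "indicator (cball 0 r) x *\<^sub>R f x = f x" for x
    using assms(2)[of x] by (auto split: split_indicator)
  ultimately show ?thesis by simp
qed

lemma integrable_test_function:
  assumes "w \<in> test_functions S"
  shows "integrable lborel w" "integrable lborel (gradient w)"
    "continuous_on UNIV f \<Longrightarrow> integrable lborel (\<lambda>x. w x *\<^sub>R (f x :: 'b::euclidean_space))"
    "continuous_on UNIV f' \<Longrightarrow> integrable lborel (\<lambda>x. f' x *\<^sub>R gradient w x)"
proof -
  obtain r where r: "w \<in> test_functions (ball 0 r)" using test_function_bounded_support[OF assms] .
  show "integrable lborel w" "integrable lborel (gradient w)"
    "continuous_on UNIV f \<Longrightarrow> integrable lborel (\<lambda>x. w x *\<^sub>R (f x :: 'b::euclidean_space))"
    "continuous_on UNIV f' \<Longrightarrow> integrable lborel (\<lambda>x. f' x *\<^sub>R gradient w x)"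
    using test_function_continuous[OF r] continuous_on_gradient[OF r]
    by (auto intro!: integrable_ball_support[where r = r] continuous_intros simp: test_function_zero_outside[OF r])
qed

text \<open>
  The fundamental theorem of calculus along the ray, on which \<open>w\<close> eventually vanishes.
\<close>

lemma test_function_ray_integral:
  assumes "w \<in> test_functions S" "x \<noteq> 0"
  shows "has_bochner_integral lborel (\<lambda>s. (gradient w (s *\<^sub>R x) \<bullet> x) * indicator {1..} s) (- w x)"
proof -
  obtain r where r: "r > 0" "w \<in> test_functions (ball 0 r)" using test_function_bounded_support[OF assms(1)] .
  \<comment> \<open>Beyond \<open>b\<close> the ray has left the ball that contains the support.\<close>
  define b where "b = max 1 (r / norm x)"
  have out: "s *\<^sub>R x \<notin> ball 0 r" if "b \<le> s" for s
    using that assms(2) r by (auto simp: b_def field_simps)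
  have "has_bochner_integral lborel (\<lambda>s. (gradient w (s *\<^sub>R x) \<bullet> x) * indicator {1..b} s)
      (w (b *\<^sub>R x) - w (1 *\<^sub>R x))"
  proof (rule has_bochner_integral_FTC_Icc_real)
    fix s :: real
    have "((\<lambda>s. w (s *\<^sub>R x)) has_derivative (\<lambda>h. gradient w (s *\<^sub>R x) \<bullet> (h *\<^sub>R x))) (at s)"
      by (rule has_derivative_compose[OF _ test_function_has_derivative[OF r(2)]])
         (auto intro!: derivative_eq_intros)
    then show "((\<lambda>s. w (s *\<^sub>R x)) has_real_derivative gradient w (s *\<^sub>R x) \<bullet> x) (at s)"
      by (simp add: has_field_derivative_def mult_commute_abs)
    have "continuous_on UNIV (\<lambda>s. gradient w (s *\<^sub>R x) \<bullet> x)"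
      by (intro continuous_intros continuous_on_compose2[OF continuous_on_gradient[OF r(2)]]) auto
    then show "isCont (\<lambda>s. gradient w (s *\<^sub>R x) \<bullet> x) s"
      by (simp add: continuous_on_eq_continuous_at)
  qed (simp add: b_def)
  moreover have "(gradient w (s *\<^sub>R x) \<bullet> x) * indicator {1..b} s
      = (gradient w (s *\<^sub>R x) \<bullet> x) * indicator {1..} s" for s
    using out[of s] test_function_zero_outside(2)[OF r(2), of "s *\<^sub>R x"]
    by (auto split: split_indicator)
  ultimately show ?thesis
    using out[of b] test_function_zero_outside(1)[OF r(2), of "b *\<^sub>R x"] by simp
qed

text \<open>
  Apart from being Borel, \<open>h\<close> need only act as the gradient of \<open>v\<close> along the single ray through \<open>x\<close>. With \<open>h = 0\<close> and \<open>v = 0\<close> this bounds \<open>w\<close> by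
  its gradient; with the radial potential it compares that potential to an approximating test function.
\<close>

lemma ray_integral_bound:
  fixes w v :: "'a::euclidean_space \<Rightarrow> real"
  assumes w: "w \<in> test_functions S" and x: "x \<noteq> 0" and [measurable]: "h \<in> borel_measurable borel"
    and v: "has_bochner_integral lborel (\<lambda>s. (h (s *\<^sub>R x) \<bullet> x) * indicator {1..} s) (- v x)"
  shows "ennreal \<bar>w x - v x\<bar> \<le> ennreal (norm x) * ray_integral (\<lambda>x. ennreal (norm (gradient w x - h x))) x"
proof -
  have int: "has_bochner_integral lborel
      (\<lambda>s. (h (s *\<^sub>R x) \<bullet> x) * indicator {1..} s - (gradient w (s *\<^sub>R x) \<bullet> x) * indicator {1..} s) (- v x - - w x)"
    by (intro has_bochner_integral_diff v test_function_ray_integral[OF w x])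
  have "ennreal \<bar>w x - v x\<bar> = ennreal (norm (\<integral>s. (h (s *\<^sub>R x) \<bullet> x) * indicator {1..} s
      - (gradient w (s *\<^sub>R x) \<bullet> x) * indicator {1..} s \<partial>lborel))"
    using has_bochner_integral_integral_eq[OF int] by simp
  also have "\<dots> \<le> (\<integral>\<^sup>+s. ennreal (norm ((h (s *\<^sub>R x) \<bullet> x) * indicator {1..} s
      - (gradient w (s *\<^sub>R x) \<bullet> x) * indicator {1..} s)) \<partial>lborel)"
    using int by (intro integral_norm_bound_ennreal) (auto simp: has_bochner_integral_iff)
  also have "\<dots> \<le> (\<integral>\<^sup>+s. ennreal (norm x) * (ennreal (norm (gradient w (s *\<^sub>R x) - h (s *\<^sub>R x))) * indicator {1..} s) \<partial>lborel)"
  proof (intro nn_integral_mono)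
    fix s :: real
    have "norm (h (s *\<^sub>R x) \<bullet> x - gradient w (s *\<^sub>R x) \<bullet> x) \<le> norm x * norm (gradient w (s *\<^sub>R x) - h (s *\<^sub>R x))"
      using Cauchy_Schwarz_ineq2[of "gradient w (s *\<^sub>R x) - h (s *\<^sub>R x)" x]
      by (simp add: inner_diff_left abs_minus_commute mult.commute)
    then show "ennreal (norm ((h (s *\<^sub>R x) \<bullet> x) * indicator {1..} s - (gradient w (s *\<^sub>R x) \<bullet> x) * indicator {1..} s))
        \<le> ennreal (norm x) * (ennreal (norm (gradient w (s *\<^sub>R x) - h (s *\<^sub>R x))) * indicator {1..} s)"
      by (auto simp: ennreal_mult'[symmetric] intro!: ennreal_leI split: split_indicator)
  qed
  also have "\<dots> = ennreal (norm x) * ray_integral (\<lambda>x. ennreal (norm (gradient w x - h x))) x"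
  proof -
    note [measurable] = borel_measurable_gradient[OF w] assms(3)
    show ?thesis unfolding ray_integral_def by (rule nn_integral_cmult) measurable
  qed
  finally show ?thesis .
qed

text \<open>
  Translation invariance of Lebesgue measure makes the integrals of all difference quotients vanish, and
  they converge boundedly on a common compact set.
\<close>

lemma integral_gradient_eq_0:
  assumes "w \<in> test_functions S"
  shows "(\<integral>x. gradient w x \<partial>lborel) = 0"
proof (rule euclidean_eqI)
  fix i :: 'a assume i: "i \<in> Basis"
  obtain r where r: "r > 0" "w \<in> test_functions (ball 0 r)" using test_function_bounded_support[OF assms(1)] .
  note [measurable] = borel_measurable_test_function[OF r(2)] borel_measurable_gradient[OF r(2)]
  have "bounded (gradient w ` cball 0 r)"
    by (intro compact_imp_bounded compact_continuous_image continuous_on_subset[OF continuous_on_gradient[OF r(2)]]) auto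
  then obtain L where L: "\<And>x. x \<in> cball 0 r \<Longrightarrow> norm (gradient w x) \<le> L" "L > 0"
    unfolding bounded_pos by blast
  have L: "norm (gradient w x) \<le> L" for x
    using L test_function_zero_outside(2)[OF r(2), of x] by (cases "x \<in> ball 0 r") auto
  have Lip: "\<bar>w (x + h *\<^sub>R i) - w x\<bar> \<le> L * \<bar>h\<bar>" for x h
  proof -
    have "norm (w (x + h *\<^sub>R i) - w x) \<le> L * norm (x + h *\<^sub>R i - x)"
    proof (rule differentiable_bound[of UNIV])
      show "(w has_derivative (\<lambda>v. gradient w y \<bullet> v)) (at y within UNIV)" for y
        using test_function_has_derivative[OF r(2)] by simp
      show "onorm (\<lambda>v. gradient w y \<bullet> v) \<le> L" for y
      proof (rule onorm_le)
        fix v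
        have "norm (gradient w y \<bullet> v) \<le> norm (gradient w y) * norm v"
          using Cauchy_Schwarz_ineq2 by simp
        also have "\<dots> \<le> L * norm v" by (intro mult_right_mono L) simp
        finally show "norm (gradient w y \<bullet> v) \<le> L * norm v" .
      qed
    qed auto
    then show ?thesis using i by simp
  qed
  define q where "q n x = (w (x + (1 / real (Suc n)) *\<^sub>R i) - w x) / (1 / real (Suc n))" for n x
  have "(\<lambda>n. \<integral>x. q n x \<partial>lborel) \<longlonglongrightarrow> (\<integral>x. gradient w x \<bullet> i \<partial>lborel)"
  proof (rule integral_dominated_convergence)
    show "integrable lborel (\<lambda>x. L * indicator (cball 0 (r + 1) :: 'a set) x)"
      by (intro integrable_mult_right integrable_real_indicator) (auto intro: emeasure_bounded_finite[unfolded infinity_ennreal_def])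
    show "AE x in lborel. (\<lambda>n. q n x) \<longlonglongrightarrow> gradient w x \<bullet> i"
    proof (rule AE_I2)
      fix x
      have "((\<lambda>t. w (x + t *\<^sub>R i)) has_derivative (\<lambda>h. gradient w (x + 0 *\<^sub>R i) \<bullet> (h *\<^sub>R i))) (at 0)"
        by (rule has_derivative_compose[OF _ test_function_has_derivative[OF r(2)]])
           (auto intro!: derivative_eq_intros)
      then have "((\<lambda>t. w (x + t *\<^sub>R i)) has_real_derivative gradient w x \<bullet> i) (at 0)"
        by (simp add: has_field_derivative_def mult_commute_abs)
      then have "((\<lambda>h. (w (x + h *\<^sub>R i) - w x) / h) \<longlongrightarrow> gradient w x \<bullet> i) (at 0)"
        by (simp add: DERIV_def)
      moreover have "filterlim (\<lambda>n. 1 / real (Suc n)) (at 0) sequentially"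
        by (intro filterlim_atI LIMSEQ_Suc lim_1_over_n) auto
      ultimately show "(\<lambda>n. q n x) \<longlonglongrightarrow> gradient w x \<bullet> i"
        unfolding q_def by (rule filterlim_compose)
    qed
    show "AE x in lborel. norm (q n x) \<le> L * indicator (cball 0 (r + 1)) x" for n
    proof (rule AE_I2)
      fix x
      show "norm (q n x) \<le> L * indicator (cball 0 (r + 1)) x"
      proof (cases "x \<in> cball 0 (r + 1)")
        case True
        have "\<bar>w (x + (1 / real (Suc n)) *\<^sub>R i) - w x\<bar> * real (Suc n) \<le> L * (1 / real (Suc n)) * real (Suc n)"
          using Lip[of x "1 / real (Suc n)"] by (intro mult_right_mono) auto
        with True show ?thesis by (simp add: q_def abs_mult)
      next
        case False
        have "norm x \<le> norm (x + (1 / real (Suc n)) *\<^sub>R i) + norm ((1 / real (Suc n)) *\<^sub>R i)"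
          using norm_triangle_ineq4[of "x + (1 / real (Suc n)) *\<^sub>R i" "(1 / real (Suc n)) *\<^sub>R i"] by simp
        also have "norm ((1 / real (Suc n)) *\<^sub>R i) \<le> 1" using i by simp
        finally have "w (x + (1 / real (Suc n)) *\<^sub>R i) = 0" "w x = 0"
          using False by (auto intro!: test_function_zero_outside(1)[OF r(2)])
        then show ?thesis using False by (simp add: q_def)
      qed
    qed
  qed (auto simp: q_def[abs_def])
  moreover have "(\<integral>x. q n x \<partial>lborel) = 0" for n
  proof -
    let ?v = "(1 / real (Suc n)) *\<^sub>R i"
    have i1: "integrable lborel w" by (rule integrable_test_function[OF r(2)])
    have eq: "distr lborel borel (\<lambda>x. x + ?v) = lborel"
    proof -
      have "(\<lambda>x. x + ?v) = (+) ?v" by (auto simp: add.commute)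
      then show ?thesis by (simp only: lborel_distr_plus)
    qed
    have "integrable (distr lborel borel (\<lambda>x. x + ?v)) w" "integral\<^sup>L (distr lborel borel (\<lambda>x. x + ?v)) w = integral\<^sup>L lborel w"
      unfolding eq using i1 by auto
    then have "integrable lborel (\<lambda>x. w (x + ?v))" "(\<integral>x. w (x + ?v) \<partial>lborel) = (\<integral>x. w x \<partial>lborel)"
      by (auto simp: integrable_distr_eq integral_distr)
    with i1 show ?thesis by (simp add: q_def)
  qed
  ultimately have "(\<integral>x. gradient w x \<bullet> i \<partial>lborel) = 0" by (simp add: LIMSEQ_const_iff)
  then show "(\<integral>x. gradient w x \<partial>lborel) \<bullet> i = 0 \<bullet> i"
    using integrable_test_function(2)[OF r(2)] by simp
qed

lemma integration_by_parts:
  assumes w: "w \<in> test_functions S" and z: "z \<in> test_functions T"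
  shows "(\<integral>x. w x *\<^sub>R gradient z x \<partial>lborel) = - (\<integral>x. z x *\<^sub>R gradient w x \<partial>lborel)"
proof -
  have "(\<lambda>x. w x * z x) \<in> test_functions T"
    by (intro test_functions_mult z test_function_continuously_differentiable[OF w])
  from integral_gradient_eq_0[OF this]
  have "(\<integral>x. w x *\<^sub>R gradient z x + z x *\<^sub>R gradient w x \<partial>lborel) = 0"
    by (simp add: gradient_mult[OF w z])
  moreover have "integrable lborel (\<lambda>x. w x *\<^sub>R gradient z x)" "integrable lborel (\<lambda>x. z x *\<^sub>R gradient w x)"
    using w z by (auto intro!: integrable_test_function test_function_continuous)
  ultimately show ?thesis by (simp add: eq_neg_iff_add_eq_0)
qed

section \<open>Uniqueness of weak gradients\<close>

text \<open>
  Boxes form an intersection-stable generator of the Borel sets, so the integral over every Borel set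
  vanishes; the total integral takes care of complements.
\<close>

lemma AE_zero_if_box_integrals_zero:
  fixes f :: "'a::euclidean_space \<Rightarrow> real"
  assumes f: "integrable lborel f" and total: "(\<integral>x. f x \<partial>lborel) = 0"
    and box: "\<And>a b. (\<integral>x. indicator (box a b) x * f x \<partial>lborel) = 0"
  shows "AE x in lborel. f x = 0"
proof (rule density_unique_real[OF f])
  fix A :: "'a set" assume "A \<in> sets lborel"
  then have A: "A \<in> sigma_sets UNIV (range (\<lambda>(a, b). box a b))"
    by (simp add: borel_eq_box)
  have "Int_stable (range (\<lambda>(a, b). box a b :: 'a set))"
    by (auto simp: Int_stable_def box_Int_box)
  moreover have "range (\<lambda>(a, b). box a b :: 'a set) \<subseteq> Pow UNIV" by simp
  ultimately have "A \<in> sets borel \<and> (\<integral>x. indicator A x * f x \<partial>lborel) = 0"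
    using A
  proof (induction rule: sigma_sets_induct_disjoint)
    case (compl A)
    have "(\<integral>x. indicator (UNIV - A) x * f x \<partial>lborel) = (\<integral>x. f x - indicator A x * f x \<partial>lborel)"
      by (intro Bochner_Integration.integral_cong) (auto split: split_indicator)
    then show ?case
      using compl f total integrable_real_mult_indicator[of A lborel f] by (auto simp: mult.commute)
  next
    case (union A)
    then have U: "(\<Union>i. A i) \<in> sets borel" by auto
    then have "set_integrable lborel (\<Union>i. A i) f"
      using integrable_mult_indicator[OF _ f] by (simp add: set_integrable_def)
    then have "(\<integral>x\<in>(\<Union>i. A i). f x \<partial>lborel) = (\<Sum>i. \<integral>x\<in>A i. f x \<partial>lborel)"
      using union by (intro lebesgue_integral_countable_add) (auto simp: disjoint_family_on_def)
    with U union show ?case by (simp add: set_lebesgue_integral_def)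
  qed (use box in auto)
  then show "(\<integral>x\<in>A. f x \<partial>lborel) = (\<integral>x\<in>A. 0 \<partial>lborel)"
    by (simp add: set_lebesgue_integral_def)
qed auto


text \<open>
  A smooth approximation from below to the indicator of a box.
\<close>

definition box_bump :: "nat \<Rightarrow> 'a::euclidean_space \<Rightarrow> 'a \<Rightarrow> 'a \<Rightarrow> real" where
  "box_bump n a b x = (\<Prod>i\<in>Basis. smooth_step n (x \<bullet> i - a \<bullet> i) * smooth_step n (b \<bullet> i - x \<bullet> i))"

lemma box_bump_bounds: "0 \<le> box_bump n a b x" "box_bump n a b x \<le> 1"
  unfolding box_bump_def
  by (auto intro!: prod_nonneg prod_le_1 mult_nonneg_nonneg mult_le_one simp: smooth_step_bounds)

lemma box_bump_outside: "x \<notin> box a b \<Longrightarrow> box_bump n a b x = 0"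
proof -
  assume "x \<notin> box a b"
  then obtain i where "i \<in> Basis" "x \<bullet> i \<le> a \<bullet> i \<or> b \<bullet> i \<le> x \<bullet> i" by (auto simp: mem_box not_less)
  then have "\<exists>i\<in>Basis. smooth_step n (x \<bullet> i - a \<bullet> i) * smooth_step n (b \<bullet> i - x \<bullet> i) = 0"
    by (intro bexI[of _ i]) auto
  then show ?thesis by (simp add: box_bump_def)
qed

lemma box_bump_tendsto: "(\<lambda>n. box_bump n a b x) \<longlonglongrightarrow> indicator (box a b) x"
proof -
  have "(\<lambda>n. box_bump n a b x) \<longlonglongrightarrow>
      (\<Prod>i\<in>Basis. indicator {0<..} (x \<bullet> i - a \<bullet> i) * indicator {0<..} (b \<bullet> i - x \<bullet> i))"
    unfolding box_bump_def by (intro tendsto_intros smooth_step_tendsto)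
  also have "(\<Prod>i\<in>Basis. indicator {0<..} (x \<bullet> i - a \<bullet> i) * indicator {0<..} (b \<bullet> i - x \<bullet> i))
      = (indicator (box a b) x :: real)"
  proof (cases "x \<in> box a b")
    case False
    then obtain i where "i \<in> Basis" "x \<bullet> i \<le> a \<bullet> i \<or> b \<bullet> i \<le> x \<bullet> i" by (auto simp: mem_box not_less)
    then have "\<exists>i\<in>Basis. indicat_real {0<..} (x \<bullet> i - a \<bullet> i) * indicat_real {0<..} (b \<bullet> i - x \<bullet> i) = 0"
      by (intro bexI[of _ i]) auto
    with False show ?thesis by simp
  qed (auto simp: mem_box)
  finally show ?thesis .
qed

lemma box_bump_test_function:
  assumes "cbox a b \<subseteq> S"
  shows "box_bump n a b \<in> test_functions S"
proof -
  have "{x. box_bump n a b x \<noteq> 0} \<subseteq> cbox a b"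
    using box_bump_outside[of _ a b n] box_subset_cbox[of a b] by blast
  then have sub: "closure {x. box_bump n a b x \<noteq> 0} \<subseteq> cbox a b"
    by (rule closure_minimal) (rule closed_cbox)
  have "continuously_differentiable k (\<lambda>x. x \<bullet> i - a \<bullet> i)" 
    "continuously_differentiable k (\<lambda>x. b \<bullet> i - x \<bullet> i)" for k and i :: 'a
    using continuously_differentiable_add[OF continuously_differentiable_inner continuously_differentiable_const, of k i "- (a \<bullet> i)"]
      continuously_differentiable_add[OF continuously_differentiable_const
          continuously_differentiable_cmult[OF continuously_differentiable_inner, where c = "-1"], of k "b \<bullet> i" i]
    by simp_all
  then have "continuously_differentiable k (box_bump n a b)" for k
    unfolding box_bump_def[abs_def]
    by (intro continuously_differentiable_prod continuously_differentiable_mult continuously_differentiable_smooth_step)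
  moreover have "compact (closure {x. box_bump n a b x \<noteq> 0})"
    using sub compact_Int_closed[OF compact_cbox[of a b] closed_closure[of "{x. box_bump n a b x \<noteq> 0}"]]
    by (simp add: Int_absorb1)
  ultimately show ?thesis
    using sub assms by (auto simp: test_functions_def)
qed

text \<open>
  Testing both weak gradients with the bumps and passing to the limit gives their integrals over the box.
\<close>

lemma weak_gradient_box_integral:
  fixes g g' :: "'a::euclidean_space \<Rightarrow> 'a"
  assumes \<Omega>: "open \<Omega>" and g: "has_weak_gradient \<Omega> u g" and g': "has_weak_gradient \<Omega> u g'"
    and sub: "cbox a b \<subseteq> \<Omega>"
  shows "integrable lebesgue (\<lambda>x. indicator (box a b) x *\<^sub>R (g x - g' x))"
    "(\<integral>x. indicator (box a b) x *\<^sub>R (g x - g' x) \<partial>lebesgue) = 0"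
proof -
  define G where "G x = indicator (cbox a b) x *\<^sub>R (g x - g' x)" for x
  have on: "integrable (lebesgue_on (cbox a b)) g" "integrable (lebesgue_on (cbox a b)) g'"
    using g g' sub by (auto simp: has_weak_gradient_def locally_integrable_def)
  then have G: "integrable lebesgue G"
    unfolding G_def[abs_def] by (subst integrable_restrict_space[symmetric]) (auto intro: Bochner_Integration.integrable_diff)
  have eq: "indicator (box a b) x *\<^sub>R (g x - g' x) = indicator (box a b) x *\<^sub>R G x" for x
    using box_subset_cbox[of a b] by (auto simp: G_def split: split_indicator)
  show "integrable lebesgue (\<lambda>x. indicator (box a b) x *\<^sub>R (g x - g' x))"
    unfolding eq using G by (intro integrable_mult_indicator) auto
  have [measurable]: "box_bump n a b \<in> borel_measurable lebesgue" for n
    using borel_measurable_test_function[OF box_bump_test_function[OF subset_UNIV]]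
    by (intro measurable_completion) simp
  have "(\<lambda>n. \<integral>x. box_bump n a b x *\<^sub>R G x \<partial>lebesgue) \<longlonglongrightarrow> (\<integral>x. indicator (box a b) x *\<^sub>R G x \<partial>lebesgue)"
  proof (rule integral_dominated_convergence)
    show "integrable lebesgue (\<lambda>x. norm (G x))" using G by simp
    show "AE x in lebesgue. (\<lambda>n. box_bump n a b x *\<^sub>R G x) \<longlonglongrightarrow> indicator (box a b) x *\<^sub>R G x"
      by (intro AE_I2 tendsto_intros box_bump_tendsto)
    show "AE x in lebesgue. norm (box_bump n a b x *\<^sub>R G x) \<le> norm (G x)" for n
      by (auto intro!: AE_I2 mult_left_le_one_le simp: box_bump_bounds)
  qed (use G in \<open>auto intro!: borel_measurable_scaleR borel_measurable_indicator\<close>)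
  moreover have "(\<integral>x. box_bump n a b x *\<^sub>R G x \<partial>lebesgue) = 0" for n
  proof -
    note test = box_bump_test_function[OF sub, of n]
    have bump_eq: "indicator \<Omega> x * box_bump n a b x = box_bump n a b x * indicator (cbox a b) x" for x
      using sub box_bump_outside[of x a b n] box_subset_cbox[of a b] by (auto split: split_indicator)
    have "(\<integral>x. box_bump n a b x *\<^sub>R g x \<partial>lebesgue_on \<Omega>) = (\<integral>x. box_bump n a b x *\<^sub>R g' x \<partial>lebesgue_on \<Omega>)"
      using g g' test unfolding has_weak_gradient_def by (metis neg_equal_iff_equal)
    then have "(\<integral>x. box_bump n a b x *\<^sub>R (indicator (cbox a b) x *\<^sub>R g x) \<partial>lebesgue)
        = (\<integral>x. box_bump n a b x *\<^sub>R (indicator (cbox a b) x *\<^sub>R g' x) \<partial>lebesgue)"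
      using \<Omega> by (simp add: integral_restrict_space bump_eq)
    moreover have "integrable lebesgue (\<lambda>x. box_bump n a b x *\<^sub>R (indicator (cbox a b) x *\<^sub>R z x))"
      if "integrable (lebesgue_on (cbox a b)) z" for z :: "'a \<Rightarrow> 'a"
    proof -
      have z: "integrable lebesgue (\<lambda>x. indicator (cbox a b) x *\<^sub>R z x)"
        using that by (subst integrable_restrict_space[symmetric]) auto
      show ?thesis
      proof (rule Bochner_Integration.integrable_bound[OF z])
        show "(\<lambda>x. box_bump n a b x *\<^sub>R (indicator (cbox a b) x *\<^sub>R z x)) \<in> borel_measurable lebesgue"
          by (intro borel_measurable_scaleR borel_measurable_integrable[OF z]) measurable
        show "AE x in lebesgue. norm (box_bump n a b x *\<^sub>R (indicator (cbox a b) x *\<^sub>R z x))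
            \<le> norm (indicator (cbox a b) x *\<^sub>R z x)"
          by (intro AE_I2) (auto simp: box_bump_bounds intro!: mult_left_le_one_le split: split_indicator)
      qed
    qed
    ultimately show ?thesis
      using on by (simp add: G_def scaleR_diff_right)
  qed
  ultimately show "(\<integral>x. indicator (box a b) x *\<^sub>R (g x - g' x) \<partial>lebesgue) = 0"
    by (simp add: eq LIMSEQ_const_iff)
qed

text \<open>
  On a closed box inside \<open>\<Omega>\<close> the difference is integrable and its integral over every subbox vanishes;
  countably many such boxes cover \<open>\<Omega>\<close>.
\<close>

lemma weak_gradient_unique:
  fixes g g' :: "'a::euclidean_space \<Rightarrow> 'a"
  assumes \<Omega>: "open \<Omega>" and g: "has_weak_gradient \<Omega> u g" and g': "has_weak_gradient \<Omega> u g'"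
  shows "AE x in lebesgue_on \<Omega>. g x = g' x"
proof -
  have local: "AE x in lebesgue. x \<in> cbox c d \<longrightarrow> g x = g' x" if sub: "cbox c d \<subseteq> \<Omega>" for c d
  proof -
    define W where "W x = indicator (box c d) x *\<^sub>R (g x - g' x)" for x
    have W: "integrable lebesgue W" "(\<integral>x. W x \<partial>lebesgue) = 0"
      unfolding W_def[abs_def] using weak_gradient_box_integral[OF \<Omega> g g' sub] by auto
    have box: "(\<integral>x. indicator (box a b) x *\<^sub>R W x \<partial>lebesgue) = 0" for a b
    proof -
      obtain e f where ef: "box a b \<inter> box c d = box e f"
        unfolding box_Int_box by blast
      have eq: "indicator (box a b) x *\<^sub>R W x = indicator (box e f) x *\<^sub>R (g x - g' x)" for x
        by (auto simp: W_def ef[symmetric] split: split_indicator)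
      show ?thesis
      proof (cases "box e f = {}")
        case False
        then have "cbox e f = closure (box e f)" by (simp add: closure_box)
        also have "\<dots> \<subseteq> closure (box c d)" using ef by (intro closure_mono) auto
        also have "\<dots> \<subseteq> cbox c d" by (intro closure_minimal box_subset_cbox closed_cbox)
        finally show ?thesis
          unfolding eq using sub by (intro weak_gradient_box_integral(2)[OF \<Omega> g g']) auto
      qed (simp add: eq)
    qed
    have "AE x in lebesgue. W x \<bullet> i = 0" for i
    proof -
      have Wi: "integrable lebesgue (\<lambda>x. W x \<bullet> i)" using W by simp
      then obtain f where f [measurable]: "f \<in> borel_measurable lborel" and AE: "AE x in lborel. W x \<bullet> i = f x"
        using completion_ex_borel_measurable_real[of "\<lambda>x. W x \<bullet> i" lborel] by auto
      have AE': "AE x in lebesgue. W x \<bullet> i = f x" using AE by (rule AE_completion)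
      have f': "f \<in> borel_measurable lebesgue" using f by (rule measurable_completion)
      have "integrable lebesgue f"
        using Wi AE' f' by (subst integrable_cong_AE[symmetric, where f = "\<lambda>x. W x \<bullet> i"]) auto
      then have 1: "integrable lborel f" using f by (simp add: integrable_completion)
      have "AE x in lborel. f x = 0"
      proof (rule AE_zero_if_box_integrals_zero[OF 1])
        have "(\<integral>x. f x \<partial>lborel) = (\<integral>x. f x \<partial>lebesgue)" using f by (simp add: integral_completion)
        also have "\<dots> = (\<integral>x. W x \<bullet> i \<partial>lebesgue)"
          using AE' f' Wi by (intro integral_cong_AE) auto
        finally show "(\<integral>x. f x \<partial>lborel) = 0" using W by simp
        fix a b :: 'a
        have 2: "integrable lebesgue (\<lambda>x. indicator (box a b) x *\<^sub>R W x)"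
          using W by (intro integrable_mult_indicator) auto
        have "(\<integral>x. indicator (box a b) x * f x \<partial>lborel) = (\<integral>x. indicator (box a b) x * f x \<partial>lebesgue)"
          using f by (subst integral_completion) auto
        also have "\<dots> = (\<integral>x. (indicator (box a b) x *\<^sub>R W x) \<bullet> i \<partial>lebesgue)"
          using AE' f' Wi 2 W by (intro integral_cong_AE) (auto intro!: borel_measurable_times borel_measurable_inner borel_measurable_scaleR borel_measurable_indicator)
        also have "\<dots> = 0" using box[of a b] 2 by (subst integral_inner_left) auto
        finally show "(\<integral>x. indicator (box a b) x * f x \<partial>lborel) = 0" .
      qed
      then have "AE x in lebesgue. f x = 0" by (rule AE_completion)
      with AE' show ?thesis by eventually_elim simp
    qed
    then have "AE x in lebesgue. \<forall>i\<in>Basis. W x \<bullet> i = 0" by (intro AE_finite_allI) auto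
    moreover have "AE x in lebesgue. x \<notin> cbox c d - box c d"
      using negligible_frontier_interval[of c d] by (intro AE_not_in) (simp add: negligible_iff_null_sets)
    ultimately show ?thesis
    proof eventually_elim
      case (elim x)
      then have "W x = 0" by (metis euclidean_all_zero_iff)
      with elim(2) show ?case by (auto simp: W_def)
    qed
  qed
  obtain D where D: "countable D" "D \<subseteq> Pow \<Omega>" "\<And>X. X \<in> D \<Longrightarrow> \<exists>a b. X = cbox a b" "\<Union>D = \<Omega>"
    using open_countable_Union_open_cbox[OF \<Omega>] by metis
  have "AE x in lebesgue. \<forall>X\<in>D. x \<in> X \<longrightarrow> g x = g' x"
    unfolding AE_ball_countable[OF D(1)]
  proof
    fix X assume X: "X \<in> D"
    then obtain a b where "X = cbox a b" using D(3) by blast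
    then show "AE x in lebesgue. x \<in> X \<longrightarrow> g x = g' x" using local[of a b] X D(2) by auto
  qed
  then have "AE x in lebesgue. x \<in> \<Omega> \<longrightarrow> g x = g' x"
    by eventually_elim (use D(4) in blast)
  then show ?thesis using \<Omega> by (subst AE_restrict_space_iff) auto
qed


section \<open>Square-integrable functions\<close>

lemma Lp_2_iff:
  "f \<in> Lp 2 S \<longleftrightarrow> f \<in> borel_measurable (lebesgue_on S) \<and>
    (\<integral>\<^sup>+x. ennreal ((norm (f x))\<^sup>2) \<partial>lebesgue_on S) < \<infinity>"
  unfolding Lp_def by (auto simp: integrable_iff_bounded)

lemma nn_integral_square_eq_Lp_norm:
  assumes "f \<in> Lp 2 S"
  shows "(\<integral>\<^sup>+x. ennreal ((norm (f x))\<^sup>2) \<partial>lebesgue_on S) = ennreal ((Lp_norm 2 S f)\<^sup>2)"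
proof -
  have "integrable (lebesgue_on S) (\<lambda>x. (norm (f x))\<^sup>2)" using assms by (simp add: Lp_def)
  then have "(\<integral>\<^sup>+x. ennreal ((norm (f x))\<^sup>2) \<partial>lebesgue_on S) = ennreal (\<integral>x. (norm (f x))\<^sup>2 \<partial>lebesgue_on S)"
    by (intro nn_integral_eq_integral) auto
  also have "(\<integral>x. (norm (f x))\<^sup>2 \<partial>lebesgue_on S) = (Lp_norm 2 S f)\<^sup>2"
    by (simp add: Lp_norm_def powr_half_sqrt)
  finally show ?thesis .
qed

lemma ennreal_power2: "0 \<le> a \<Longrightarrow> ennreal (a\<^sup>2) = (ennreal a)\<^sup>2"
  by (simp add: ennreal_power)

lemma ennreal_add_power2_le: "((a::ennreal) + b)\<^sup>2 \<le> 2 * a\<^sup>2 + 2 * b\<^sup>2"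
proof (cases a; cases b)
  fix x y assume *: "a = ennreal x" "0 \<le> x" "b = ennreal y" "0 \<le> y"
  have "(x + y)\<^sup>2 \<le> 2 * x\<^sup>2 + 2 * y\<^sup>2"
    using sum_squares_bound[of x y] by (simp add: power2_sum)
  then have "ennreal ((x + y)\<^sup>2) \<le> ennreal (2 * x\<^sup>2 + 2 * y\<^sup>2)" by (rule ennreal_leI)
  also have "\<dots> = 2 * (ennreal x)\<^sup>2 + 2 * (ennreal y)\<^sup>2"
    using * by (simp add: ennreal_mult' ennreal_power)
  also have "ennreal ((x + y)\<^sup>2) = (ennreal x + ennreal y)\<^sup>2"
    using * by (simp add: ennreal_power2)
  finally show ?thesis using * by simp
qed (auto simp: power2_eq_square ennreal_mult_top ennreal_top_mult)

lemma norm_diff_power2_le: "ennreal ((norm (a - b))\<^sup>2) \<le> 2 * ennreal ((norm a)\<^sup>2) + 2 * ennreal ((norm b)\<^sup>2)"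
proof -
  have "ennreal (norm (a - b)) \<le> ennreal (norm a) + ennreal (norm b)"
    by (simp add: ennreal_plus[symmetric] norm_triangle_ineq4 del: ennreal_plus)
  from power_mono[OF this, of 2] show ?thesis
    using ennreal_add_power2_le[of "ennreal (norm a)" "ennreal (norm b)"] by (simp add: ennreal_power2)
qed

lemma Lp_2_diff:
  assumes "f \<in> Lp 2 S" "g \<in> Lp 2 S"
  shows "(\<lambda>x. f x - g x) \<in> Lp 2 S"
proof -
  have [measurable]: "f \<in> borel_measurable (lebesgue_on S)" "g \<in> borel_measurable (lebesgue_on S)"
    using assms by (auto simp: Lp_2_iff)
  have "(\<integral>\<^sup>+x. ennreal ((norm (f x - g x))\<^sup>2) \<partial>lebesgue_on S)
      \<le> (\<integral>\<^sup>+x. 2 * ennreal ((norm (f x))\<^sup>2) + 2 * ennreal ((norm (g x))\<^sup>2) \<partial>lebesgue_on S)"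
    by (intro nn_integral_mono norm_diff_power2_le)
  also have "\<dots> = 2 * (\<integral>\<^sup>+x. ennreal ((norm (f x))\<^sup>2) \<partial>lebesgue_on S) + 2 * (\<integral>\<^sup>+x. ennreal ((norm (g x))\<^sup>2) \<partial>lebesgue_on S)"
    by (simp add: nn_integral_add nn_integral_cmult)
  also have "\<dots> < \<infinity>" using assms by (simp add: Lp_2_iff ennreal_mult_less_top)
  finally show ?thesis by (simp add: Lp_2_iff)
qed

lemma nn_integral_lebesgue_on:
  assumes "S \<in> sets borel"
  shows "(\<integral>\<^sup>+x. f x \<partial>lebesgue_on S) = (\<integral>\<^sup>+x. f x * indicator S x \<partial>lborel)"
  using assms by (simp add: nn_integral_restrict_space nn_integral_completion)

lemma borel_measurable_lebesgue_onI: "f \<in> borel_measurable borel \<Longrightarrow> f \<in> borel_measurable (lebesgue_on S)"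
  by (intro measurable_restrict_space1 measurable_completion) simp

lemma Lp_2_borelI:
  assumes "f \<in> borel_measurable borel" "S \<in> sets borel" "(\<integral>\<^sup>+x. ennreal ((norm (f x))\<^sup>2) \<partial>lborel) < \<infinity>"
  shows "f \<in> Lp 2 S"
proof -
  have "(\<integral>\<^sup>+x. ennreal ((norm (f x))\<^sup>2) \<partial>lebesgue_on S) \<le> (\<integral>\<^sup>+x. ennreal ((norm (f x))\<^sup>2) \<partial>lborel)"
    unfolding nn_integral_lebesgue_on[OF assms(2)] by (intro nn_integral_mono) (auto split: split_indicator)
  with assms show ?thesis by (auto simp: Lp_2_iff intro: borel_measurable_lebesgue_onI)
qed

lemma test_function_square_integrable:
  assumes "w \<in> test_functions S"
  shows "(\<integral>\<^sup>+x. ennreal ((norm (w x))\<^sup>2) \<partial>lborel) < \<infinity>" "(\<integral>\<^sup>+x. ennreal ((norm (gradient w x))\<^sup>2) \<partial>lborel) < \<infinity>"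
proof -
  obtain r where r: "w \<in> test_functions (ball 0 r)" using test_function_bounded_support[OF assms] .
  have "integrable lborel (\<lambda>x. (norm (w x))\<^sup>2)" "integrable lborel (\<lambda>x. (norm (gradient w x))\<^sup>2)"
    using test_function_continuous[OF r] continuous_on_gradient[OF r]
    by (auto intro!: integrable_ball_support[where r = r] continuous_intros simp: test_function_zero_outside[OF r])
  then show "(\<integral>\<^sup>+x. ennreal ((norm (w x))\<^sup>2) \<partial>lborel) < \<infinity>" "(\<integral>\<^sup>+x. ennreal ((norm (gradient w x))\<^sup>2) \<partial>lborel) < \<infinity>"
    by (auto simp: integrable_iff_bounded)
qed

lemma test_function_Lp_2:
  assumes "w \<in> test_functions T" "S \<in> sets borel"
  shows "w \<in> Lp 2 S" "gradient w \<in> Lp 2 S"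
  using assms
  by (auto intro!: Lp_2_borelI test_function_square_integrable borel_measurable_test_function borel_measurable_gradient)

section \<open>Radial integration of the gradient\<close>

text \<open>
  For a test function the bound follows from integration along the ray. The excess \<open>Dk k\<close> of the norm of its gradient
  over \<open>G\<close> tends to zero in \<open>L\<^sup>2\<close>, hence so does its ray integral by Hardy's inequality. The part \<open>E\<close>
  by which \<open>u\<close> violates the bound is therefore arbitrarily small in \<open>L\<^sup>2\<close>, so it vanishes.
\<close>

lemma H10_ray_bound:
  fixes u :: "'a::euclidean_space \<Rightarrow> real"
  assumes dim: "DIM('a) > 2" and \<Omega>: "open \<Omega>" "bounded \<Omega>" and u: "u \<in> H10 \<Omega>"
    and g: "has_weak_gradient \<Omega> u g"
    and [measurable]: "G \<in> borel_measurable borel" and G: "AE x in lebesgue_on \<Omega>. norm (g x) \<le> G x"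
    and nonneg: "\<And>x. 0 \<le> G x"
  shows "AE x in lebesgue_on \<Omega>. ennreal \<bar>u x\<bar> \<le> ennreal (norm x) * ray_integral (\<lambda>x. ennreal (G x)) x"
proof -
  from u obtain g' \<phi> where g': "g' \<in> Lp 2 \<Omega>" "has_weak_gradient \<Omega> u g'" and \<phi>: "\<And>k. \<phi> k \<in> test_functions \<Omega>"
    and lim: "(\<lambda>k::nat. Lp_norm 2 \<Omega> (\<lambda>x. \<phi> k x - u x)) \<longlonglongrightarrow> 0"
      "(\<lambda>k. Lp_norm 2 \<Omega> (\<lambda>x. gradient (\<phi> k) x - g' x)) \<longlonglongrightarrow> 0"
    unfolding H10_def by blast
  have u2: "u \<in> Lp 2 \<Omega>" using u by (simp add: H10_def H1_def)
  have \<Omega>b [measurable]: "\<Omega> \<in> sets borel" using \<Omega> by simp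
  obtain r where r: "r > 0" "\<Omega> \<subseteq> ball 0 r" using bounded_subset_ballD[OF \<Omega>(2), of 0] by auto
  note [measurable] = borel_measurable_test_function[OF \<phi>] borel_measurable_gradient[OF \<phi>]
  have [measurable]: "u \<in> borel_measurable (lebesgue_on \<Omega>)" using u2 by (simp add: Lp_2_iff)
  define a where "a k = (Lp_norm 2 \<Omega> (\<lambda>x. gradient (\<phi> k) x - g' x))\<^sup>2" for k
  define b where "b k = (Lp_norm 2 \<Omega> (\<lambda>x. \<phi> k x - u x))\<^sup>2" for k
  have a: "(\<integral>\<^sup>+x. ennreal ((norm (gradient (\<phi> k) x - g' x))\<^sup>2) \<partial>lebesgue_on \<Omega>) = ennreal (a k)" for k
    unfolding a_def by (intro nn_integral_square_eq_Lp_norm Lp_2_diff g' test_function_Lp_2[OF \<phi>] \<Omega>b)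
  have b: "(\<integral>\<^sup>+x. ennreal ((norm (\<phi> k x - u x))\<^sup>2) \<partial>lebesgue_on \<Omega>) = ennreal (b k)" for k
    unfolding b_def by (intro nn_integral_square_eq_Lp_norm Lp_2_diff u2 test_function_Lp_2[OF \<phi>] \<Omega>b)
  define Dk where "Dk k x = ennreal (norm (gradient (\<phi> k) x) - G x)" for k x
  have [measurable]: "Dk k \<in> borel_measurable borel" for k unfolding Dk_def[abs_def] by measurable
  have Dk_int: "(\<integral>\<^sup>+x. (Dk k x)\<^sup>2 \<partial>lborel) \<le> ennreal (a k)" for k
  proof -
    have "(\<integral>\<^sup>+x. (Dk k x)\<^sup>2 \<partial>lborel) = (\<integral>\<^sup>+x. (Dk k x)\<^sup>2 \<partial>lebesgue_on \<Omega>)"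
      unfolding nn_integral_lebesgue_on[OF \<Omega>b]
      by (intro nn_integral_cong)
         (auto simp: Dk_def test_function_zero_outside[OF \<phi>] nonneg ennreal_neg split: split_indicator)
    also have "\<dots> \<le> (\<integral>\<^sup>+x. ennreal ((norm (gradient (\<phi> k) x - g' x))\<^sup>2) \<partial>lebesgue_on \<Omega>)"
    proof (rule nn_integral_mono_AE)
      show "AE x in lebesgue_on \<Omega>. (Dk k x)\<^sup>2 \<le> ennreal ((norm (gradient (\<phi> k) x - g' x))\<^sup>2)"
        using G weak_gradient_unique[OF \<Omega>(1) g g'(2)]
      proof eventually_elim
        case (elim x)
        then have "norm (gradient (\<phi> k) x) - G x \<le> norm (gradient (\<phi> k) x - g' x)"
          using norm_triangle_ineq2[of "gradient (\<phi> k) x" "g' x"] by simp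
        then have "Dk k x \<le> ennreal (norm (gradient (\<phi> k) x - g' x))" unfolding Dk_def by (rule ennreal_leI)
        from power_mono[OF this, of 2] show ?case by (simp add: ennreal_power2)
      qed
    qed
    finally show ?thesis by (simp add: a)
  qed
  \<comment> \<open>The subtraction truncates at zero, so \<open>E\<close> is the positive part of the difference.\<close>
  define E where "E x = ennreal \<bar>u x\<bar> - ennreal (norm x) * ray_integral (\<lambda>x. ennreal (G x)) x" for x
  have E_le: "E x \<le> ennreal (norm (\<phi> k x - u x)) + ennreal (norm x) * ray_integral (Dk k) x" if "x \<noteq> 0" for k x
  proof -
    have "ennreal \<bar>\<phi> k x\<bar> \<le> ennreal (norm x) * ray_integral (\<lambda>x. ennreal (norm (gradient (\<phi> k) x))) x"
      using ray_integral_bound[OF \<phi>[of k] that, of "\<lambda>_. 0" "\<lambda>_. 0"] by (simp add: has_bochner_integral_iff)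
    also have "\<dots> \<le> ennreal (norm x) * ray_integral (\<lambda>x. ennreal (G x) + Dk k x) x"
      by (intro mult_left_mono ray_integral_mono)
         (auto simp: Dk_def ennreal_plus[symmetric] ennreal_plus_if nonneg intro!: ennreal_leI simp del: ennreal_plus)
    also have "\<dots> = ennreal (norm x) * ray_integral (\<lambda>x. ennreal (G x)) x + ennreal (norm x) * ray_integral (Dk k) x"
      by (subst ray_integral_add) (auto simp: distrib_left)
    finally have 1: "ennreal \<bar>\<phi> k x\<bar> \<le> ennreal (norm x) * ray_integral (\<lambda>x. ennreal (G x)) x + ennreal (norm x) * ray_integral (Dk k) x" .
    have "ennreal \<bar>u x\<bar> \<le> ennreal \<bar>\<phi> k x\<bar> + ennreal (norm (\<phi> k x - u x))"
      by (auto simp: ennreal_plus[symmetric] simp del: ennreal_plus intro!: ennreal_leI)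
    also have "\<dots> \<le> ennreal (norm x) * ray_integral (\<lambda>x. ennreal (G x)) x
        + (ennreal (norm (\<phi> k x - u x)) + ennreal (norm x) * ray_integral (Dk k) x)"
      using add_right_mono[OF 1, of "ennreal (norm (\<phi> k x - u x))"] by (simp add: ac_simps)
    finally show ?thesis unfolding E_def by (simp add: ennreal_minus_le_iff)
  qed
  have [measurable]: "(\<lambda>x. ennreal (norm x) * ray_integral F x) \<in> borel_measurable (lebesgue_on \<Omega>)"
    if [measurable]: "F \<in> borel_measurable borel" for F
    by (rule borel_measurable_lebesgue_onI) measurable
  have [measurable]: "E \<in> borel_measurable (lebesgue_on \<Omega>)" "\<phi> k \<in> borel_measurable (lebesgue_on \<Omega>)" for k
    unfolding E_def[abs_def] by (measurable, intro borel_measurable_lebesgue_onI) measurable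
  have "AE x in lebesgue. x \<noteq> 0"
    by (rule AE_completion) (rule AE_lborel_singleton)
  then have "AE x in lebesgue. x \<in> \<Omega> \<longrightarrow> x \<noteq> 0" by eventually_elim simp
  then have ne0: "AE x in lebesgue_on \<Omega>. x \<noteq> 0" using \<Omega> by (simp add: AE_restrict_space_iff)
  have "(\<integral>\<^sup>+x. (E x)\<^sup>2 \<partial>lebesgue_on \<Omega>) \<le> ennreal (2 * b k + 8 * r\<^sup>2 * a k)" for k
  proof -
    have "(\<integral>\<^sup>+x. (E x)\<^sup>2 \<partial>lebesgue_on \<Omega>) \<le> (\<integral>\<^sup>+x. 2 * ennreal ((norm (\<phi> k x - u x))\<^sup>2)
        + 2 * (ennreal (norm x) * ray_integral (Dk k) x)\<^sup>2 \<partial>lebesgue_on \<Omega>)"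
    proof (rule nn_integral_mono_AE)
      show "AE x in lebesgue_on \<Omega>. (E x)\<^sup>2 \<le> 2 * ennreal ((norm (\<phi> k x - u x))\<^sup>2)
          + 2 * (ennreal (norm x) * ray_integral (Dk k) x)\<^sup>2"
        using ne0
      proof eventually_elim
        case (elim x)
        then show ?case
          using order_trans[OF power_mono[OF E_le[OF elim, of k], of 2] ennreal_add_power2_le]
          by (simp add: ennreal_power2 del: real_norm_def)
      qed
    qed
    also have "\<dots> = 2 * ennreal (b k) + 2 * (\<integral>\<^sup>+x. (ennreal (norm x) * ray_integral (Dk k) x)\<^sup>2 \<partial>lebesgue_on \<Omega>)"
      by (simp add: nn_integral_add nn_integral_cmult b[symmetric])
    also have "(\<integral>\<^sup>+x. (ennreal (norm x) * ray_integral (Dk k) x)\<^sup>2 \<partial>lebesgue_on \<Omega>) \<le> ennreal (r\<^sup>2) * (4 * ennreal (a k))"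
    proof -
      have "(\<integral>\<^sup>+x. (ennreal (norm x) * ray_integral (Dk k) x)\<^sup>2 \<partial>lebesgue_on \<Omega>)
          \<le> (\<integral>\<^sup>+x. ennreal (r\<^sup>2) * (ray_integral (Dk k) x)\<^sup>2 \<partial>lborel)"
        unfolding nn_integral_lebesgue_on[OF \<Omega>b]
      proof (intro nn_integral_mono)
        fix x
        show "(ennreal (norm x) * ray_integral (Dk k) x)\<^sup>2 * indicator \<Omega> x \<le> ennreal (r\<^sup>2) * (ray_integral (Dk k) x)\<^sup>2"
          using r by (auto simp: power_mult_distrib ennreal_power2[symmetric] split: split_indicator
              intro!: mult_right_mono ennreal_leI power_mono)
      qed
      also have "\<dots> = ennreal (r\<^sup>2) * (\<integral>\<^sup>+x. (ray_integral (Dk k) x)\<^sup>2 \<partial>lborel)" by (simp add: nn_integral_cmult)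
      also have "\<dots> \<le> ennreal (r\<^sup>2) * (4 * ennreal (a k))"
        by (intro mult_left_mono order_trans[OF Hardy_inequality_ray_integral[OF _ dim]] Dk_int) auto
      finally show ?thesis .
    qed
    also have "2 * ennreal (b k) + 2 * (ennreal (r\<^sup>2) * (4 * ennreal (a k))) = ennreal (2 * b k + 8 * r\<^sup>2 * a k)"
      by (simp add: a_def b_def ennreal_mult' mult_ac)
    finally show ?thesis by (simp add: add_left_mono mult_left_mono)
  qed
  moreover have "(\<lambda>k. ennreal (2 * b k + 8 * r\<^sup>2 * a k)) \<longlonglongrightarrow> ennreal (2 * 0\<^sup>2 + 8 * r\<^sup>2 * 0\<^sup>2)"
    unfolding a_def b_def by (intro tendsto_intros lim)
  ultimately have "(\<integral>\<^sup>+x. (E x)\<^sup>2 \<partial>lebesgue_on \<Omega>) \<le> ennreal (2 * 0\<^sup>2 + 8 * r\<^sup>2 * 0\<^sup>2)"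
    by (intro LIMSEQ_le_const) auto
  then have "AE x in lebesgue_on \<Omega>. (E x)\<^sup>2 = 0"
    by (subst nn_integral_0_iff_AE[symmetric]) auto
  then show ?thesis
  proof eventually_elim
    case (elim x)
    then have "E x = 0" by simp
    then show ?case unfolding E_def by (metis diff_eq_0_iff_ennreal ennreal_less_top less_imp_le linorder_not_le)
  qed
qed

lemma H10_Hardy_functional_bound:
  fixes u :: "'a::euclidean_space \<Rightarrow> real"
  assumes dim: "DIM('a) > 2" and \<Omega>: "open \<Omega>" "bounded \<Omega>" and u: "u \<in> H10 \<Omega>"
    and g: "has_weak_gradient \<Omega> u g"
    and [measurable]: "G \<in> borel_measurable borel" and G: "AE x in lebesgue_on \<Omega>. norm (g x) \<le> G x"
    and nonneg: "\<And>x. 0 \<le> G x"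
  shows "(\<integral>\<^sup>+x. ennreal ((u x)\<^sup>2 / (norm x)\<^sup>2) \<partial>lebesgue_on \<Omega>)
    \<le> (\<integral>\<^sup>+x. (ray_integral (\<lambda>x. ennreal (G x)) x)\<^sup>2 \<partial>lborel)"
proof -
  have "AE x in lebesgue. x \<noteq> 0"
    by (rule AE_completion) (rule AE_lborel_singleton)
  then have "AE x in lebesgue. x \<in> \<Omega> \<longrightarrow> x \<noteq> 0" by eventually_elim simp
  then have ne0: "AE x in lebesgue_on \<Omega>. x \<noteq> 0" using \<Omega> by (simp add: AE_restrict_space_iff)
  have "(\<integral>\<^sup>+x. ennreal ((u x)\<^sup>2 / (norm x)\<^sup>2) \<partial>lebesgue_on \<Omega>)
      \<le> (\<integral>\<^sup>+x. (ray_integral (\<lambda>x. ennreal (G x)) x)\<^sup>2 \<partial>lebesgue_on \<Omega>)"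
  proof (rule nn_integral_mono_AE)
    show "AE x in lebesgue_on \<Omega>. ennreal ((u x)\<^sup>2 / (norm x)\<^sup>2) \<le> (ray_integral (\<lambda>x. ennreal (G x)) x)\<^sup>2"
      using ne0 H10_ray_bound[OF assms]
    proof eventually_elim
      case (elim x)
      have "ennreal (\<bar>u x\<bar> / norm x) = ennreal (1 / norm x) * ennreal \<bar>u x\<bar>"
        by (simp add: ennreal_mult'[symmetric])
      also have "\<dots> \<le> ennreal (1 / norm x) * (ennreal (norm x) * ray_integral (\<lambda>x. ennreal (G x)) x)"
        using elim by (intro mult_left_mono) auto
      also have "\<dots> = ray_integral (\<lambda>x. ennreal (G x)) x"
        using elim by (simp add: mult.assoc[symmetric] ennreal_mult'[symmetric])
      finally show ?case
        using power_mono[of "ennreal (\<bar>u x\<bar> / norm x)" _ 2] by (simp add: ennreal_power2[symmetric] power_divide)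
    qed
  qed
  also have "\<dots> \<le> (\<integral>\<^sup>+x. (ray_integral (\<lambda>x. ennreal (G x)) x)\<^sup>2 \<partial>lborel)"
    unfolding nn_integral_lebesgue_on[OF borel_open[OF \<Omega>(1)]]
    by (intro nn_integral_mono) (auto split: split_indicator)
  finally show ?thesis .
qed


section \<open>The symmetric decreasing rearrangement\<close>

text \<open>
  The profile \<open>I\<close> is the generalized inverse of the distribution function \<open>D\<close>, read off at the volume of the ball of
  radius \<open>r\<close>. Right-continuity of \<open>D\<close> makes \<open>I r \<le> t\<close> and \<open>D t \<le> V * r ^ N\<close> equivalent, so each superlevel
  set is, up to the origin, a ball of the prescribed volume. At the origin, where the profile may be infinite, the value is
  set to zero.
\<close>

lemma symmetric_rearrangement_exists:
  fixes f :: "'a::euclidean_space \<Rightarrow> real"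
  assumes [measurable]: "f \<in> borel_measurable borel" and r: "0 \<le> r"
    and supp: "emeasure lborel {x. 0 < f x} \<le> emeasure lborel (ball (0::'a) r)"
  obtains f' :: "'a \<Rightarrow> real" where "f' \<in> borel_measurable borel" "\<And>x. 0 \<le> f' x" "f' 0 = 0"
    "spherically_symmetric_decreasing_on UNIV f'" "equimeasurable f f'" "\<And>x. x \<notin> ball 0 r \<Longrightarrow> f' x = 0"
proof -
  define N where "N = DIM('a)"
  define V where "V = unit_ball_vol (real N)"
  define D where "D t = measure lborel {x. t < f x}" for t
  define I where "I r = Inf {t. 0 \<le> t \<and> D t \<le> V * r ^ N}" for r :: real
  define f' where "f' x = (if x = 0 then 0 else I (norm x))" for x :: 'a
  have N: "N > 0" by (simp add: N_def)
  have V: "V > 0" by (simp add: V_def)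
  have fin: "emeasure lborel {x. t < f x} \<noteq> \<infinity>" if "0 \<le> t" for t
  proof -
    have "emeasure lborel {x. t < f x} \<le> emeasure lborel {x. 0 < f x}"
      using that by (intro emeasure_mono) auto
    also have "\<dots> < \<infinity>"
      using supp emeasure_bounded_finite[OF bounded_ball, of "0::'a" r] by (simp add: le_less_trans)
    finally show ?thesis by simp
  qed
  have eD: "emeasure lborel {x. t < f x} = ennreal (D t)" if "0 \<le> t" for t
    unfolding D_def using fin[OF that] by (intro emeasure_eq_ennreal_measure) auto
  have anti: "D t \<le> D s" if "0 \<le> s" "s \<le> t" for s t
    unfolding D_def using fin[OF that(1)] that by (intro measure_mono_fmeasurable) (auto simp: fmeasurable_def top.not_eq_extremum)
  have D0: "0 \<le> D t" for t by (simp add: D_def)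
  have vol_mono: "V * r ^ N \<le> V * s ^ N" if "0 \<le> r" "r \<le> s" for r s
    using that V by (intro mult_left_mono power_mono) auto
  have ne: "\<exists>t\<ge>0. D t \<le> V * r ^ N" if "r > 0" for r
  proof -
    have "(\<lambda>n. measure lborel {x. real n < f x}) \<longlonglongrightarrow> measure lborel (\<Inter>n. {x. real n < f x})"
      using fin by (intro Lim_measure_decseq) (auto simp: decseq_def)
    also have "(\<Inter>n. {x. real n < f x}) = {}"
    proof -
      have "x \<notin> (\<Inter>n. {x. real n < f x})" for x
        using real_arch_simple[of "f x"] by (auto simp: not_less)
      then show ?thesis by blast
    qed
    finally have "(\<lambda>n. D (real n)) \<longlonglongrightarrow> 0" by (simp add: D_def)
    moreover have "0 < V * r ^ N" using V that by simp
    ultimately have "\<forall>\<^sub>F n in sequentially. D (real n) < V * r ^ N" by (rule order_tendstoD)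
    then obtain n where "D (real n) < V * r ^ N" by (auto simp: eventually_sequentially)
    then show ?thesis by (intro exI[of _ "real n"]) simp
  qed
  have bdd: "bdd_below {t. 0 \<le> t \<and> D t \<le> V * r ^ N}" for r by (rule bdd_belowI[of _ 0]) auto
  have I0: "0 \<le> I r" if "r > 0" for r
    unfolding I_def using ne[OF that] by (intro cInf_greatest) auto
  have key: "I r \<le> t \<longleftrightarrow> D t \<le> V * r ^ N" if r: "r > 0" and t: "0 \<le> t" for r t
  proof
    assume "D t \<le> V * r ^ N"
    then show "I r \<le> t" unfolding I_def using t by (intro cInf_lower bdd) auto
  next
    assume le: "I r \<le> t"
    have U: "(\<Union>n. {x. I r + 1 / real (Suc n) < f x}) = {x. I r < f x}"
    proof (intro equalityI subsetI)
      fix x assume "x \<in> {x. I r < f x}"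
      then obtain n where "1 / real (Suc n) < f x - I r"
        using nat_approx_posE[of "f x - I r"] by auto
      then show "x \<in> (\<Union>n. {x. I r + 1 / real (Suc n) < f x})" by (auto intro!: exI[of _ n])
    next
      fix x assume "x \<in> (\<Union>n. {x. I r + 1 / real (Suc n) < f x})"
      then obtain n where "I r + 1 / real (Suc n) < f x" by blast
      moreover have "0 < 1 / real (Suc n)" by simp
      ultimately show "x \<in> {x. I r < f x}" by (simp only: mem_Collect_eq)
    qed
    have "D (I r + 1 / real (Suc n)) \<le> V * r ^ N" for n
    proof -
      have "Inf {t. 0 \<le> t \<and> D t \<le> V * r ^ N} < I r + 1 / real (Suc n)" by (simp add: I_def)
      then obtain s where "0 \<le> s" "D s \<le> V * r ^ N" "s < I r + 1 / real (Suc n)"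
        using cInf_lessD ne[OF r] by (metis (mono_tags, lifting) empty_Collect_eq mem_Collect_eq)
      then show ?thesis using anti[of s "I r + 1 / real (Suc n)"] by simp
    qed
    moreover have "(\<lambda>n. measure lborel {x. I r + 1 / real (Suc n) < f x})
        \<longlonglongrightarrow> measure lborel (\<Union>n. {x. I r + 1 / real (Suc n) < f x})"
    proof (rule Lim_measure_incseq)
      show "emeasure lborel (\<Union>n. {x. I r + 1 / real (Suc n) < f x}) \<noteq> \<infinity>"
        unfolding U by (rule fin[OF I0[OF r]])
      show "incseq (\<lambda>n. {x. I r + 1 / real (Suc n) < f x})"
      proof (rule incseq_SucI)
        fix n
        have "1 / real (Suc (Suc n)) \<le> 1 / real (Suc n)" by (intro divide_left_mono) auto
        then show "{x. I r + 1 / real (Suc n) < f x} \<subseteq> {x. I r + 1 / real (Suc (Suc n)) < f x}"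
          by (intro Collect_mono impI) linarith
      qed
    qed auto
    ultimately have "D (I r) \<le> V * r ^ N"
      unfolding D_def U by (intro LIMSEQ_le_const2) auto
    then show "D t \<le> V * r ^ N" using anti[OF I0[OF r] le] by simp
  qed
  have f'0: "0 \<le> f' x" for x using I0 by (simp add: f'_def)
  have level: "{x. t < f' x} = ball 0 (root N (D t / V)) - {0}" if t: "0 \<le> t" for t
  proof -
    have "t < f' x \<longleftrightarrow> norm x < root N (D t / V)" if "x \<noteq> 0" for x
    proof -
      have "t < f' x \<longleftrightarrow> (norm x) ^ N < D t / V"
        using key[of "norm x" t] that t V by (auto simp: f'_def not_le[symmetric] pos_le_divide_eq pos_divide_le_eq mult.commute)
      also have "\<dots> \<longleftrightarrow> root N ((norm x) ^ N) < root N (D t / V)" using N by simp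
      finally show ?thesis using N by (simp add: real_root_power_cancel)
    qed
    then show ?thesis using t by (auto simp: f'_def)
  qed
  show ?thesis
  proof (rule that[of f'])
    show "f' \<in> borel_measurable borel"
      unfolding borel_measurable_iff_greater
    proof
      fix t
      show "{w \<in> space borel. t < f' w} \<in> sets borel"
      proof (cases "0 \<le> t")
        case True
        then show ?thesis using level[OF True] by simp
      next
        case False
        then have "{w \<in> space borel. t < f' w} = UNIV" using f'0 by (auto intro: less_le_trans[of t 0])
        then show ?thesis by simp
      qed
    qed
    show "equimeasurable f f'"
      unfolding equimeasurable_def
    proof (intro allI impI)
      fix t :: real assume t: "0 \<le> t"
      have r: "0 \<le> root N (D t / V)" using N V D0[of t] by simp
      have "emeasure lborel {x. t < f' x} = emeasure lborel (ball 0 (root N (D t / V)) :: 'a set)"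
        unfolding level[OF t] by (rule emeasure_Diff_null_set) auto
      also have "\<dots> = ennreal (V * (root N (D t / V)) ^ N)"
        using emeasure_ball[OF r, of "0 :: 'a"] by (simp add: V_def N_def)
      also have "V * (root N (D t / V)) ^ N = D t" using N V D0[of t] by simp
      finally show "emeasure lborel {x. t < f x} = emeasure lborel {x. t < f' x}" using eD[OF t] by simp
    qed
    show "spherically_symmetric_decreasing_on UNIV f'"
      unfolding spherically_symmetric_decreasing_on_def
    proof (intro ballI impI)
      fix x y :: 'a assume xy: "x \<in> UNIV - {0}" "y \<in> UNIV - {0}" "norm x \<le> norm y"
      then have "D (I (norm x)) \<le> V * norm x ^ N" using key[of "norm x" "I (norm x)"] I0 by simp
      also have "\<dots> \<le> V * norm y ^ N" using xy by (intro vol_mono) auto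
      finally show "f' y \<le> f' x" using key[of "norm y" "I (norm x)"] I0[of "norm x"] xy by (simp add: f'_def)
    qed
    show "f' x = 0" if x: "x \<notin> ball 0 r" for x
    proof (cases "x = 0")
      case False
      have "ennreal (D 0) \<le> ennreal (V * r ^ N)"
        using supp eD[of 0] emeasure_ball[OF r, of "0 :: 'a"] by (simp add: V_def N_def)
      then have "D 0 \<le> V * r ^ N" using V r by (simp add: ennreal_le_iff)
      also have "\<dots> \<le> V * norm x ^ N" using x r by (intro vol_mono) auto
      finally have "f' x \<le> 0" using False key[of "norm x" 0] by (simp add: f'_def)
      with f'0[of x] show ?thesis by simp
    qed (simp add: f'_def)
  qed (use f'0 in \<open>simp_all add: f'_def\<close>)
qed

section \<open>The radial function with prescribed decreasing gradient\<close>

text \<open>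
  The integral of the profile of \<open>f\<close> from \<open>norm x\<close> to infinity, in terms of the ray integral so that the
  estimates for ray integrals apply to it directly.
\<close>

definition radial_potential :: "('a::euclidean_space \<Rightarrow> real) \<Rightarrow> 'a \<Rightarrow> real" where
  "radial_potential f x = norm x * enn2real (ray_integral (\<lambda>y. ennreal (f y)) x)"

definition radial_field :: "('a::euclidean_space \<Rightarrow> real) \<Rightarrow> 'a \<Rightarrow> 'a" where
  "radial_field f x = - (f x / norm x) *\<^sub>R x"

lemma norm_radial_field: "0 \<le> f x \<Longrightarrow> f 0 = 0 \<Longrightarrow> norm (radial_field f x) = f x"
  by (cases "x = 0") (auto simp: radial_field_def)

lemma borel_measurable_radial [measurable]:
  assumes [measurable]: "f \<in> borel_measurable borel"
  shows "radial_potential f \<in> borel_measurable borel" "radial_field f \<in> borel_measurable borel"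
  unfolding radial_potential_def[abs_def] radial_field_def[abs_def] by measurable

text \<open>
  Away from the origin the integrand is bounded by its value at \<open>x\<close> and vanishes once the ray leaves the ball.
\<close>

lemma ray_integral_finite:
  assumes f: "spherically_symmetric_decreasing_on UNIV f"
    and zero: "\<And>x. x \<notin> ball 0 r \<Longrightarrow> f x = 0" and x: "x \<noteq> 0"
  shows "ray_integral (\<lambda>y. ennreal (f y)) x < \<infinity>"
proof -
  have "ray_integral (\<lambda>y. ennreal (f y)) x \<le> (\<integral>\<^sup>+s. ennreal (f x) * indicator {1..r / norm x} s \<partial>lborel)"
    unfolding ray_integral_def
  proof (intro nn_integral_mono)
    fix s :: real
    have "f (s *\<^sub>R x) \<le> f x" if "1 \<le> s"
    proof -
      have "norm x \<le> norm (s *\<^sub>R x)" using that mult_right_mono[of 1 s "norm x"] by simp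
      moreover have "s *\<^sub>R x \<noteq> 0" using that x by simp
      ultimately show ?thesis using f x unfolding spherically_symmetric_decreasing_on_def by blast
    qed
    moreover have "f (s *\<^sub>R x) = 0" if "1 \<le> s" "r / norm x < s"
      using that x by (intro zero) (auto simp: field_simps)
    ultimately show "ennreal (f (s *\<^sub>R x)) * indicator {1..} s \<le> ennreal (f x) * indicator {1..r / norm x} s"
      by (auto intro: ennreal_leI split: split_indicator)
  qed
  also have "\<dots> < \<infinity>" by (simp add: nn_integral_cmult ennreal_mult_less_top emeasure_lborel_Icc_eq)
  finally show ?thesis .
qed

lemma radial_potential_zero:
  assumes zero: "\<And>x. x \<notin> ball 0 r \<Longrightarrow> f x = 0" and x: "x \<notin> ball 0 r"
  shows "radial_potential f x = 0"
proof -
  have "f (s *\<^sub>R x) = 0" if "1 \<le> s" for s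
    using that x mult_right_mono[of 1 s "norm x"] by (intro zero) auto
  then have "ray_integral (\<lambda>y. ennreal (f y)) x = (\<integral>\<^sup>+s. 0 \<partial>(lborel :: real measure))"
    unfolding ray_integral_def by (intro nn_integral_cong) (auto split: split_indicator)
  then show ?thesis by (simp add: radial_potential_def)
qed

text \<open>
  Substituting \<open>s = t / c\<close> with \<open>c = norm y / norm x\<close> turns the ray from \<open>y\<close> into the part beyond \<open>c\<close> of the ray from \<open>x\<close>.
\<close>

lemma radial_potential_decreasing:
  fixes f :: "'a::euclidean_space \<Rightarrow> real"
  assumes [measurable]: "f \<in> borel_measurable borel"
    and f: "spherically_symmetric_decreasing_on UNIV f"
    and zero: "\<And>x. x \<notin> ball 0 r \<Longrightarrow> f x = 0"
  shows "spherically_symmetric_decreasing_on UNIV (radial_potential f)"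
  unfolding spherically_symmetric_decreasing_on_def
proof (intro ballI impI)
  fix x y :: 'a assume xy: "x \<in> UNIV - {0}" "y \<in> UNIV - {0}" "norm x \<le> norm y"
  define c where "c = norm y / norm x"
  have c: "1 \<le> c" using xy by (simp add: c_def)
  have same: "f (s *\<^sub>R y) = f ((c * s) *\<^sub>R x)" if "1 \<le> s" for s
  proof (rule antisym)
    have "s *\<^sub>R y \<noteq> 0" "(c * s) *\<^sub>R x \<noteq> 0" "norm (s *\<^sub>R y) = norm ((c * s) *\<^sub>R x)"
      using that c xy by (auto simp: c_def)
    then show "f (s *\<^sub>R y) \<le> f ((c * s) *\<^sub>R x)" "f ((c * s) *\<^sub>R x) \<le> f (s *\<^sub>R y)"
      using f unfolding spherically_symmetric_decreasing_on_def by auto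
  qed
  have "ennreal (f (s *\<^sub>R y)) * indicator {1..} s = ennreal (f ((c * s) *\<^sub>R x)) * indicator {c..} (c * s)" for s
    using c same[of s] by (cases "1 \<le> s") auto
  then have "ennreal c * ray_integral (\<lambda>y. ennreal (f y)) y
      = ennreal c * (\<integral>\<^sup>+s. ennreal (f ((c * s) *\<^sub>R x)) * indicator {c..} (c * s) \<partial>lborel)"
    unfolding ray_integral_def by simp
  also have "\<dots> = (\<integral>\<^sup>+s. ennreal (f (s *\<^sub>R x)) * indicator {c..} s \<partial>lborel)"
    using nn_integral_real_affine[of "\<lambda>s. ennreal (f (s *\<^sub>R x)) * indicator {c..} s" c 0] c by simp
  also have "\<dots> \<le> ray_integral (\<lambda>y. ennreal (f y)) x"
    unfolding ray_integral_def using c by (intro nn_integral_mono) (auto split: split_indicator)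
  finally have "enn2real (ennreal c * ray_integral (\<lambda>y. ennreal (f y)) y) \<le> enn2real (ray_integral (\<lambda>y. ennreal (f y)) x)"
    using ray_integral_finite[OF f zero] xy by (intro enn2real_mono) auto
  then have "norm x * (c * enn2real (ray_integral (\<lambda>y. ennreal (f y)) y)) \<le> norm x * enn2real (ray_integral (\<lambda>y. ennreal (f y)) x)"
    using c by (intro mult_left_mono) (auto simp: enn2real_mult)
  then show "radial_potential f y \<le> radial_potential f x"
    using xy by (simp add: radial_potential_def c_def)
qed

lemma radial_field_ray_integral:
  fixes f :: "'a::euclidean_space \<Rightarrow> real"
  assumes [measurable]: "f \<in> borel_measurable borel" and nonneg: "\<And>x. 0 \<le> f x"
    and f: "spherically_symmetric_decreasing_on UNIV f"
    and zero: "\<And>x. x \<notin> ball 0 r \<Longrightarrow> f x = 0" and x: "x \<noteq> 0"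
  shows "has_bochner_integral lborel (\<lambda>s. (radial_field f (s *\<^sub>R x) \<bullet> x) * indicator {1..} s) (- radial_potential f x)"
proof -
  have "has_bochner_integral lborel (\<lambda>s. f (s *\<^sub>R x) * indicator {1..} s) (enn2real (ray_integral (\<lambda>y. ennreal (f y)) x))"
  proof (rule has_bochner_integral_nn_integral)
    have "(\<integral>\<^sup>+s. ennreal (f (s *\<^sub>R x) * indicator {1..} s) \<partial>lborel) = ray_integral (\<lambda>y. ennreal (f y)) x"
      unfolding ray_integral_def by (intro nn_integral_cong) (auto split: split_indicator)
    then show "(\<integral>\<^sup>+s. ennreal (f (s *\<^sub>R x) * indicator {1..} s) \<partial>lborel) = ennreal (enn2real (ray_integral (\<lambda>y. ennreal (f y)) x))"
      using ray_integral_finite[OF f zero x] by (simp add: ennreal_enn2real)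
  qed (auto simp: nonneg)
  then have "has_bochner_integral lborel (\<lambda>s. - norm x * (f (s *\<^sub>R x) * indicator {1..} s)) (- norm x * enn2real (ray_integral (\<lambda>y. ennreal (f y)) x))"
    by (rule has_bochner_integral_mult_right)
  moreover have "- norm x * (f (s *\<^sub>R x) * indicator {1..} s) = (radial_field f (s *\<^sub>R x) \<bullet> x) * indicator {1..} s" for s
    using x by (auto simp: radial_field_def dot_square_norm power2_eq_square split: split_indicator)
  ultimately show ?thesis by (simp add: radial_potential_def)
qed

section \<open>Limits of gradients of test functions\<close>

text \<open>
  The \<open>L\<^sup>2\<close>-closure of the gradients of test functions, for Borel fields. The functions themselves are left out:
  their convergence follows from that of their gradients.
\<close>

definition gradient_limit :: "'a::euclidean_space set \<Rightarrow> ('a \<Rightarrow> 'a) \<Rightarrow> bool" where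
  "gradient_limit S h \<longleftrightarrow> h \<in> borel_measurable borel \<and>
    (\<forall>\<delta>>0. \<exists>w\<in>test_functions S. (\<integral>\<^sup>+x. ennreal ((norm (gradient w x - h x))\<^sup>2) \<partial>lborel) \<le> ennreal \<delta>)"

lemma nn_integral_norm_diff_power2_le:
  fixes f g h :: "'a::euclidean_space \<Rightarrow> 'b::euclidean_space"
  assumes [measurable]: "f \<in> borel_measurable borel" "g \<in> borel_measurable borel"
    and eq: "\<And>x. h x = f x - g x"
  shows "(\<integral>\<^sup>+x. ennreal ((norm (h x))\<^sup>2) \<partial>lborel)
    \<le> 2 * (\<integral>\<^sup>+x. ennreal ((norm (f x))\<^sup>2) \<partial>lborel) + 2 * (\<integral>\<^sup>+x. ennreal ((norm (g x))\<^sup>2) \<partial>lborel)"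
proof -
  have "(\<integral>\<^sup>+x. ennreal ((norm (h x))\<^sup>2) \<partial>lborel)
      \<le> (\<integral>\<^sup>+x. 2 * ennreal ((norm (f x))\<^sup>2) + 2 * ennreal ((norm (g x))\<^sup>2) \<partial>lborel)"
    unfolding eq by (intro nn_integral_mono norm_diff_power2_le)
  then show ?thesis by (simp add: nn_integral_add nn_integral_cmult)
qed

lemma gradient_limit_approx:
  assumes [measurable]: "h \<in> borel_measurable borel"
    and approx: "\<And>\<delta>. \<delta> > 0 \<Longrightarrow>
      \<exists>k. gradient_limit S k \<and> (\<integral>\<^sup>+x. ennreal ((norm (h x - k x))\<^sup>2) \<partial>lborel) \<le> ennreal \<delta>"
  shows "gradient_limit S h"
  unfolding gradient_limit_def
proof (intro conjI allI impI)
  fix \<delta> :: real assume \<delta>: "\<delta> > 0"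
  then obtain k where k: "gradient_limit S k" "(\<integral>\<^sup>+x. ennreal ((norm (h x - k x))\<^sup>2) \<partial>lborel) \<le> ennreal (\<delta> / 4)"
    using approx[of "\<delta> / 4"] by auto
  have [measurable]: "k \<in> borel_measurable borel" using k by (simp add: gradient_limit_def)
  have "\<delta> / 4 > 0" using \<delta> by simp
  then obtain w where w: "w \<in> test_functions S" "(\<integral>\<^sup>+x. ennreal ((norm (gradient w x - k x))\<^sup>2) \<partial>lborel) \<le> ennreal (\<delta> / 4)"
    using k(1) unfolding gradient_limit_def by blast
  note [measurable] = borel_measurable_gradient[OF w(1)]
  have "(\<integral>\<^sup>+x. ennreal ((norm (gradient w x - h x))\<^sup>2) \<partial>lborel)
      \<le> 2 * (\<integral>\<^sup>+x. ennreal ((norm (gradient w x - k x))\<^sup>2) \<partial>lborel) + 2 * (\<integral>\<^sup>+x. ennreal ((norm (h x - k x))\<^sup>2) \<partial>lborel)"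
    by (rule nn_integral_norm_diff_power2_le) auto
  also have "\<dots> \<le> 2 * ennreal (\<delta> / 4) + 2 * ennreal (\<delta> / 4)"
    using w k by (intro add_mono mult_left_mono) auto
  also have "\<dots> = ennreal (2 * (\<delta> / 4)) + ennreal (2 * (\<delta> / 4))" using \<delta> by (simp only: ennreal_mult') simp
  also have "\<dots> = ennreal \<delta>" using \<delta> by (simp add: ennreal_plus[symmetric] del: ennreal_plus)
  finally show "\<exists>w\<in>test_functions S. (\<integral>\<^sup>+x. ennreal ((norm (gradient w x - h x))\<^sup>2) \<partial>lborel) \<le> ennreal \<delta>"
    using w(1) by blast
qed fact

lemma gradient_limit_gradient: "w \<in> test_functions S \<Longrightarrow> gradient_limit S (gradient w)"
  unfolding gradient_limit_def by (auto intro!: borel_measurable_gradient bexI[of _ w])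

lemma gradient_limit_zero: "gradient_limit S (\<lambda>_. 0)"
proof -
  have "gradient (\<lambda>_::'a. 0) = (\<lambda>_. 0)" by (rule ext, rule gradient_eqI) simp
  then show ?thesis using gradient_limit_gradient[OF zero_test_function, of S] by simp
qed

lemma gradient_limit_AE:
  fixes h :: "'a::euclidean_space \<Rightarrow> 'a"
  assumes "gradient_limit S k" and [measurable]: "h \<in> borel_measurable borel" and AE: "AE x in lborel. h x = k x"
  shows "gradient_limit S h"
proof (rule gradient_limit_approx)
  have "(\<integral>\<^sup>+x. ennreal ((norm (h x - k x))\<^sup>2) \<partial>lborel) = (\<integral>\<^sup>+x. 0 \<partial>(lborel :: 'a measure))"
    using AE by (intro nn_integral_cong_AE) (auto elim: eventually_mono)
  then show "\<exists>k. gradient_limit S k \<and> (\<integral>\<^sup>+x. ennreal ((norm (h x - k x))\<^sup>2) \<partial>lborel) \<le> ennreal \<delta>" for \<delta>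
    using assms(1) by auto
qed fact

lemma gradient_limit_dominated:
  fixes h :: "'a::euclidean_space \<Rightarrow> 'a"
  assumes k: "\<And>n. gradient_limit S (k n)" and [measurable]: "h \<in> borel_measurable borel"
    and lim: "\<And>x. (\<lambda>n. k n x) \<longlonglongrightarrow> h x"
    and [measurable]: "F \<in> borel_measurable borel" and dom: "\<And>n x. norm (k n x) \<le> F x"
    and F: "(\<integral>\<^sup>+x. ennreal ((F x)\<^sup>2) \<partial>lborel) < \<infinity>"
  shows "gradient_limit S h"
proof (rule gradient_limit_approx)
  fix \<delta> :: real assume \<delta>: "\<delta> > 0"
  have [measurable]: "k n \<in> borel_measurable borel" for n using k by (simp add: gradient_limit_def)
  have h: "norm (h x) \<le> F x" for x
    using lim dom by (intro LIMSEQ_le_const2[OF tendsto_norm[OF lim[of x]]]) auto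
  have "(\<lambda>n. \<integral>\<^sup>+x. ennreal ((norm (h x - k n x))\<^sup>2) \<partial>lborel) \<longlonglongrightarrow> (\<integral>\<^sup>+x. 0 \<partial>(lborel :: 'a measure))"
  proof (rule nn_integral_dominated_convergence)
    show "AE x in lborel. ennreal ((norm (h x - k n x))\<^sup>2) \<le> 4 * ennreal ((F x)\<^sup>2)" for n
    proof (rule AE_I2)
      fix x
      have "norm (h x - k n x) \<le> 2 * F x" using norm_triangle_ineq4[of "h x" "k n x"] h[of x] dom[of n x] by simp
      from power_mono[OF this, of 2] have "(norm (h x - k n x))\<^sup>2 \<le> 4 * (F x)\<^sup>2" by (simp add: power_mult_distrib)
      then show "ennreal ((norm (h x - k n x))\<^sup>2) \<le> 4 * ennreal ((F x)\<^sup>2)"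
        using ennreal_leI by (fastforce simp: ennreal_mult')
    qed
    show "(\<integral>\<^sup>+x. 4 * ennreal ((F x)\<^sup>2) \<partial>lborel) < \<infinity>" using F by (simp add: nn_integral_cmult ennreal_mult_less_top)
    show "AE x in lborel. (\<lambda>n. ennreal ((norm (h x - k n x))\<^sup>2)) \<longlonglongrightarrow> 0"
    proof (rule AE_I2)
      fix x
      have "(\<lambda>n. ennreal ((norm (h x - k n x))\<^sup>2)) \<longlonglongrightarrow> ennreal ((norm (h x - h x))\<^sup>2)"
        by (intro tendsto_intros lim)
      then show "(\<lambda>n. ennreal ((norm (h x - k n x))\<^sup>2)) \<longlonglongrightarrow> 0" by simp
    qed
  qed auto
  then have "(\<lambda>n. \<integral>\<^sup>+x. ennreal ((norm (h x - k n x))\<^sup>2) \<partial>lborel) \<longlonglongrightarrow> 0" by simp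
  then have "\<forall>\<^sub>F n in sequentially. (\<integral>\<^sup>+x. ennreal ((norm (h x - k n x))\<^sup>2) \<partial>lborel) < ennreal \<delta>"
    by (rule order_tendstoD) (use \<delta> in simp)
  then obtain n where "(\<integral>\<^sup>+x. ennreal ((norm (h x - k n x))\<^sup>2) \<partial>lborel) < ennreal \<delta>"
    by (auto simp: eventually_sequentially)
  then show "\<exists>k. gradient_limit S k \<and> (\<integral>\<^sup>+x. ennreal ((norm (h x - k x))\<^sup>2) \<partial>lborel) \<le> ennreal \<delta>"
    using k by (intro exI[of _ "k n"]) auto
qed fact

lemma gradient_limit_add:
  assumes h: "gradient_limit S h" and k: "gradient_limit S k"
  shows "gradient_limit S (\<lambda>x. h x + k x)"
  unfolding gradient_limit_def
proof (intro conjI allI impI)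
  have [measurable]: "h \<in> borel_measurable borel" "k \<in> borel_measurable borel"
    using h k by (auto simp: gradient_limit_def)
  show "(\<lambda>x. h x + k x) \<in> borel_measurable borel" by measurable
  fix \<delta> :: real assume \<delta>: "\<delta> > 0"
  then have "\<delta> / 4 > 0" by simp
  then obtain w z where w: "w \<in> test_functions S" "(\<integral>\<^sup>+x. ennreal ((norm (gradient w x - h x))\<^sup>2) \<partial>lborel) \<le> ennreal (\<delta> / 4)"
    and z: "z \<in> test_functions S" "(\<integral>\<^sup>+x. ennreal ((norm (gradient z x - k x))\<^sup>2) \<partial>lborel) \<le> ennreal (\<delta> / 4)"
    using h k unfolding gradient_limit_def by meson
  note [measurable] = borel_measurable_gradient[OF w(1)] borel_measurable_gradient[OF z(1)]
  have "(\<integral>\<^sup>+x. ennreal ((norm (gradient (\<lambda>x. w x + z x) x - (h x + k x)))\<^sup>2) \<partial>lborel)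
      \<le> 2 * (\<integral>\<^sup>+x. ennreal ((norm (gradient w x - h x))\<^sup>2) \<partial>lborel) + 2 * (\<integral>\<^sup>+x. ennreal ((norm (k x - gradient z x))\<^sup>2) \<partial>lborel)"
    by (rule nn_integral_norm_diff_power2_le) (auto simp: gradient_add[OF w(1) z(1)])
  also have "\<dots> \<le> 2 * ennreal (\<delta> / 4) + 2 * ennreal (\<delta> / 4)"
    using w z by (intro add_mono mult_left_mono) (auto simp: norm_minus_commute)
  also have "\<dots> = ennreal (2 * (\<delta> / 4)) + ennreal (2 * (\<delta> / 4))" using \<delta> by (simp only: ennreal_mult') simp
  also have "\<dots> = ennreal \<delta>" using \<delta> by (simp add: ennreal_plus[symmetric] del: ennreal_plus)
  finally show "\<exists>w\<in>test_functions S. (\<integral>\<^sup>+x. ennreal ((norm (gradient w x - (h x + k x)))\<^sup>2) \<partial>lborel) \<le> ennreal \<delta>"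
    using test_functions_add[OF w(1) z(1)] by blast
qed

lemma gradient_limit_scaleR:
  assumes h: "gradient_limit S h"
  shows "gradient_limit S (\<lambda>x. c *\<^sub>R h x)"
  unfolding gradient_limit_def
proof (intro conjI allI impI)
  have [measurable]: "h \<in> borel_measurable borel" using h by (auto simp: gradient_limit_def)
  show "(\<lambda>x. c *\<^sub>R h x) \<in> borel_measurable borel" by measurable
  fix \<delta> :: real assume \<delta>: "\<delta> > 0"
  have pos: "c\<^sup>2 + 1 > 0" by (simp add: add_nonneg_pos)
  then have "\<delta> / (c\<^sup>2 + 1) > 0" using \<delta> by simp
  then obtain w where w: "w \<in> test_functions S" "(\<integral>\<^sup>+x. ennreal ((norm (gradient w x - h x))\<^sup>2) \<partial>lborel) \<le> ennreal (\<delta> / (c\<^sup>2 + 1))"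
    using h unfolding gradient_limit_def by meson
  note [measurable] = borel_measurable_gradient[OF w(1)]
  have "(\<integral>\<^sup>+x. ennreal ((norm (gradient (\<lambda>x. c * w x) x - c *\<^sub>R h x))\<^sup>2) \<partial>lborel)
      = ennreal (c\<^sup>2) * (\<integral>\<^sup>+x. ennreal ((norm (gradient w x - h x))\<^sup>2) \<partial>lborel)"
    by (subst nn_integral_cmult[symmetric])
       (auto simp: gradient_cmult[OF w(1)] scaleR_diff_right[symmetric] power_mult_distrib ennreal_mult')
  also have "\<dots> \<le> ennreal (c\<^sup>2) * ennreal (\<delta> / (c\<^sup>2 + 1))" by (intro mult_left_mono w) simp
  also have "\<dots> = ennreal (c\<^sup>2 * (\<delta> / (c\<^sup>2 + 1)))" by (rule ennreal_mult'[symmetric]) simp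
  also have "\<dots> \<le> ennreal \<delta>"
    using pos \<delta> by (intro ennreal_leI) (simp add: pos_divide_le_eq algebra_simps)
  finally show "\<exists>w\<in>test_functions S. (\<integral>\<^sup>+x. ennreal ((norm (gradient w x - c *\<^sub>R h x))\<^sup>2) \<partial>lborel) \<le> ennreal \<delta>"
    using test_functions_mult[OF w(1) continuously_differentiable_const, of c] by blast
qed

lemma gradient_limit_sum:
  "(\<And>i. i \<in> I \<Longrightarrow> gradient_limit S (h i)) \<Longrightarrow> gradient_limit S (\<lambda>x. \<Sum>i\<in>I. h i x)"
  by (induction I rule: infinite_finite_induct) (auto intro: gradient_limit_zero gradient_limit_add)


text \<open>
  Composing with \<open>x \<bullet> x\<close>, which is smooth at the origin, keeps radial functions smooth: take the primitive of a smooth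
  step in that variable, normalized to vanish beyond \<open>b\<^sup>2\<close>. The factor \<open>1/2\<close> cancels the derivative of the square.
\<close>

lemma radial_test_function:
  fixes b R :: real
  assumes b: "0 < b" "b < R"
  obtains w :: "'a::euclidean_space \<Rightarrow> real" where "w \<in> test_functions (ball 0 R)"
    "\<And>x. gradient w x = - smooth_step n (b\<^sup>2 - x \<bullet> x) *\<^sub>R x"
proof -
  define \<psi> where "\<psi> s = smooth_step n (b\<^sup>2 - s)" for s
  have "continuously_differentiable 0 (\<lambda>s::real. smooth_step n (b\<^sup>2 + (-1) * (s \<bullet> 1)))"
    by (intro continuously_differentiable_smooth_step continuously_differentiable_add
        continuously_differentiable_const continuously_differentiable_cmult continuously_differentiable_inner)
  then have "continuous_on UNIV \<psi>" by (simp add: \<psi>_def[abs_def])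
  then have \<psi>_cont: "continuous_on A \<psi>" for A by (rule continuous_on_subset) simp
  have \<psi>_int: "\<psi> integrable_on {c..d}" for c d
    by (intro integrable_continuous_real \<psi>_cont)
  \<comment> \<open>Starting at \<open>-1\<close> makes \<open>s = x \<bullet> x \<ge> 0\<close> an interior point, so the derivative at the origin is two-sided.\<close>
  define P where "P s = integral {-1..s} \<psi>" for s
  define w where "w x = (1/2) * (P (b\<^sup>2) - P (x \<bullet> x))" for x :: 'a
  have P_deriv: "(P has_real_derivative \<psi> s) (at s)" if "s > -1" for s
  proof -
    have "(P has_real_derivative \<psi> s) (at s within {-1..s + 1})"
      unfolding P_def[abs_def] using that by (intro integral_has_real_derivative \<psi>_cont) auto
    then show ?thesis using that by (simp add: at_within_Icc_at)
  qed
  have D: "(w has_derivative (\<lambda>v. (- \<psi> (x \<bullet> x)) * (x \<bullet> v))) (at x)" for x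
  proof -
    have pos: "x \<bullet> x > -1" using inner_ge_zero[of x] by linarith
    have "((\<lambda>x. P (x \<bullet> x)) has_derivative (\<lambda>v. \<psi> (x \<bullet> x) * (x \<bullet> v + v \<bullet> x))) (at x)"
      by (rule has_derivative_compose[where f = "\<lambda>x. x \<bullet> x" and g = P and x = x and s = UNIV,
              OF _ P_deriv[OF pos, unfolded has_field_derivative_def]])
         (auto intro!: derivative_eq_intros)
    then have "((\<lambda>x. (1/2) * (P (b\<^sup>2) - P (x \<bullet> x))) has_derivative
        (\<lambda>v. (1/2) * (0 - \<psi> (x \<bullet> x) * (x \<bullet> v + v \<bullet> x)))) (at x)"
      by (intro derivative_intros)
    then show ?thesis by (simp add: w_def[abs_def] inner_commute)
  qed
  have w_outside: "w x = 0" if "norm x \<ge> b" for x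
  proof -
    have le: "b\<^sup>2 \<le> x \<bullet> x" using that b by (simp add: dot_square_norm power_mono)
    have "P (b\<^sup>2) + integral {b\<^sup>2..x \<bullet> x} \<psi> = P (x \<bullet> x)"
      unfolding P_def using le zero_le_power2[of b]
      by (intro Henstock_Kurzweil_Integration.integral_combine \<psi>_int) linarith+
    moreover have "integral {b\<^sup>2..x \<bullet> x} \<psi> = integral {b\<^sup>2..x \<bullet> x} (\<lambda>_. 0)"
      by (rule Henstock_Kurzweil_Integration.integral_cong) (simp add: \<psi>_def)
    ultimately show ?thesis by (simp add: w_def)
  qed
  have smooth: "continuously_differentiable (Suc k) w" for k
  proof (rule continuously_differentiable_SucI[OF D])
    fix v :: 'a
    have "continuously_differentiable k (\<lambda>x::'a. (- 1) * smooth_step n (b\<^sup>2 + (-1) * (\<Sum>i\<in>Basis. (x \<bullet> i) * (x \<bullet> i))) * (x \<bullet> v))"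
      by (intro continuously_differentiable_mult continuously_differentiable_cmult continuously_differentiable_smooth_step
          continuously_differentiable_add continuously_differentiable_sum continuously_differentiable_const
          continuously_differentiable_inner)
    then show "continuously_differentiable k (\<lambda>x. (- \<psi> (x \<bullet> x)) * (x \<bullet> v))"
      by (simp add: \<psi>_def euclidean_inner[of x x for x :: 'a, symmetric])
  qed
  have sub: "closure {x. w x \<noteq> 0} \<subseteq> cball 0 b"
  proof (rule closure_minimal)
    have "norm x \<le> b" if "w x \<noteq> 0" for x
      using w_outside[of x] that by (cases "b \<le> norm x") auto
    then show "{x. w x \<noteq> 0} \<subseteq> cball 0 b" by auto
  qed simp
  have "compact (closure {x. w x \<noteq> 0})"
    using sub compact_Int_closed[OF compact_cball[of 0 b] closed_closure[of "{x. w x \<noteq> 0}"]]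
    by (simp add: Int_absorb1)
  moreover have "closure {x. w x \<noteq> 0} \<subseteq> ball 0 R" using sub b by auto
  ultimately have "w \<in> test_functions (ball 0 R)"
    using continuously_differentiable_Suc_D[OF smooth] by (auto simp: test_functions_def)
  moreover have "gradient w x = - smooth_step n (b\<^sup>2 - x \<bullet> x) *\<^sub>R x" for x
    by (rule gradient_eqI) (use D[of x] in \<open>simp add: \<psi>_def\<close>)
  ultimately show ?thesis by (rule that)
qed

text \<open>
  The steps increase to the indicator of the ball. The strict inequality leaves room for their closed supports.
\<close>

lemma gradient_limit_smaller_ball:
  fixes b R :: real
  assumes b: "b < R"
  shows "gradient_limit (ball 0 R) (\<lambda>x::'a::euclidean_space. indicator (ball 0 b) x *\<^sub>R (- x))"
proof (cases "0 < b")
  case True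
  have "\<exists>w. w \<in> test_functions (ball 0 R) \<and> (\<forall>x::'a. gradient w x = - smooth_step n (b\<^sup>2 - x \<bullet> x) *\<^sub>R x)" for n
    using radial_test_function[OF True b, of n] by metis
  then obtain w where w: "\<And>n. w n \<in> test_functions (ball 0 R)"
    "\<And>n x::'a. gradient (w n) x = - smooth_step n (b\<^sup>2 - x \<bullet> x) *\<^sub>R x" by metis
  have ball: "x \<in> ball 0 b \<longleftrightarrow> 0 < b\<^sup>2 - x \<bullet> x" for x :: 'a
  proof -
    have "norm x < b \<longleftrightarrow> (norm x)\<^sup>2 < b\<^sup>2"
      using True power_strict_mono[of "norm x" b 2] power_less_imp_less_base[of "norm x" 2 b] by auto
    then show ?thesis by (simp add: dot_square_norm)
  qed
  show ?thesis
  proof (rule gradient_limit_dominated)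
    show "gradient_limit (ball 0 R) (gradient (w n))" for n by (rule gradient_limit_gradient[OF w(1)])
    show "(\<lambda>n. gradient (w n) x) \<longlonglongrightarrow> indicator (ball 0 b) x *\<^sub>R (- x)" for x
    proof -
      have "(\<lambda>n. - smooth_step n (b\<^sup>2 - x \<bullet> x) *\<^sub>R x) \<longlonglongrightarrow> - indicator {0<..} (b\<^sup>2 - x \<bullet> x) *\<^sub>R x"
        by (intro tendsto_intros smooth_step_tendsto)
      also have "- indicator {0<..} (b\<^sup>2 - x \<bullet> x) *\<^sub>R x = indicator (ball 0 b) x *\<^sub>R (- x)"
        using ball[of x] by (auto split: split_indicator)
      finally show ?thesis by (simp add: w)
    qed
    show "norm (gradient (w n) x) \<le> b * indicator (ball 0 b) x" for n x
      using ball[of x] smooth_step_bounds[of n "b\<^sup>2 - x \<bullet> x"] True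
      by (auto simp: w not_less mult_le_one intro: order_trans[OF mult_left_le_one_le] split: split_indicator)
    have "(\<integral>\<^sup>+x. ennreal ((b * indicator (ball 0 b) x)\<^sup>2) \<partial>(lborel :: 'a measure))
        = (\<integral>\<^sup>+x. ennreal (b\<^sup>2) * indicator (ball 0 b) x \<partial>(lborel :: 'a measure))"
      by (intro nn_integral_cong) (auto split: split_indicator)
    then show "(\<integral>\<^sup>+x. ennreal ((b * indicator (ball 0 b) x)\<^sup>2) \<partial>(lborel :: 'a measure)) < \<infinity>"
      using emeasure_bounded_finite[of "ball (0::'a) b"] by (simp add: nn_integral_cmult_indicator ennreal_mult_less_top)
  qed (auto intro!: borel_measurable_scaleR borel_measurable_times borel_measurable_indicator)
next
  case False
  then have "ball (0::'a) b = {}" by simp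
  then have "(\<lambda>x::'a. indicator (ball 0 b) x *\<^sub>R (- x)) = (\<lambda>_. 0)"
    by (simp only: indicator_simps empty_iff not_False_eq_True scaleR_zero_left)
  then show ?thesis using gradient_limit_zero by simp
qed

lemma gradient_limit_ball:
  fixes b R :: real
  assumes b: "b \<le> R"
  shows "gradient_limit (ball 0 R) (\<lambda>x::'a::euclidean_space. indicator (ball 0 b) x *\<^sub>R (- x))"
proof (rule gradient_limit_dominated)
  show "gradient_limit (ball 0 R) (\<lambda>x::'a. indicator (ball 0 (b - 1 / real (Suc n))) x *\<^sub>R (- x))" for n
    using b by (intro gradient_limit_smaller_ball) (simp add: add_pos_pos less_le_trans[of _ b])
  show "(\<lambda>n. indicat_real (ball 0 (b - 1 / real (Suc n))) x *\<^sub>R (- x)) \<longlonglongrightarrow> indicator (ball 0 b) x *\<^sub>R (- x)" for x :: 'a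
  proof (cases "norm x < b")
    case True
    have "(\<lambda>n. b - 1 / real (Suc n)) \<longlonglongrightarrow> b - 0" by (intro tendsto_intros LIMSEQ_Suc lim_1_over_n)
    then have "\<forall>\<^sub>F n in sequentially. norm x < b - 1 / real (Suc n)"
      using True by (intro order_tendstoD) auto
    then show ?thesis using True by (intro tendsto_eventually) (auto elim!: eventually_mono)
  next
    case False
    have "x \<notin> ball 0 (b - 1 / real (Suc n))" for n
    proof -
      have "b - 1 / real (Suc n) \<le> b" by simp
      then show ?thesis using False by (simp only: mem_ball_0)
    qed
    then show ?thesis using False by simp
  qed
  show "norm (indicator (ball 0 (b - 1 / real (Suc n))) x *\<^sub>R (- x)) \<le> \<bar>b\<bar> * indicator (ball 0 b) x" for n and x :: 'a
  proof -
    have "b - 1 / real (Suc n) \<le> b" by simp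
    then have "norm x < b - 1 / real (Suc n) \<Longrightarrow> norm x < b" by linarith
    then show ?thesis by (auto split: split_indicator simp del: of_nat_Suc)
  qed
  have "(\<integral>\<^sup>+x. ennreal ((\<bar>b\<bar> * indicator (ball 0 b) x)\<^sup>2) \<partial>(lborel :: 'a measure))
      = (\<integral>\<^sup>+x. ennreal (b\<^sup>2) * indicator (ball 0 b) x \<partial>(lborel :: 'a measure))"
    by (intro nn_integral_cong) (auto split: split_indicator)
  then show "(\<integral>\<^sup>+x. ennreal ((\<bar>b\<bar> * indicator (ball 0 b) x)\<^sup>2) \<partial>(lborel :: 'a measure)) < \<infinity>"
    using emeasure_bounded_finite[of "ball (0::'a) b"] by (simp add: nn_integral_cmult_indicator ennreal_mult_less_top)
qed (auto intro!: borel_measurable_scaleR borel_measurable_times borel_measurable_indicator)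

text \<open>
  Unless empty, such a set lies between a punctured open ball and the closed ball of the same radius, which differ by a null set.
\<close>

lemma gradient_limit_norm_decreasing_set:
  fixes S :: "'a::euclidean_space set"
  assumes [measurable]: "S \<in> sets borel" and sub: "S \<subseteq> ball 0 R"
    and down: "\<And>x y. x \<in> S \<Longrightarrow> y \<noteq> 0 \<Longrightarrow> norm y \<le> norm x \<Longrightarrow> y \<in> S"
  shows "gradient_limit (ball 0 R) (\<lambda>x. indicator S x *\<^sub>R (- x))"
proof (cases "S = {}")
  case False
  define \<rho> where "\<rho> = Sup (norm ` S)"
  have bdd: "bdd_above (norm ` S)" using sub by (intro bdd_aboveI[of _ R]) auto
  have upper: "norm x \<le> \<rho>" if "x \<in> S" for x unfolding \<rho>_def using that by (intro cSup_upper bdd) auto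
  have "\<rho> \<le> R" unfolding \<rho>_def using False sub by (intro cSup_least) auto
  have lower: "x \<in> S" if "norm x < \<rho>" "x \<noteq> 0" for x
  proof -
    have "\<exists>r\<in>norm ` S. norm x < r"
      using that(1) False bdd unfolding \<rho>_def by (subst less_cSup_iff[symmetric]) auto
    then obtain y where "y \<in> S" "norm x < norm y" by blast
    then show ?thesis using down[of y x] that by simp
  qed
  have "negligible (sphere (0::'a) \<rho>)" by (rule negligible_sphere)
  then have "sphere (0::'a) \<rho> \<in> null_sets lborel"
    by (simp add: negligible_iff_null_sets null_sets_completion_iff)
  then have "AE x in lborel. x \<notin> sphere (0::'a) \<rho>" by (rule AE_not_in)
  then have "AE x in lborel. indicat_real S x *\<^sub>R (- x) = indicator (ball 0 \<rho>) x *\<^sub>R (- x)"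
  proof eventually_elim
    case (elim x)
    then show ?case using upper[of x] lower[of x] by (auto split: split_indicator)
  qed
  then show ?thesis
    using gradient_limit_ball[OF \<open>\<rho> \<le> R\<close>] by (rule gradient_limit_AE[rotated 2]) measurable
qed (simp add: gradient_limit_zero)

text \<open>
  A layer-cake sum with step \<open>1/m\<close> up to height \<open>m\<close>. It approximates \<open>y\<close> from below while depending on it only
  through the comparisons \<open>j/m < y\<close>, so that it turns superlevel sets into the function.
\<close>

definition layer_sum :: "nat \<Rightarrow> real \<Rightarrow> real" where
  "layer_sum m y = (\<Sum>j\<in>{1..m\<^sup>2}. (1 / real m) * (if real j / real m < y then 1 else 0))"

text \<open>
  The sum counts the \<open>j\<close> with \<open>j < m y\<close>, which are those below the ceiling of \<open>m y\<close>.
\<close>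

lemma layer_sum_eq:
  assumes m: "m > 0" and y: "0 \<le> y"
  shows "layer_sum m y = real (min (nat \<lceil>real m * y\<rceil> - 1) (m\<^sup>2)) / real m"
proof -
  have "real j / real m < y \<longleftrightarrow> j < nat \<lceil>real m * y\<rceil>" for j
    using m by (simp add: pos_divide_less_eq mult.commute zless_nat_eq_int_zless less_ceiling_iff)
  then have "layer_sum m y = (\<Sum>j\<in>{1..m\<^sup>2}. if j < nat \<lceil>real m * y\<rceil> then 1 / real m else 0)"
    by (simp add: layer_sum_def if_distrib cong: if_cong)
  also have "\<dots> = (\<Sum>j\<in>{1..m\<^sup>2} \<inter> {j. j < nat \<lceil>real m * y\<rceil>}. 1 / real m)"
    by (simp add: sum.If_cases)
  also have "{1..m\<^sup>2} \<inter> {j. j < nat \<lceil>real m * y\<rceil>} = {1..min (nat \<lceil>real m * y\<rceil> - 1) (m\<^sup>2)}"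
    by auto
  finally show ?thesis by simp
qed

lemma layer_sum_bounds:
  assumes m: "m > 0" and y: "0 \<le> y"
  shows "0 \<le> layer_sum m y" "layer_sum m y \<le> y" "y \<le> real m \<Longrightarrow> y - 1 / real m \<le> layer_sum m y"
proof -
  let ?c = "nat \<lceil>real m * y\<rceil> - 1"
  show "0 \<le> layer_sum m y" unfolding layer_sum_eq[OF assms] by simp
  have c1: "real ?c \<le> real m * y" using m y by (cases "nat \<lceil>real m * y\<rceil>") (auto, linarith)
  have c2: "real m * y - 1 \<le> real ?c" using m y by linarith
  have "real (min ?c (m\<^sup>2)) \<le> real m * y" using c1 of_nat_mono[OF min.cobounded1[of ?c "m\<^sup>2"], where 'a = real] by linarith
  then show "layer_sum m y \<le> y" unfolding layer_sum_eq[OF assms] using m by (simp add: pos_divide_le_eq mult.commute)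
  assume "y \<le> real m"
  then have "real m * y \<le> real (m\<^sup>2)" using m by (simp add: power2_eq_square)
  then have "real m * y - 1 \<le> real (min ?c (m\<^sup>2))" using c2 by (simp add: min_def)
  then show "y - 1 / real m \<le> layer_sum m y"
    unfolding layer_sum_eq[OF assms] using m by (simp only: pos_le_divide_eq of_nat_0_less_iff) (simp add: algebra_simps)
qed

lemma layer_sum_tendsto:
  assumes y: "0 \<le> y"
  shows "(\<lambda>n. layer_sum (Suc n) y) \<longlonglongrightarrow> y"
proof (rule tendsto_sandwich)
  have "\<forall>\<^sub>F n in sequentially. y \<le> real n" by (rule eventually_sequentiallyI[of "nat \<lceil>y\<rceil>"]) linarith
  then show "\<forall>\<^sub>F n in sequentially. y - 1 / real (Suc n) \<le> layer_sum (Suc n) y"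
    by eventually_elim (intro layer_sum_bounds y; simp)
  show "\<forall>\<^sub>F n in sequentially. layer_sum (Suc n) y \<le> y"
    by (intro always_eventually allI layer_sum_bounds y) simp
  have "(\<lambda>n. y - 1 / real (Suc n)) \<longlonglongrightarrow> y - 0" by (intro tendsto_intros LIMSEQ_Suc lim_1_over_n)
  then show "(\<lambda>n. y - 1 / real (Suc n)) \<longlonglongrightarrow> y" by simp
qed auto

text \<open>
  The field is \<open>p(x) (-x)\<close> with \<open>p(x) = f(x) / norm x\<close>, which decreases in the norm like \<open>f\<close>. Hence the superlevel
  sets of \<open>p\<close> are balls up to null sets, and \<open>p\<close> is a dominated limit of sums of their indicators.
\<close>

lemma gradient_limit_radial_field:
  fixes f :: "'a::euclidean_space \<Rightarrow> real"
  assumes [measurable]: "f \<in> borel_measurable borel" and nonneg: "\<And>x. 0 \<le> f x" and f0: "f 0 = 0"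
    and f: "spherically_symmetric_decreasing_on UNIV f"
    and zero: "\<And>x. x \<notin> ball 0 R \<Longrightarrow> f x = 0" and L2: "(\<integral>\<^sup>+x. ennreal ((f x)\<^sup>2) \<partial>lborel) < \<infinity>"
  shows "gradient_limit (ball 0 R) (radial_field f)"
proof (rule gradient_limit_dominated)
  define p where "p x = f x / norm x" for x
  have [measurable]: "p \<in> borel_measurable borel" unfolding p_def[abs_def] by measurable
  have p: "0 \<le> p x" for x by (simp add: p_def nonneg)
  have level: "gradient_limit (ball 0 R) (\<lambda>x. indicator {x. t < p x} x *\<^sub>R (- x))" if t: "0 \<le> t" for t
  proof (rule gradient_limit_norm_decreasing_set)
    show "{x. t < p x} \<subseteq> ball 0 R" using zero t by (force simp: p_def)
      fix x y :: 'a assume x: "x \<in> {x. t < p x}" and y: "y \<noteq> 0" "norm y \<le> norm x"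
    then have "x \<noteq> 0" using t by (auto simp: p_def)
    then have "f x \<le> f y" using f y unfolding spherically_symmetric_decreasing_on_def by auto
    then have "p x \<le> p y" unfolding p_def using y nonneg by (intro frac_le) auto
    then show "y \<in> {x. t < p x}" using x by simp
  qed measurable
  show "gradient_limit (ball 0 R) (\<lambda>x. layer_sum (Suc n) (p x) *\<^sub>R (- x))" for n
  proof -
    have "gradient_limit (ball 0 R) (\<lambda>x. \<Sum>j\<in>{1..(Suc n)\<^sup>2}. (1 / real (Suc n)) *\<^sub>R
        (indicator {x. real j / real (Suc n) < p x} x *\<^sub>R (- x)))"
      by (intro gradient_limit_sum gradient_limit_scaleR level) auto
    also have "(\<lambda>x. \<Sum>j\<in>{1..(Suc n)\<^sup>2}. (1 / real (Suc n)) *\<^sub>R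
        (indicator {x. real j / real (Suc n) < p x} x *\<^sub>R (- x))) = (\<lambda>x. layer_sum (Suc n) (p x) *\<^sub>R (- x))"
      unfolding layer_sum_def scaleR_sum_left by (intro ext sum.cong) (auto simp: indicator_def)
    finally show ?thesis .
  qed
  have rf: "radial_field f x = p x *\<^sub>R (- x)" for x by (simp add: radial_field_def p_def)
  show "(\<lambda>n. layer_sum (Suc n) (p x) *\<^sub>R (- x)) \<longlonglongrightarrow> radial_field f x" for x
    unfolding rf by (intro tendsto_intros layer_sum_tendsto p)
  show "norm (layer_sum (Suc n) (p x) *\<^sub>R (- x)) \<le> f x" for n x
  proof -
    have "norm (layer_sum (Suc n) (p x) *\<^sub>R (- x)) \<le> p x * norm x"
      using layer_sum_bounds[of "Suc n" "p x"] p[of x] by (simp add: mult_right_mono)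
    also have "\<dots> \<le> f x" using nonneg by (simp add: p_def)
    finally show ?thesis .
  qed
qed (use L2 in auto)

lemma integral_lebesgue_on_eq_lborel:
  fixes F :: "'a::euclidean_space \<Rightarrow> 'b::euclidean_space"
  assumes F: "F \<in> borel_measurable borel" and S: "S \<in> sets borel" and zero: "\<And>x. x \<notin> S \<Longrightarrow> F x = 0"
  shows "(\<integral>x. F x \<partial>lebesgue_on S) = (\<integral>x. F x \<partial>lborel)"
proof -
  have "(\<integral>x. F x \<partial>lebesgue_on S) = (\<integral>x. indicator S x *\<^sub>R F x \<partial>lebesgue)"
    using S by (intro integral_restrict_space) auto
  also have "(\<lambda>x. indicator S x *\<^sub>R F x) = F" using zero by (auto simp: fun_eq_iff split: split_indicator)
  finally show ?thesis using F by (simp add: integral_completion)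
qed

lemma ennreal_power2_le_imp_le: "(a::ennreal)\<^sup>2 \<le> b\<^sup>2 \<Longrightarrow> a \<le> b"
  by (cases a; cases b)
     (auto simp: ennreal_power2[symmetric] power_mono_iff ennreal_le_iff power2_eq_square[of top] ennreal_mult_top top_unique)

lemma integral_mult_Cauchy_Schwarz:
  fixes F :: "'a::euclidean_space \<Rightarrow> real" and H :: "'a \<Rightarrow> 'b::euclidean_space"
  assumes [measurable]: "F \<in> borel_measurable borel" "H \<in> borel_measurable borel"
    and F: "(\<integral>\<^sup>+x. ennreal ((norm (F x))\<^sup>2) \<partial>lborel) \<le> ennreal a" and H: "(\<integral>\<^sup>+x. ennreal ((norm (H x))\<^sup>2) \<partial>lborel) \<le> ennreal b"
    and ab: "0 \<le> a" "0 \<le> b"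
  shows "integrable lborel (\<lambda>x. F x *\<^sub>R H x)" "norm (\<integral>x. F x *\<^sub>R H x \<partial>lborel) \<le> sqrt (a * b)"
proof -
  have "(\<integral>\<^sup>+x. ennreal (norm (F x)) * ennreal (norm (H x)) \<partial>lborel)\<^sup>2
      \<le> (\<integral>\<^sup>+x. (ennreal (norm (F x)))\<^sup>2 \<partial>lborel) * (\<integral>\<^sup>+x. (ennreal (norm (H x)))\<^sup>2 \<partial>lborel)"
    by (intro Cauchy_Schwarz_nn_integral) auto
  also have "\<dots> \<le> ennreal a * ennreal b"
    using F H by (intro mult_mono) (auto simp: ennreal_power2 simp del: real_norm_def)
  also have "\<dots> = (ennreal (sqrt (a * b)))\<^sup>2" using ab by (simp add: ennreal_power2[symmetric] ennreal_mult')
  finally have le: "(\<integral>\<^sup>+x. ennreal (norm (F x)) * ennreal (norm (H x)) \<partial>lborel) \<le> ennreal (sqrt (a * b))"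
    by (rule ennreal_power2_le_imp_le)
  then have le': "(\<integral>\<^sup>+x. ennreal (norm (F x *\<^sub>R H x)) \<partial>lborel) \<le> ennreal (sqrt (a * b))"
    by (simp add: ennreal_mult')
  then show int: "integrable lborel (\<lambda>x. F x *\<^sub>R H x)"
    by (auto simp: integrable_iff_bounded intro: le_less_trans)
  have "ennreal (norm (\<integral>x. F x *\<^sub>R H x \<partial>lborel)) \<le> ennreal (sqrt (a * b))"
    using integral_norm_bound_ennreal[OF int] le' by (rule order_trans)
  then show "norm (\<integral>x. F x *\<^sub>R H x \<partial>lborel) \<le> sqrt (a * b)" using ab by simp
qed


section \<open>Weak gradients of limits of test functions\<close>

text \<open>
  The rate \<open>c / (k + 1)\<close> is the form in which approximating sequences are chosen from \<open>gradient_limit\<close>.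
\<close>

lemma Lp_norm_2_tendsto_0:
  fixes F :: "nat \<Rightarrow> 'a::euclidean_space \<Rightarrow> 'b::euclidean_space"
  assumes F: "\<And>k. F k \<in> borel_measurable borel" and S: "S \<in> sets borel"
    and le: "\<And>k. (\<integral>\<^sup>+x. ennreal ((norm (F k x))\<^sup>2) \<partial>lborel) \<le> ennreal (c / real (Suc k))" and c: "0 \<le> c"
  shows "(\<lambda>k. Lp_norm 2 S (F k)) \<longlonglongrightarrow> 0"
proof (rule tendsto_sandwich[where f = "\<lambda>_. 0" and h = "\<lambda>k. sqrt (c * (1 / real (Suc k)))"])
  have "Lp_norm 2 S (F k) \<le> sqrt (c / real (Suc k))" for k
  proof -
    have "ennreal ((Lp_norm 2 S (F k))\<^sup>2) = (\<integral>\<^sup>+x. ennreal ((norm (F k x))\<^sup>2) \<partial>lebesgue_on S)"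
      using le_less_trans[OF le ennreal_less_top]
      by (intro nn_integral_square_eq_Lp_norm[symmetric] Lp_2_borelI F S) (simp add: top.not_eq_extremum)
    also have "\<dots> \<le> (\<integral>\<^sup>+x. ennreal ((norm (F k x))\<^sup>2) \<partial>lborel)"
      unfolding nn_integral_lebesgue_on[OF S] by (intro nn_integral_mono) (auto split: split_indicator)
    also have "\<dots> \<le> ennreal (c / real (Suc k))" by (rule le)
    finally have "(Lp_norm 2 S (F k))\<^sup>2 \<le> c / real (Suc k)" using c by (simp add: ennreal_le_iff del: of_nat_Suc)
    then show ?thesis by (rule real_le_rsqrt)
  qed
  then show "\<forall>\<^sub>F k in sequentially. Lp_norm 2 S (F k) \<le> sqrt (c * (1 / real (Suc k)))" by simp
  have "(\<lambda>k. sqrt (c * (1 / real (Suc k)))) \<longlonglongrightarrow> sqrt (c * 0)"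
    by (intro tendsto_intros LIMSEQ_Suc lim_1_over_n)
  then show "(\<lambda>k. sqrt (c * (1 / real (Suc k)))) \<longlonglongrightarrow> 0" by simp
qed (auto simp: Lp_norm_def)

lemma integral_mult_limit:
  fixes H :: "'a::euclidean_space \<Rightarrow> 'b::euclidean_space"
  assumes [measurable]: "\<And>k. F k \<in> borel_measurable borel" "H \<in> borel_measurable borel"
    and le: "\<And>k. (\<integral>\<^sup>+x. ennreal ((norm (F k x))\<^sup>2) \<partial>lborel) \<le> ennreal (c / real (Suc k))" and c: "0 \<le> c"
    and H: "(\<integral>\<^sup>+x. ennreal ((norm (H x))\<^sup>2) \<partial>lborel) < \<infinity>"
  shows "(\<lambda>k. \<integral>x. F k x *\<^sub>R H x \<partial>lborel) \<longlonglongrightarrow> 0"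
proof -
  obtain b where b: "(\<integral>\<^sup>+x. ennreal ((norm (H x))\<^sup>2) \<partial>lborel) = ennreal b" "0 \<le> b"
    using H by (cases "\<integral>\<^sup>+x. ennreal ((norm (H x))\<^sup>2) \<partial>lborel") auto
  have bound: "norm (\<integral>x. F k x *\<^sub>R H x \<partial>lborel) \<le> sqrt (c * (1 / real (Suc k)) * b)" for k
  proof -
    have "norm (\<integral>x. F k x *\<^sub>R H x \<partial>lborel) \<le> sqrt (c / real (Suc k) * b)"
      by (rule integral_mult_Cauchy_Schwarz(2)[OF _ _ le[of k] eq_refl[OF b(1)] _ b(2)]) (use c in auto)
    then show ?thesis by (simp only: times_divide_eq_right mult_1_right)
  qed
  show ?thesis
  proof (rule Lim_null_comparison)
    show "\<forall>\<^sub>F k in sequentially. norm (\<integral>x. F k x *\<^sub>R H x \<partial>lborel) \<le> sqrt (c * (1 / real (Suc k)) * b)"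
      by (intro always_eventually allI bound)
    have "(\<lambda>k. sqrt (c * (1 / real (Suc k)) * b)) \<longlonglongrightarrow> sqrt (c * 0 * b)"
      by (intro tendsto_intros LIMSEQ_Suc lim_1_over_n)
    then show "(\<lambda>k. sqrt (c * (1 / real (Suc k)) * b)) \<longlonglongrightarrow> 0" by simp
  qed
qed

lemma locally_integrable_lborelI:
  fixes F :: "'a::euclidean_space \<Rightarrow> 'b::euclidean_space"
  assumes "F \<in> borel_measurable borel" "integrable lborel F"
  shows "locally_integrable S F"
  unfolding locally_integrable_def
proof (intro conjI allI impI)
  show "F \<in> borel_measurable (lebesgue_on S)" using assms(1) by (rule borel_measurable_lebesgue_onI)
  fix C assume "compact C \<and> C \<subseteq> S"
  then have C: "C \<in> sets lebesgue" using fmeasurableD[OF lmeasurable_compact[of C]] by simp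
  have "integrable lebesgue F" using assms by (simp add: integrable_completion)
  then show "integrable (lebesgue_on C) F"
    using C by (subst integrable_restrict_space) (auto intro: integrable_mult_indicator)
qed

text \<open>
  Test functions satisfy the weak identity by integration by parts, and both sides are continuous with respect to
  \<open>L\<^sup>2\<close> convergence. As \<open>v\<close> and \<open>h\<close> vanish outside \<open>S\<close>, all integrals can be taken over the whole space.
\<close>

lemma weak_gradient_limit:
  fixes v :: "'a::euclidean_space \<Rightarrow> real" and h :: "'a \<Rightarrow> 'a"
  assumes [measurable]: "v \<in> borel_measurable borel" "h \<in> borel_measurable borel"
    and S: "open S" "bounded S" and zero: "\<And>x. x \<notin> S \<Longrightarrow> v x = 0" "\<And>x. x \<notin> S \<Longrightarrow> h x = 0"
    and w: "\<And>k. w k \<in> test_functions S" and c: "0 \<le> c"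
    and v_lim: "\<And>k. (\<integral>\<^sup>+x. ennreal ((norm (w k x - v x))\<^sup>2) \<partial>lborel) \<le> ennreal (c / real (Suc k))"
    and h_lim: "\<And>k. (\<integral>\<^sup>+x. ennreal ((norm (gradient (w k) x - h x))\<^sup>2) \<partial>lborel) \<le> ennreal (c / real (Suc k))"
  shows "has_weak_gradient S v h" "v \<in> H10 S" "h \<in> Lp 2 S"
proof -
  note [measurable] = borel_measurable_test_function[OF w] borel_measurable_gradient[OF w]
  have S' [measurable]: "S \<in> sets borel" using S by simp
  have v2: "(\<integral>\<^sup>+x. ennreal ((norm (v x))\<^sup>2) \<partial>lborel) < \<infinity>"
  proof -
    have "(\<integral>\<^sup>+x. ennreal ((norm (v x))\<^sup>2) \<partial>lborel) \<le> 2 * (\<integral>\<^sup>+x. ennreal ((norm (w 0 x))\<^sup>2) \<partial>lborel)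
        + 2 * (\<integral>\<^sup>+x. ennreal ((norm (w 0 x - v x))\<^sup>2) \<partial>lborel)"
      by (rule nn_integral_norm_diff_power2_le) auto
    also have "\<dots> < \<infinity>"
      using test_function_square_integrable(1)[OF w] le_less_trans[OF v_lim ennreal_less_top]
      by (simp add: ennreal_mult_less_top)
    finally show ?thesis .
  qed
  have h2: "(\<integral>\<^sup>+x. ennreal ((norm (h x))\<^sup>2) \<partial>lborel) < \<infinity>"
  proof -
    have "(\<integral>\<^sup>+x. ennreal ((norm (h x))\<^sup>2) \<partial>lborel) \<le> 2 * (\<integral>\<^sup>+x. ennreal ((norm (gradient (w 0) x))\<^sup>2) \<partial>lborel)
        + 2 * (\<integral>\<^sup>+x. ennreal ((norm (gradient (w 0) x - h x))\<^sup>2) \<partial>lborel)"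
      by (rule nn_integral_norm_diff_power2_le) auto
    also have "\<dots> < \<infinity>"
      using test_function_square_integrable(2)[OF w] le_less_trans[OF h_lim ennreal_less_top]
      by (simp add: ennreal_mult_less_top)
    finally show ?thesis .
  qed
  obtain a b where a: "(\<integral>\<^sup>+x. ennreal ((norm (v x))\<^sup>2) \<partial>lborel) \<le> ennreal a" "0 \<le> a"
    and b: "(\<integral>\<^sup>+x. ennreal ((norm (h x))\<^sup>2) \<partial>lborel) \<le> ennreal b" "0 \<le> b"
  proof (cases "\<integral>\<^sup>+x. ennreal ((norm (v x))\<^sup>2) \<partial>lborel"; cases "\<integral>\<^sup>+x. ennreal ((norm (h x))\<^sup>2) \<partial>lborel")
  qed (use v2 h2 that in auto)
  have eS: "emeasure lborel S < \<infinity>" using emeasure_bounded_finite[OF S(2)] by simp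
  have ind: "(\<integral>\<^sup>+x. ennreal ((norm (indicat_real S x))\<^sup>2) \<partial>lborel) \<le> ennreal (measure lborel S)"
  proof -
    have "(\<integral>\<^sup>+x. ennreal ((norm (indicat_real S x))\<^sup>2) \<partial>lborel) = (\<integral>\<^sup>+x. indicator S x \<partial>lborel)"
      by (intro nn_integral_cong) (auto split: split_indicator)
    also have "\<dots> = ennreal (measure lborel S)" using eS by (simp add: emeasure_eq_ennreal_measure)
    finally show ?thesis by simp
  qed
  have v1: "integrable lborel v"
  proof -
    have "integrable lborel (\<lambda>x. v x *\<^sub>R indicat_real S x)"
      by (rule integral_mult_Cauchy_Schwarz(1)[OF _ _ a(1) ind a(2)]) auto
    also have "(\<lambda>x. v x *\<^sub>R indicat_real S x) = v" using zero by (auto simp: fun_eq_iff split: split_indicator)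
    finally show ?thesis .
  qed
  have h1: "integrable lborel h"
  proof -
    have "integrable lborel (\<lambda>x. indicat_real S x *\<^sub>R h x)"
      by (rule integral_mult_Cauchy_Schwarz(1)[OF _ _ ind b(1) _ b(2)]) auto
    also have "(\<lambda>x. indicat_real S x *\<^sub>R h x) = h" using zero by (auto simp: fun_eq_iff split: split_indicator)
    finally show ?thesis .
  qed
  show weak: "has_weak_gradient S v h"
    unfolding has_weak_gradient_def
  proof (intro conjI ballI locally_integrable_lborelI v1 h1)
    fix \<phi> assume \<phi>: "\<phi> \<in> test_functions S"
    note [measurable] = borel_measurable_test_function[OF \<phi>] borel_measurable_gradient[OF \<phi>]
    obtain d e where d: "(\<integral>\<^sup>+x. ennreal ((norm (\<phi> x))\<^sup>2) \<partial>lborel) \<le> ennreal d" "0 \<le> d"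
      and e: "(\<integral>\<^sup>+x. ennreal ((norm (gradient \<phi> x))\<^sup>2) \<partial>lborel) \<le> ennreal e" "0 \<le> e"
    proof (cases "\<integral>\<^sup>+x. ennreal ((norm (\<phi> x))\<^sup>2) \<partial>lborel"; cases "\<integral>\<^sup>+x. ennreal ((norm (gradient \<phi> x))\<^sup>2) \<partial>lborel")
    qed (use test_function_square_integrable[OF \<phi>] that in auto)
    have int: "integrable lborel (\<lambda>x. v x *\<^sub>R gradient \<phi> x)" "integrable lborel (\<lambda>x. \<phi> x *\<^sub>R h x)"
      using integral_mult_Cauchy_Schwarz(1)[OF _ _ a(1) e(1) a(2) e(2)] integral_mult_Cauchy_Schwarz(1)[OF _ _ d(1) b(1) d(2) b(2)] by auto
    have intw: "integrable lborel (\<lambda>x. w k x *\<^sub>R gradient \<phi> x)" "integrable lborel (\<lambda>x. \<phi> x *\<^sub>R gradient (w k) x)" for k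
      using integrable_test_function(4)[OF \<phi>] integrable_test_function(4)[OF w] test_function_continuous[OF w] test_function_continuous[OF \<phi>] by auto
    have "(\<lambda>k. \<integral>x. (w k x - v x) *\<^sub>R gradient \<phi> x \<partial>lborel) \<longlonglongrightarrow> 0"
      using v_lim c by (intro integral_mult_limit[where c = c] test_function_square_integrable[OF \<phi>]) auto
    then have "(\<lambda>k. (\<integral>x. w k x *\<^sub>R gradient \<phi> x \<partial>lborel) - (\<integral>x. v x *\<^sub>R gradient \<phi> x \<partial>lborel)) \<longlonglongrightarrow> 0"
      using int intw by (simp add: scaleR_diff_left)
    then have L1: "(\<lambda>k. - (\<integral>x. \<phi> x *\<^sub>R gradient (w k) x \<partial>lborel)) \<longlonglongrightarrow> (\<integral>x. v x *\<^sub>R gradient \<phi> x \<partial>lborel)"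
      by (simp add: LIM_zero_iff integration_by_parts[OF w \<phi>])
    have "(\<lambda>k. \<integral>x. \<phi> x *\<^sub>R (gradient (w k) x - h x) \<partial>lborel) \<longlonglongrightarrow> 0"
    proof (rule Lim_null_comparison)
      show "\<forall>\<^sub>F k in sequentially. norm (\<integral>x. \<phi> x *\<^sub>R (gradient (w k) x - h x) \<partial>lborel) \<le> sqrt (d * (c * (1 / real (Suc k))))"
      proof (intro always_eventually allI)
        fix k
        show "norm (\<integral>x. \<phi> x *\<^sub>R (gradient (w k) x - h x) \<partial>lborel) \<le> sqrt (d * (c * (1 / real (Suc k))))"
          using integral_mult_Cauchy_Schwarz(2)[OF _ _ d(1) h_lim[of k] d(2)] c by simp
      qed
      have "(\<lambda>k. sqrt (d * (c * (1 / real (Suc k))))) \<longlonglongrightarrow> sqrt (d * (c * 0))"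
        by (intro tendsto_intros LIMSEQ_Suc lim_1_over_n)
      then show "(\<lambda>k. sqrt (d * (c * (1 / real (Suc k))))) \<longlonglongrightarrow> 0" by simp
    qed
    then have "(\<lambda>k. (\<integral>x. \<phi> x *\<^sub>R gradient (w k) x \<partial>lborel) - (\<integral>x. \<phi> x *\<^sub>R h x \<partial>lborel)) \<longlonglongrightarrow> 0"
      using int intw by (simp add: scaleR_diff_right)
    then have "(\<lambda>k. - (\<integral>x. \<phi> x *\<^sub>R gradient (w k) x \<partial>lborel)) \<longlonglongrightarrow> - (\<integral>x. \<phi> x *\<^sub>R h x \<partial>lborel)"
      by (intro tendsto_minus) (simp add: LIM_zero_iff)
    from LIMSEQ_unique[OF L1 this]
    have "(\<integral>x. v x *\<^sub>R gradient \<phi> x \<partial>lborel) = - (\<integral>x. \<phi> x *\<^sub>R h x \<partial>lborel)" .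
    then show "(\<integral>x. v x *\<^sub>R gradient \<phi> x \<partial>lebesgue_on S) = - (\<integral>x. \<phi> x *\<^sub>R h x \<partial>lebesgue_on S)"
      using zero by (simp add: integral_lebesgue_on_eq_lborel)
  qed auto
  show hL: "h \<in> Lp 2 S" by (rule Lp_2_borelI[OF _ S' h2]) measurable
  have vL: "v \<in> Lp 2 S" by (rule Lp_2_borelI[OF _ S' v2]) measurable
  have "(\<lambda>k. Lp_norm 2 S (\<lambda>x. w k x - v x)) \<longlonglongrightarrow> 0"
    by (rule Lp_norm_2_tendsto_0[OF _ S' v_lim c]) measurable
  moreover have "(\<lambda>k. Lp_norm 2 S (\<lambda>x. gradient (w k) x - h x)) \<longlonglongrightarrow> 0"
    by (rule Lp_norm_2_tendsto_0[OF _ S' h_lim c]) measurable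
  ultimately show "v \<in> H10 S"
    unfolding H10_def H1_def using vL hL weak w by blast
qed

text \<open>
  Choose test functions whose gradients converge to the radial field in \<open>L\<^sup>2\<close>. By \<open>ray_integral_bound\<close> and
  Hardy's inequality they converge to the potential, with a squared error at most \<open>4 R\<^sup>2\<close> times that of the gradients.
\<close>

lemma radial_potential_H10:
  fixes f :: "'a::euclidean_space \<Rightarrow> real"
  assumes dim: "DIM('a) > 2" and [measurable]: "f \<in> borel_measurable borel"
    and nonneg: "\<And>x. 0 \<le> f x" and f0: "f 0 = 0" and f: "spherically_symmetric_decreasing_on UNIV f"
    and zero: "\<And>x. x \<notin> ball 0 R \<Longrightarrow> f x = 0" and L2: "(\<integral>\<^sup>+x. ennreal ((f x)\<^sup>2) \<partial>lborel) < \<infinity>"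
  shows "has_weak_gradient (ball 0 R) (radial_potential f) (radial_field f)"
    "radial_potential f \<in> H10 (ball 0 R)"
proof -
  define c where "c = 4 * R\<^sup>2 + 1"
  have "\<exists>w\<in>test_functions (ball 0 R).
      (\<integral>\<^sup>+x. ennreal ((norm (gradient w x - radial_field f x))\<^sup>2) \<partial>lborel) \<le> ennreal (1 / real (Suc k))" for k
    using gradient_limit_radial_field[OF assms(2-7)] unfolding gradient_limit_def by auto
  then obtain w where w: "\<And>k. w k \<in> test_functions (ball 0 R)"
    "\<And>k. (\<integral>\<^sup>+x. ennreal ((norm (gradient (w k) x - radial_field f x))\<^sup>2) \<partial>lborel) \<le> ennreal (1 / real (Suc k))"
    by metis
  note [measurable] = borel_measurable_test_function[OF w(1)] borel_measurable_gradient[OF w(1)]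
  have c: "0 \<le> c" "1 \<le> c" "4 * R\<^sup>2 \<le> c" by (auto simp: c_def)
  have v_lim: "(\<integral>\<^sup>+x. ennreal ((norm (w k x - radial_potential f x))\<^sup>2) \<partial>lborel) \<le> ennreal (c / real (Suc k))" for k
  proof -
    let ?D = "\<lambda>x. ennreal (norm (gradient (w k) x - radial_field f x))"
    have "(\<integral>\<^sup>+x. ennreal ((norm (w k x - radial_potential f x))\<^sup>2) \<partial>lborel)
        \<le> (\<integral>\<^sup>+x. ennreal (R\<^sup>2) * (ray_integral ?D x)\<^sup>2 \<partial>lborel)"
    proof (rule nn_integral_mono_AE)
      show "AE x in lborel. ennreal ((norm (w k x - radial_potential f x))\<^sup>2) \<le> ennreal (R\<^sup>2) * (ray_integral ?D x)\<^sup>2"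
        using AE_lborel_singleton[of "0::'a"]
      proof eventually_elim
        case (elim x)
        show ?case
        proof (cases "x \<in> ball 0 R")
          case True
          have "ennreal (norm (w k x - radial_potential f x)) \<le> ennreal (norm x) * ray_integral ?D x"
            using ray_integral_bound[where v = "radial_potential f" and h = "radial_field f",
                OF w(1) elim borel_measurable_radial(2)[OF assms(2)] radial_field_ray_integral[OF assms(2,3,5,6) elim]] by simp
          also have "\<dots> \<le> ennreal R * ray_integral ?D x" using True by (intro mult_right_mono ennreal_leI) auto
          finally have "ennreal (norm (w k x - radial_potential f x)) \<le> ennreal R * ray_integral ?D x" .
          moreover have "0 \<le> R" using True by (metis mem_ball zero_le_dist less_imp_le order_le_less_trans)
          ultimately show ?thesis
            using power_mono[of "ennreal (norm (w k x - radial_potential f x))" "ennreal R * ray_integral ?D x" 2]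
            by (simp add: ennreal_power2 power_mult_distrib del: real_norm_def)
        next
          case False
          then show ?thesis using radial_potential_zero[of R f x, OF zero False] test_function_zero_outside[OF w(1)] by simp
        qed
      qed
    qed
    also have "\<dots> = ennreal (R\<^sup>2) * (\<integral>\<^sup>+x. (ray_integral ?D x)\<^sup>2 \<partial>lborel)" by (simp add: nn_integral_cmult)
    also have "\<dots> \<le> ennreal (R\<^sup>2) * (4 * (\<integral>\<^sup>+x. (?D x)\<^sup>2 \<partial>lborel))"
      by (intro mult_left_mono Hardy_inequality_ray_integral dim) auto
    also have "\<dots> \<le> ennreal (R\<^sup>2) * (4 * ennreal (1 / real (Suc k)))"
      using w(2)[of k] by (intro mult_left_mono) (auto simp: ennreal_power2)
    also have "\<dots> = ennreal (R\<^sup>2 * (4 * (1 / real (Suc k))))"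
      by (simp only: ennreal_mult' zero_le_power2 zero_le_numeral ennreal_numeral)
    also have "\<dots> \<le> ennreal (c / real (Suc k))"
      using divide_right_mono[OF c(3), of "real (Suc k)"] by (intro ennreal_leI) (simp add: mult.commute del: of_nat_Suc)
    finally show ?thesis .
  qed
  have h_lim: "(\<integral>\<^sup>+x. ennreal ((norm (gradient (w k) x - radial_field f x))\<^sup>2) \<partial>lborel) \<le> ennreal (c / real (Suc k))" for k
    using c(2) by (intro order_trans[OF w(2)] ennreal_leI divide_right_mono) auto
  have *: "radial_potential f x = 0" "radial_field f x = 0" if "x \<notin> ball 0 R" for x
    using radial_potential_zero[of R f x, OF zero that] zero[OF that] by (auto simp: radial_field_def)
  note lim = weak_gradient_limit[OF borel_measurable_radial[OF assms(2)] open_ball bounded_ball * w(1) c(1) v_lim h_lim]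
  show "has_weak_gradient (ball 0 R) (radial_potential f) (radial_field f)" by (rule lim(1))
  show "radial_potential f \<in> H10 (ball 0 R)" by (rule lim(2))
qed


section \<open>Comparison of the quotients\<close>

text \<open>
  For the potential, the inequality between \<open>u(x) / norm x\<close> and the ray integral of the gradient is an equality.
\<close>

lemma nn_integral_radial_potential:
  fixes f :: "'a::euclidean_space \<Rightarrow> real"
  assumes [measurable]: "f \<in> borel_measurable borel"
    and f: "spherically_symmetric_decreasing_on UNIV f"
    and zero: "\<And>x. x \<notin> ball 0 R \<Longrightarrow> f x = 0"
  shows "(\<integral>\<^sup>+x. ennreal ((radial_potential f x)\<^sup>2 / (norm x)\<^sup>2) \<partial>lebesgue_on (ball 0 R))
    = (\<integral>\<^sup>+x. (ray_integral (\<lambda>x. ennreal (f x)) x)\<^sup>2 \<partial>lborel)"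
  unfolding nn_integral_lebesgue_on[OF borel_open[OF open_ball]]
proof (rule nn_integral_cong_AE)
  show "AE x in lborel. ennreal ((radial_potential f x)\<^sup>2 / (norm x)\<^sup>2) * indicator (ball 0 R) x
      = (ray_integral (\<lambda>x. ennreal (f x)) x)\<^sup>2"
    using AE_lborel_singleton[of "0::'a"]
  proof eventually_elim
    case (elim x)
    define r where "r = enn2real (ray_integral (\<lambda>x. ennreal (f x)) x)"
    have r: "ray_integral (\<lambda>x. ennreal (f x)) x = ennreal r" "0 \<le> r"
      using ray_integral_finite[OF f zero elim] by (auto simp: r_def ennreal_enn2real)
    have p: "radial_potential f x = norm x * r" by (simp add: radial_potential_def r_def)
    show ?case
    proof (cases "x \<in> ball 0 R")
      case True
      have "(norm x * r)\<^sup>2 / (norm x)\<^sup>2 = r\<^sup>2" using elim by (simp add: power_mult_distrib)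
      then show ?thesis using True r by (simp add: p ennreal_power2)
    next
      case False
      then have "r = 0" using radial_potential_zero[of R f x, OF zero False] elim by (simp add: p)
      then show ?thesis using False r by simp
    qed
  qed
qed

lemma integral_eq_enn2real_nn_integral:
  assumes "f \<in> borel_measurable M" "\<And>x. 0 \<le> f x"
  shows "(\<integral>x. f x \<partial>M) = enn2real (\<integral>\<^sup>+x. ennreal (f x) \<partial>M)"
  using assms by (intro integral_eq_nn_integral) auto

text \<open>
  Tonelli and the dilations in the ray integral are applied to Borel functions, while gradients are only Lebesgue
  measurable on the domain; extension by zero makes the representative live on the whole space.
\<close>

lemma lebesgue_on_borel_representative:
  fixes f :: "'a::euclidean_space \<Rightarrow> real"
  assumes S: "S \<in> sets borel" and f: "f \<in> borel_measurable (lebesgue_on S)" and nonneg: "\<And>x. 0 \<le> f x"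
  obtains G where "G \<in> borel_measurable borel" "\<And>x. 0 \<le> G x" "\<And>x. x \<notin> S \<Longrightarrow> G x = 0" "AE x in lebesgue_on S. f x = G x"
proof -
  have "(\<lambda>x. if x \<in> S then f x else 0) \<in> borel_measurable lebesgue"
    using f S by (intro borel_measurable_if_I) auto
  then obtain G0 where [measurable]: "G0 \<in> borel_measurable lborel" and AE: "AE x in lborel. (if x \<in> S then f x else 0) = G0 x"
    using completion_ex_borel_measurable_real by blast
  define G where "G x = indicator S x * \<bar>G0 x\<bar>" for x
  have [measurable]: "S \<in> sets borel" by fact
  have "AE x in lebesgue. (if x \<in> S then f x else 0) = G0 x" using AE by (rule AE_completion)
  then have "AE x in lebesgue. x \<in> S \<longrightarrow> f x = G x"
  proof eventually_elim
    case (elim x)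
    then show ?case using nonneg[of x] by (auto simp: G_def)
  qed
  then have "AE x in lebesgue_on S. f x = G x" using S by (subst AE_restrict_space_iff) auto
  moreover have "G \<in> borel_measurable borel" unfolding G_def[abs_def] by measurable
  ultimately show ?thesis by (intro that[of G]) (auto simp: G_def)
qed

lemma nn_integral_representative:
  fixes f G :: "'a::euclidean_space \<Rightarrow> real" and \<phi> :: "real \<Rightarrow> real"
  assumes S: "S \<in> sets borel" and "\<And>x. x \<notin> S \<Longrightarrow> G x = 0" and AE: "AE x in lebesgue_on S. f x = G x" and "\<phi> 0 = 0"
  shows "(\<integral>\<^sup>+x. ennreal (\<phi> (f x)) \<partial>lebesgue_on S) = (\<integral>\<^sup>+x. ennreal (\<phi> (G x)) \<partial>lborel)"
proof -
  have "(\<integral>\<^sup>+x. ennreal (\<phi> (f x)) \<partial>lebesgue_on S) = (\<integral>\<^sup>+x. ennreal (\<phi> (G x)) \<partial>lebesgue_on S)"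
    using AE by (intro nn_integral_cong_AE) (auto elim: eventually_mono)
  also have "\<dots> = (\<integral>\<^sup>+x. ennreal (\<phi> (G x)) \<partial>lborel)"
    unfolding nn_integral_lebesgue_on[OF S] using assms
    by (intro nn_integral_cong) (auto split: split_indicator)
  finally show ?thesis .
qed

lemma emeasure_superlevel_representative:
  fixes f :: "'a::euclidean_space \<Rightarrow> real"
  assumes S: "S \<in> sets borel" and f: "f \<in> borel_measurable (lebesgue_on S)" and [measurable]: "G \<in> borel_measurable borel"
    and zero: "\<And>x. x \<notin> S \<Longrightarrow> G x = 0" and AE: "AE x in lebesgue_on S. f x = G x" and t: "0 \<le> t"
  shows "emeasure lebesgue {x \<in> S. t < f x} = emeasure lborel {x. t < G x}"
proof -
  have "{x \<in> space (lebesgue_on S). t < f x} \<in> sets (lebesgue_on S)" using f by measurable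
  then have "{x \<in> S. t < f x} \<in> sets lebesgue" using S by (simp add: sets_restrict_space_iff)
  moreover have G: "{x. t < G x} \<in> sets borel" by measurable
  moreover have "AE x in lebesgue. x \<in> S \<longrightarrow> f x = G x"
    using AE S by (subst (asm) AE_restrict_space_iff) auto
  then have "AE x in lebesgue. x \<in> {x \<in> S. t < f x} \<longleftrightarrow> x \<in> {x. t < G x}"
  proof eventually_elim
    case (elim x)
    then show ?case using zero[of x] t by (cases "x \<in> S") auto
  qed
  ultimately have "emeasure lebesgue {x \<in> S. t < f x} = emeasure lebesgue {x. t < G x}"
    by (intro emeasure_eq_AE) auto
  then show ?thesis using G by simp
qed

theorem theorem3:
  fixes \<Omega> :: "'a::euclidean_space set" and u :: "'a \<Rightarrow> real" and g :: "'a \<Rightarrow> 'a" and q :: real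
  assumes "DIM('a) > 2" and "1 \<le> q" and "q < 2"
    and "open \<Omega>" and "bounded \<Omega>" and "0 \<in> \<Omega>"
    and "u \<in> H10 \<Omega>" and "has_weak_gradient \<Omega> u g"
    and "AE x in lebesgue_on \<Omega>. 0 \<le> u x"
    and "\<not> (AE x in lebesgue_on \<Omega>. u x = 0)"
  shows "\<exists>v h. v \<in> H10 (symmetrized_ball \<Omega>) \<and> has_weak_gradient (symmetrized_ball \<Omega>) v h \<and>
    spherically_symmetric_decreasing_on (symmetrized_ball \<Omega>) v \<and>
    decreasing_rearrangement (symmetrized_ball \<Omega>) (\<lambda>x. norm (h x))
      = decreasing_rearrangement \<Omega> (\<lambda>x. norm (g x)) \<and>
    ((\<integral>x. (norm (g x))\<^sup>2 \<partial>lebesgue_on \<Omega>)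
        - (real DIM('a) - 2)\<^sup>2 / 4 * (\<integral>x. (u x)\<^sup>2 / (norm x)\<^sup>2 \<partial>lebesgue_on \<Omega>))
      / (Lp_norm q \<Omega> g)\<^sup>2
    \<ge> ((\<integral>x. (norm (h x))\<^sup>2 \<partial>lebesgue_on (symmetrized_ball \<Omega>))
        - (real DIM('a) - 2)\<^sup>2 / 4 * (\<integral>x. (v x)\<^sup>2 / (norm x)\<^sup>2 \<partial>lebesgue_on (symmetrized_ball \<Omega>)))
      / (Lp_norm q (symmetrized_ball \<Omega>) h)\<^sup>2"
proof -
  note \<Omega> = \<open>open \<Omega>\<close> \<open>bounded \<Omega>\<close> and weak = \<open>has_weak_gradient \<Omega> u g\<close>
  have \<Omega>b [measurable]: "\<Omega> \<in> sets borel" using \<Omega> by simp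
  obtain R where R: "0 \<le> R" "symmetrized_ball \<Omega> = ball 0 R"
    using theI'[OF symmetrized_ball_ex1[of \<Omega>]] unfolding symmetrized_ball_def by blast
  have vol: "measure lebesgue (ball (0::'a) R) = measure lebesgue \<Omega>"
    using measure_symmetrized_ball[of \<Omega>] R by simp
  have vol': "emeasure lborel \<Omega> = emeasure lborel (ball (0::'a) R)"
  proof -
    have "measure lborel (ball (0::'a) R) = measure lborel \<Omega>" using vol by simp
    then show ?thesis
      using emeasure_bounded_finite[OF \<Omega>(2)] emeasure_bounded_finite[OF bounded_ball, of "0::'a" R]
      by (simp add: emeasure_eq_ennreal_measure)
  qed
  have g_meas [measurable]: "g \<in> borel_measurable (lebesgue_on \<Omega>)"
    using weak by (simp add: has_weak_gradient_def locally_integrable_def)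
  obtain G where G [measurable]: "G \<in> borel_measurable borel" and G0: "\<And>x. 0 \<le> G x"
    and Gz: "\<And>x. x \<notin> \<Omega> \<Longrightarrow> G x = 0" and gG: "AE x in lebesgue_on \<Omega>. norm (g x) = G x"
    using lebesgue_on_borel_representative[OF \<Omega>b, of "\<lambda>x. norm (g x)"] by auto
  have supp: "emeasure lborel {x. 0 < G x} \<le> emeasure lborel \<Omega>"
  proof (rule emeasure_mono)
    show "{x. 0 < G x} \<subseteq> \<Omega>" using Gz by (metis (mono_tags) less_irrefl mem_Collect_eq subsetI)
  qed simp
  then have supp': "emeasure lborel {x. 0 < G x} \<le> emeasure lborel (ball (0::'a) R)" by (simp add: vol')
  obtain f :: "'a \<Rightarrow> real" where f [measurable]: "f \<in> borel_measurable borel" and f_nonneg: "\<And>x. 0 \<le> f x"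
    and f0: "f 0 = 0" and f_dec: "spherically_symmetric_decreasing_on UNIV f" and Gf: "equimeasurable G f"
    and f_zero: "\<And>x. x \<notin> ball 0 R \<Longrightarrow> f x = 0"
    using symmetric_rearrangement_exists[OF G R(1) supp'] by blast
  define v where "v = radial_potential f"
  \<comment> \<open>The gradient of \<open>v\<close>, of length \<open>f\<close> and pointing towards the origin.\<close>
  define h where "h = radial_field f"
  have norm_h: "norm (h x) = f x" for x unfolding h_def by (rule norm_radial_field[of f, OF f_nonneg f0])
  have v_meas [measurable]: "v \<in> borel_measurable borel" and h_meas [measurable]: "h \<in> borel_measurable borel"
    unfolding v_def h_def by measurable
  have moments: "(\<integral>\<^sup>+x. ennreal (norm (g x) powr p) \<partial>lebesgue_on \<Omega>)
      = (\<integral>\<^sup>+x. ennreal (norm (h x) powr p) \<partial>lebesgue_on (ball 0 R))" if p: "p > 0" for p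
  proof -
    have "(\<integral>\<^sup>+x. ennreal (norm (g x) powr p) \<partial>lebesgue_on \<Omega>) = (\<integral>\<^sup>+x. ennreal (G x powr p) \<partial>lborel)"
      using nn_integral_representative[OF \<Omega>b Gz gG, of "\<lambda>y. y powr p"] by simp
    also have "\<dots> = (\<integral>\<^sup>+x. ennreal (f x powr p) \<partial>lborel)"
      by (rule equimeasurable_nn_integral_powr[OF G f G0 f_nonneg Gf p])
    also have "\<dots> = (\<integral>\<^sup>+x. ennreal (norm (h x) powr p) \<partial>lebesgue_on (ball 0 R))"
      using nn_integral_representative[of "ball 0 R" f "\<lambda>x. norm (h x)" "\<lambda>y. y powr p"] f_zero by (simp add: norm_h)
    finally show ?thesis .
  qed
  have int_eq: "(\<integral>x. norm (g x) powr p \<partial>lebesgue_on \<Omega>) = (\<integral>x. norm (h x) powr p \<partial>lebesgue_on (ball 0 R))" if "p > 0" for p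
    using moments[OF that] borel_measurable_lebesgue_onI[OF h_meas, of "ball 0 R"]
    by (simp add: integral_eq_enn2real_nn_integral)
  have Lq: "Lp_norm q \<Omega> g = Lp_norm q (ball 0 R) h"
    using int_eq[of q] \<open>1 \<le> q\<close> by (simp add: Lp_norm_def)
  have energy: "(\<integral>x. (norm (g x))\<^sup>2 \<partial>lebesgue_on \<Omega>) = (\<integral>x. (norm (h x))\<^sup>2 \<partial>lebesgue_on (ball 0 R))"
    using int_eq[of 2] by simp
  have L2: "(\<integral>\<^sup>+x. ennreal ((f x)\<^sup>2) \<partial>lborel) < \<infinity>"
  proof -
    obtain g' where g': "g' \<in> Lp 2 \<Omega>" "has_weak_gradient \<Omega> u g'" using \<open>u \<in> H10 \<Omega>\<close> by (auto simp: H10_def)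
    have "(\<integral>\<^sup>+x. ennreal ((f x)\<^sup>2) \<partial>lborel) = (\<integral>\<^sup>+x. ennreal ((G x)\<^sup>2) \<partial>lborel)"
      using equimeasurable_nn_integral_powr[OF G f G0 f_nonneg Gf, of 2] by (simp add: G0 f_nonneg)
    also have "\<dots> = (\<integral>\<^sup>+x. ennreal ((norm (g x))\<^sup>2) \<partial>lebesgue_on \<Omega>)"
      using nn_integral_representative[OF \<Omega>b Gz gG, of "\<lambda>y. y\<^sup>2"] by simp
    also have "\<dots> = (\<integral>\<^sup>+x. ennreal ((norm (g' x))\<^sup>2) \<partial>lebesgue_on \<Omega>)"
      using weak_gradient_unique[OF \<Omega>(1) weak g'(2)] by (intro nn_integral_cong_AE) (auto elim: eventually_mono)
    also have "\<dots> < \<infinity>" using g' by (simp add: Lp_2_iff)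
    finally show ?thesis .
  qed
  have v: "has_weak_gradient (ball 0 R) v h" "v \<in> H10 (ball 0 R)"
    using radial_potential_H10[OF assms(1) f f_nonneg f0 f_dec f_zero L2] by (simp_all add: v_def h_def)
  have v_dec: "spherically_symmetric_decreasing_on (ball 0 R) v"
    using radial_potential_decreasing[OF f f_dec f_zero] unfolding v_def spherically_symmetric_decreasing_on_def by blast
  have rearr: "decreasing_rearrangement (ball 0 R) (\<lambda>x. norm (h x)) = decreasing_rearrangement \<Omega> (\<lambda>x. norm (g x))"
  proof -
    have "emeasure lebesgue {x \<in> ball 0 R. t < \<bar>norm (h x)\<bar>} = emeasure lebesgue {x \<in> \<Omega>. t < \<bar>norm (g x)\<bar>}" if t: "0 \<le> t" for t
    proof -
      have "{x \<in> ball 0 R. t < \<bar>norm (h x)\<bar>} = {x. t < f x}"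
      proof -
        have "x \<in> ball 0 R" if "t < f x" for x using f_zero[of x] t that by (cases "x \<in> ball 0 R") auto
        then show ?thesis by (auto simp: norm_h f_nonneg)
      qed
      then have "emeasure lebesgue {x \<in> ball 0 R. t < \<bar>norm (h x)\<bar>} = emeasure lborel {x. t < f x}" by simp
      also have "\<dots> = emeasure lborel {x. t < G x}" using Gf t by (simp add: equimeasurable_def)
      also have "\<dots> = emeasure lebesgue {x \<in> \<Omega>. t < norm (g x)}"
        by (rule emeasure_superlevel_representative[symmetric, OF \<Omega>b _ G Gz gG t]) measurable
      finally show ?thesis by simp
    qed
    \<comment> \<open>The characterizing predicate sees a function only through its distribution and the volume of its domain.\<close>
    then have "is_decreasing_rearrangement (ball 0 R) (\<lambda>x. norm (h x)) = is_decreasing_rearrangement \<Omega> (\<lambda>x. norm (g x))"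
      unfolding is_decreasing_rearrangement_def vol by (auto simp: fun_eq_iff)
    then show ?thesis by (simp add: decreasing_rearrangement_def)
  qed
  have Hardy: "(\<integral>x. (u x)\<^sup>2 / (norm x)\<^sup>2 \<partial>lebesgue_on \<Omega>) \<le> (\<integral>x. (v x)\<^sup>2 / (norm x)\<^sup>2 \<partial>lebesgue_on (ball 0 R))"
  proof -
    have v_int: "(\<integral>\<^sup>+x. ennreal ((v x)\<^sup>2 / (norm x)\<^sup>2) \<partial>lebesgue_on (ball 0 R))
        = (\<integral>\<^sup>+x. (ray_integral (\<lambda>x. ennreal (f x)) x)\<^sup>2 \<partial>lborel)"
      unfolding v_def by (rule nn_integral_radial_potential) (fact f f_dec f_zero)+
    have u_meas: "u \<in> borel_measurable (lebesgue_on \<Omega>)"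
      using weak by (simp add: has_weak_gradient_def locally_integrable_def)
    have "(\<lambda>x. norm x) \<in> borel_measurable (lebesgue_on \<Omega>)"
      by (rule borel_measurable_lebesgue_onI) measurable
    then have u2: "(\<lambda>x. (u x)\<^sup>2 / (norm x)\<^sup>2) \<in> borel_measurable (lebesgue_on \<Omega>)"
      by (intro borel_measurable_divide borel_measurable_power u_meas)
    have v2: "(\<lambda>x. (v x)\<^sup>2 / (norm x)\<^sup>2) \<in> borel_measurable (lebesgue_on (ball 0 R))"
      by (rule borel_measurable_lebesgue_onI) measurable
    have "(\<integral>\<^sup>+x. ennreal ((u x)\<^sup>2 / (norm x)\<^sup>2) \<partial>lebesgue_on \<Omega>) \<le> (\<integral>\<^sup>+x. (ray_integral (\<lambda>x. ennreal (G x)) x)\<^sup>2 \<partial>lborel)"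
      using gG by (intro H10_Hardy_functional_bound[OF assms(1) \<Omega> assms(7) weak G _ G0]) (auto elim: eventually_mono)
    also have "\<dots> \<le> (\<integral>\<^sup>+x. (ray_integral (\<lambda>x. ennreal (f x)) x)\<^sup>2 \<partial>lborel)"
      by (rule ray_integral_rearrangement[OF G f Gf f_dec])
    finally have le: "(\<integral>\<^sup>+x. ennreal ((u x)\<^sup>2 / (norm x)\<^sup>2) \<partial>lebesgue_on \<Omega>)
        \<le> (\<integral>\<^sup>+x. ennreal ((v x)\<^sup>2 / (norm x)\<^sup>2) \<partial>lebesgue_on (ball 0 R))"
      unfolding v_int .
    \<comment> \<open>Finiteness matters: were the right-hand side infinite, its real-valued integral would be 0.\<close>
    have "(\<integral>\<^sup>+x. (ray_integral (\<lambda>x. ennreal (f x)) x)\<^sup>2 \<partial>lborel) \<le> 4 * (\<integral>\<^sup>+x. (ennreal (f x))\<^sup>2 \<partial>lborel)"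
      by (rule Hardy_inequality_ray_integral[OF _ assms(1)]) measurable
    also have "\<dots> < \<infinity>" using L2 f_nonneg by (simp add: ennreal_power2 ennreal_mult_less_top)
    finally have fin: "(\<integral>\<^sup>+x. ennreal ((v x)\<^sup>2 / (norm x)\<^sup>2) \<partial>lebesgue_on (ball 0 R)) < \<infinity>"
      unfolding v_int .
    have "(\<integral>x. (u x)\<^sup>2 / (norm x)\<^sup>2 \<partial>lebesgue_on \<Omega>) = enn2real (\<integral>\<^sup>+x. ennreal ((u x)\<^sup>2 / (norm x)\<^sup>2) \<partial>lebesgue_on \<Omega>)"
      by (rule integral_eq_enn2real_nn_integral[OF u2]) simp
    also have "\<dots> \<le> enn2real (\<integral>\<^sup>+x. ennreal ((v x)\<^sup>2 / (norm x)\<^sup>2) \<partial>lebesgue_on (ball 0 R))"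
      using le fin by (intro enn2real_mono) simp_all
    also have "\<dots> = (\<integral>x. (v x)\<^sup>2 / (norm x)\<^sup>2 \<partial>lebesgue_on (ball 0 R))"
      by (rule integral_eq_enn2real_nn_integral[OF v2, symmetric]) simp
    finally show ?thesis .
  qed
  have "((\<integral>x. (norm (h x))\<^sup>2 \<partial>lebesgue_on (ball 0 R))
        - (real DIM('a) - 2)\<^sup>2 / 4 * (\<integral>x. (v x)\<^sup>2 / (norm x)\<^sup>2 \<partial>lebesgue_on (ball 0 R))) / (Lp_norm q (ball 0 R) h)\<^sup>2
      \<le> ((\<integral>x. (norm (g x))\<^sup>2 \<partial>lebesgue_on \<Omega>)
        - (real DIM('a) - 2)\<^sup>2 / 4 * (\<integral>x. (u x)\<^sup>2 / (norm x)\<^sup>2 \<partial>lebesgue_on \<Omega>)) / (Lp_norm q \<Omega> g)\<^sup>2"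
    unfolding Lq energy using Hardy by (intro divide_right_mono diff_left_mono mult_left_mono) auto
  with v v_dec rearr show ?thesis unfolding R(2) by blast
qed

end
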